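(* Let $p\ge1$ be an integer. Thompson's group $F(p+1)$ is not (synchronously) combable by geodesics with respect to $X=\{x_0,\dots,x_p\}$. That is, there do not exist a constant $k$ and a set $L$ of geodesic words over $X\cup X^{-1}$, containing at least one representative of every element of $F(p+1)$, such that any two words of $L$ representing elements at distance $1$ in the Cayley graph synchronously $k$-fellow travel.
   Context: For an integer $p\ge1$, $F(p+1)$ is the group of piecewise-linear orientation-preserving homeomorphisms of $[0,1]$ with finitely many breakpoints, all in $\mathbb{Z}[\frac1{p+1}]$, and with slopes in the multiplicative group generated by $p+1$; the product is $fg=f\circ g$. Standard finite generating set $X=\{x_0,\dots,x_p\}$: for $0\le i\le p-1$, in the domain divide $[0,1]$ into $p+1$ equal intervals and divide the last of these again into $p+1$ equal intervals; in the range divide $[0,1]$ into $p+1$ equal intervals and divide the $(i+1)$-st (from the left) of these again into $p+1$ equal intervals; $x_i$ maps the $j$-th domain interval affinely and increasingly onto the $j$-th range interval, for each $j=1,\dots,2p+1$. The generator $x_p$ is the identity on $[0,\frac p{p+1}]$ and $x_p(t)=\frac{p+x_0((p+1)t-p)}{p+1}$ on $[\frac p{p+1},1]$. $\Gamma$ is the Cayley graph of $F(p+1)$ with respect to $X$ (edges join $w$ and $wg$, $g\in X\cup X^{-1}$), $d_\Gamma$ its path metric, and $|h|=d_\Gamma(1,h)$. Two geodesic paths $\lambda,\eta$ in $\Gamma$ from the identity to $w$ and $v$ respectively, with $d_\Gamma(w,v)=1$, synchronously $k$-fellow travel if for any vertices $h$ on $\lambda$ and $g$ on $\eta$ with $|h|=|g|$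 one has $d_\Gamma(h,g)\le k$. Two words $k$-fellow travel if the paths from the identity they label do. A group is (synchronously) combable by geodesics if it can be represented by a language of geodesic words satisfying the synchronous $k$-fellow traveller property for some constant $k$. *)

theory Defs
  imports "HOL-Analysis.Analysis" "HOL-Algebra.Group"
begin

text \<open>Cayley graphs and combings, for an arbitrary group G and a set X of generators.
  The Cayley graph is represented by its symmetric edge relation on the carrier, so
  \<^term>\<open>(u, v) \<in> R ^^ n\<close> says that u and v are joined by a path with n edges.\<close>

definition letters :: "('a, 'b) monoid_scheme \<Rightarrow> 'a set \<Rightarrow> 'a set" where
  "letters G X = X \<union> (m_inv G) ` X"

definition cayley_edges :: "('a, 'b) monoid_scheme \<Rightarrow> 'a set \<Rightarrow> ('a \<times> 'a) set" where
  "cayley_edges G X = {(u, u \<otimes>\<^bsub>G\<^esub> g) | u g. u \<in> carrier G \<and> g \<in> letters G X}"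

text \<open>The path metric. It is only meaningful if some path joins the two vertices, which is
  always the case when X generates G.\<close>

definition cayley_dist :: "('a, 'b) monoid_scheme \<Rightarrow> 'a set \<Rightarrow> 'a \<Rightarrow> 'a \<Rightarrow> nat" where
  "cayley_dist G X u v = (LEAST n. (u, v) \<in> cayley_edges G X ^^ n)"

definition cayley_length :: "('a, 'b) monoid_scheme \<Rightarrow> 'a set \<Rightarrow> 'a \<Rightarrow> nat" where
  "cayley_length G X h = cayley_dist G X \<one>\<^bsub>G\<^esub> h"

text \<open>Paths are given by their nonempty lists of vertices.\<close>

definition geodesic_path :: "('a, 'b) monoid_scheme \<Rightarrow> 'a set \<Rightarrow> 'a list \<Rightarrow> bool" where
  "geodesic_path G X vs \<longleftrightarrow>
     vs \<noteq> [] \<and> set vs \<subseteq> carrier G \<and>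
     successively (\<lambda>u v. (u, v) \<in> cayley_edges G X) vs \<and>
     length vs = Suc (cayley_dist G X (hd vs) (last vs))"

definition sync_fellow_travel ::
    "('a, 'b) monoid_scheme \<Rightarrow> 'a set \<Rightarrow> nat \<Rightarrow> 'a list \<Rightarrow> 'a list \<Rightarrow> bool" where
  "sync_fellow_travel G X k vs ws \<longleftrightarrow>
     (\<forall>h\<in>set vs. \<forall>g\<in>set ws.
        cayley_length G X h = cayley_length G X g \<longrightarrow> cayley_dist G X h g \<le> k)"

definition word_val :: "('a, 'b) monoid_scheme \<Rightarrow> 'a list \<Rightarrow> 'a" where
  "word_val G w = foldr (\<lambda>a b. a \<otimes>\<^bsub>G\<^esub> b) w \<one>\<^bsub>G\<^esub>"

text \<open>The path from the identity labelled by a word visits the values of its prefixes.\<close>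

definition word_path :: "('a, 'b) monoid_scheme \<Rightarrow> 'a list \<Rightarrow> 'a list" where
  "word_path G w = map (\<lambda>i. word_val G (take i w)) [0..<Suc (length w)]"

definition geodesic_word :: "('a, 'b) monoid_scheme \<Rightarrow> 'a set \<Rightarrow> 'a list \<Rightarrow> bool" where
  "geodesic_word G X w \<longleftrightarrow> w \<in> lists (letters G X) \<and> geodesic_path G X (word_path G w)"

definition combable_by_geodesics :: "('a, 'b) monoid_scheme \<Rightarrow> 'a set \<Rightarrow> bool" where
  "combable_by_geodesics G X \<longleftrightarrow>
     (\<exists>(k::nat) (L::'a list set).
        (\<forall>w\<in>L. geodesic_word G X w) \<and>
        (\<forall>h\<in>carrier G. \<exists>w\<in>L. word_val G w = h) \<and>
        (\<forall>u\<in>L. \<forall>v\<in>L. cayley_dist G X (word_val G u) (word_val G v) = 1 \<longrightarrow>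
           sync_fellow_travel G X k (word_path G u) (word_path G v)))"

text \<open>Thompson's group F(n). A homeomorphism of the unit interval is represented by its
  extension to the real line by the identity, so that the group operation is
  composition of functions.\<close>

definition nadic :: "nat \<Rightarrow> real set" where
  "nadic n = {real_of_int a / real n ^ k | a k. True}"

text \<open>B contains the breakpoints: between consecutive points of B the function is affine.\<close>

definition thompson_PL :: "nat \<Rightarrow> (real \<Rightarrow> real) \<Rightarrow> bool" where
  "thompson_PL n f \<longleftrightarrow>
     (\<exists>B. finite B \<and> B \<subseteq> nadic n \<and>
        (\<forall>a b. 0 \<le> a \<and> a < b \<and> b \<le> 1 \<and> {a<..<b} \<inter> B = {} \<longrightarrow>
           (\<exists>(j::int) c. \<forall>t\<in>{a..b}. f t = real n powi j * t + c)))"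

definition thompson_set :: "nat \<Rightarrow> (real \<Rightarrow> real) set" where
  "thompson_set n =
     {f. (\<exists>g. homeomorphism {0..1} {0..1} f g) \<and> strict_mono_on {0..1} f \<and>
         thompson_PL n f \<and> (\<forall>t. t \<notin> {0..1} \<longrightarrow> f t = t)}"

definition thompson_F :: "nat \<Rightarrow> (real \<Rightarrow> real) monoid" where
  "thompson_F n = \<lparr>carrier = thompson_set n, mult = (\<lambda>f g. f \<circ> g), one = id\<rparr>"

text \<open>The endpoints (numbered from 0 to 2p+1) of the intervals obtained by dividing the unit
  interval into p+1 equal intervals and then dividing the (i+1)-st of these into p+1 equal
  intervals. For i = p this is the subdivision of the domain of the generators.\<close>

definition subdiv :: "nat \<Rightarrow> nat \<Rightarrow> nat \<Rightarrow> real" where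
  "subdiv p i j =
     (if j \<le> i then real j / real (p + 1)
      else if j \<le> i + p + 1 then real i / real (p + 1) + real (j - i) / (real (p + 1))^2
      else real (j - p) / real (p + 1))"

definition thompson_x_low :: "nat \<Rightarrow> nat \<Rightarrow> real \<Rightarrow> real" where
  "thompson_x_low p i t =
     (if t \<in> {0..1} then
        let j = Max {j. j \<le> 2 * p \<and> subdiv p p j \<le> t};
            d = subdiv p p; r = subdiv p i
        in r j + (t - d j) * ((r (Suc j) - r j) / (d (Suc j) - d j))
      else t)"

definition thompson_x_last :: "nat \<Rightarrow> real \<Rightarrow> real" where
  "thompson_x_last p t =
     (if t \<in> {real p / real (p + 1)..1}
      then (real p + thompson_x_low p 0 (real (p + 1) * t - real p)) / real (p + 1)
      else t)"

definition thompson_x :: "nat \<Rightarrow> nat \<Rightarrow> real \<Rightarrow> real" where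
  "thompson_x p i = (if i < p then thompson_x_low p i else thompson_x_last p)"

definition thompson_gens :: "nat \<Rightarrow> (real \<Rightarrow> real) set" where
  "thompson_gens p = thompson_x p ` {0..p}"

lemma subdiv_strict:
  assumes "i \<le> p" shows "subdiv p i j < subdiv p i (Suc j)"
proof -
  have pos: "real (p+1) > 0" by simp
  consider "j < i" | "i \<le> j" "j < i + p + 1" | "j \<ge> i+p+1" by linarith
  then show ?thesis
  proof cases
    case 1 then show ?thesis by (simp add: subdiv_def divide_strict_right_mono)
  next
    case 2
    then have "real (j - i) < real (Suc j - i)" by auto
    then have "real (j - i)/(real (p+1))^2 < real (Suc j - i)/(real (p+1))^2"
      using pos by (intro divide_strict_right_mono) auto
    then show ?thesis using 2 by (cases "j = i") (auto simp: subdiv_def)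
  next
    case 3
    have "subdiv p i j = real (j - p) / real (p+1)"
    proof (cases "j = i+p+1")
      case True
      have "real (p+1) / (real (p+1))^2 = 1 / real (p+1)"
        using pos by (simp only: power2_eq_square) (simp del: of_nat_add)
      then show ?thesis using True by (simp add: subdiv_def add_divide_distrib del: of_nat_add)
    qed (use 3 in \<open>auto simp: subdiv_def\<close>)
    then show ?thesis using 3 by (auto simp: subdiv_def divide_strict_right_mono)
  qed
qed

lemma subdiv_mono: assumes "i \<le> p" shows "strict_mono (subdiv p i)"
  using subdiv_strict[OF assms] strict_mono_Suc_iff by blast

lemma subdiv_ends: "i \<le> p \<Longrightarrow> subdiv p i 0 = 0" "i \<le> p \<Longrightarrow> subdiv p i (2*p+1) = 1"
proof -
  have "real p + 1 \<noteq> 0" by linarith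
  moreover have "(real p + 1) / (real p + 1)\<^sup>2 = 1 / (real p + 1)"
    by (simp add: power2_eq_square)
  moreover have "real p / (real p + 1) + 1 / (real p + 1) = 1"
    using calculation(1) by (simp add: add_divide_distrib[symmetric])
  ultimately show "i \<le> p \<Longrightarrow> subdiv p i 0 = 0" "i \<le> p \<Longrightarrow> subdiv p i (2*p+1) = 1"
    by (auto simp: subdiv_def add.commute)
qed

text \<open>The generator maps the intervals of the domain affinely onto those of the range.\<close>

lemma thompson_x_affine:
  assumes "i < p" "j \<le> 2 * p" "0 \<le> s" "s \<le> 1"
  shows "thompson_x p i ((1 - s) * subdiv p p j + s * subdiv p p (Suc j))
         = (1 - s) * subdiv p i j + s * subdiv p i (Suc j)"
proof -
  let ?d = "subdiv p p" let ?t = "(1 - s) * ?d j + s * ?d (Suc j)"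
  note m = subdiv_mono[of p p, simplified] 
  have lt: "?d j < ?d (Suc j)" using subdiv_strict[of p p j] by simp
  have t: "?t = ?d j + s * (?d (Suc j) - ?d j)" by (simp add: algebra_simps)
  have lo: "?d j \<le> ?t" using t lt assms by simp
  have hi: "?t \<le> ?d (Suc j)" 
    using convex_bound_le[of "?d j" "?d (Suc j)" "?d (Suc j)" "1 - s" s] lt assms by simp
  have d0: "0 \<le> ?d j" using strict_mono_less_eq[OF m, of 0 j] subdiv_ends(1)[of p p] by simp
  have d1: "?d (Suc j) \<le> 1" using strict_mono_less_eq[OF m, of "Suc j" "2*p+1"] subdiv_ends(2)[of p p] assms by simp
  have t01: "?t \<in> {0..1}" using lo hi d0 d1 by simp
  let ?S = "{j. j \<le> 2 * p \<and> ?d j \<le> ?t}"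
  have fin: "finite ?S" by simp
  show ?thesis
  proof (cases "s = 1 \<and> j < 2*p")
    case False
    have mx: "Max ?S = j"
    proof (rule Max_eqI[OF fin])
      fix y assume y: "y \<in> ?S"
      show "y \<le> j"
      proof (rule ccontr)
        assume "\<not> y \<le> j" 
        then have "?d (Suc j) \<le> ?d y" using strict_mono_less_eq[OF m] by simp
        then have "?d (Suc j) \<le> ?t" using y by simp
        then have "s \<ge> 1" using t lt by (smt (verit) mult_le_cancel_right1)
        with False assms y \<open>\<not> y \<le> j\<close> show False by auto
      qed
    qed (use lo assms in auto)
    show ?thesis using assms(1) lt t01 unfolding thompson_x_def thompson_x_low_def Let_def
      by (simp only: mx if_True, simp) (simp add: field_simps)
  next
    case True
    have mx: "Max ?S = Suc j"
      by (rule Max_eqI[OF fin]) (use True strict_mono_less_eq[OF m] in auto)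
    show ?thesis using assms(1) lt t01 True mx unfolding thompson_x_def thompson_x_low_def Let_def
      by simp
  qed
qed

end

theory Submission
  imports Defs
begin

text \<open>The group acts on \<open>(0,1)\<close>. Cut this interval at the ends of all standard intervals that hang off
the left and the right spine of the infinite \<open>(p + 1)\<close>-ary tree of subdivisions. A chart
identifies it with the line so that \<open>x\<^sub>0\<close> becomes the translation by \<open>-1\<close>, and the generators \<open>x\<^sub>1, \<dots>, x\<^sub>p\<close> fix everything far to the left, squeeze a bounded
interval by the factor \<open>n = p + 1\<close> and translate the rest by \<open>-1\<close>. Building an element \<open>g\<close> letter
by letter postcomposes \<open>h = g\<^sup>-\<^sup>1\<close>, read in the chart, with such maps and their inverses. Follow the integer
points under this process. A point \<open>x\<close> is ``ahead'' if \<open>h x\<close> is a positive integer, ``passed'' if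
it is an integer \<open>\<le> 0\<close>, and ``buried'' if \<open>h x\<close> is not an integer. Every letter changes the status
of at most one point, namely of the one that is at \<open>1\<close> before or after the step, and this point goes
from or to ``ahead''. Numbering passed, ahead, buried as \<open>-1, 0, 1\<close>, the length of a path is therefore
at least the sum over any finite set of points of the total variations of their status
(\<open>sum_variation_le\<close>). This is the only lower bound for word lengths that is needed.

The elements are of lamplighter type. They bury the points \<open>2q + 1\<close>, for \<open>0 \<le> q < M\<close>, on the
right and one mark \<open>1 - A\<close> on the left, and end with the pointer shifted by \<open>j\<close>. A point that
is buried at the end must have been at \<open>1\<close> at some time; at that time every smaller point is passed
or buried, and every larger one ahead or buried. So each path has to touch both the right end
\<open>2M - 1\<close> and the left mark, and the order of these events determines how often the points in
between have to change their status. Both orders give words of length \<open>3M + 2A \<plusminus> j\<close>, and the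
wrong one is too long if \<open>j = 3\<close> or \<open>j = -3\<close>. So for some \<open>j\<close> the chosen geodesic of the \<open>j\<close>-th
element touches right before left, and that of the next one only touches left before right. The
two elements are neighbours. When the first geodesic \<open>\<gamma>\<close> touches the right end, the other
geodesic \<open>\<gamma>'\<close> is at most \<open>D\<close> steps away. If \<open>\<gamma>'\<close> has touched the left mark by then, following
\<open>\<gamma>'\<close>, changing over and following \<open>\<gamma>\<close> gives a path that touches left, right, left. If not, a detour
of \<open>\<gamma>'\<close> to \<open>\<gamma>\<close> and back gives a path that touches right, left, right. Both are geodesics up to
\<open>2D\<close> steps, but both are too long by an amount that grows with \<open>A\<close> or \<open>M\<close>.

In the second case, the count by status alone would allow a cheap path that buries everything on
the way. It is excluded because the contractions are arranged in parallel: whenever \<open>2q + 1\<close> is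
buried for the last time, its left neighbour \<open>2q\<close> is at \<open>0\<close> and thus passed (\<open>parent_at_zero\<close>), so
\<open>2q\<close> cannot stay buried throughout.\<close>

section \<open>The generators as maps of the line\<close>

text \<open>The generator \<open>x\<^sub>i\<close> in the coordinate of \<open>chart\<close> below. With \<open>s = 1 + p u\<close> the ends of the standard
intervals on the spines are the integers \<open>s\<close>, and for \<open>i \<ge> 1\<close> the generator maps \<open>[i, i + p + 1]\<close> onto \<open>[i, i + 1]\<close>.
The integers \<open>u\<close> form one residue class mod \<open>p\<close> of these ends. Following only this class makes
each generator affect a single point, whatever \<open>p\<close> is.\<close>

definition glide :: "nat \<Rightarrow> nat \<Rightarrow> real \<Rightarrow> real" where
  "glide p i u =
     (if i = 0 then u - 1
      else if real p * u \<le> real i - 1 then u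
      else if real p * u \<le> real i + real p then (u + real i - 1) / (real p + 1)
      else u - 1)"

definition glide_inv :: "nat \<Rightarrow> nat \<Rightarrow> real \<Rightarrow> real" where
  "glide_inv p i w =
     (if i = 0 then w + 1
      else if real p * w \<le> real i - 1 then w
      else if real p * w \<le> real i then (real p + 1) * w - (real i - 1)
      else w + 1)"

lemma glide_glide_inv: assumes "p \<ge> 1" shows "glide p i (glide_inv p i w) = w"
proof -
  have e: "real p * ((real p + 1) * w - (real i - 1)) = (real p + 1) * (real p * w - (real i - 1)) + (real i - 1)"
    by (simp add: algebra_simps)
  have 1: "real p * ((real p + 1) * w - (real i - 1)) > real i - 1" if "real p * w > real i - 1"
    unfolding e using that by simp
  have 2: "real p * ((real p + 1) * w - (real i - 1)) \<le> real i + real p" if "real p * w \<le> real i"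
  proof -
    have "(real p + 1) * (real p * w - (real i - 1)) + (real i - 1) \<le> (real p + 1) * 1 + (real i - 1)"
      by (intro add_right_mono mult_left_mono) (use that in auto)
    also have "\<dots> = real i + real p" by simp
    finally show ?thesis unfolding e .
  qed
  have 3: "real p * (w + 1) > real i + real p" if "real p * w > real i"
    using that by (simp add: algebra_simps)
  show ?thesis
    using 1 2 3 by (auto simp: glide_def glide_inv_def)
qed

lemma glide_inv_glide: assumes "p \<ge> 1" shows "glide_inv p i (glide p i u) = u"
proof -
  have e: "real p * ((u + real i - 1) / (real p + 1)) = (real p * u + real p * (real i - 1)) / (real p + 1)"
    by (simp add: algebra_simps)
  have 1: "real p * ((u + real i - 1) / (real p + 1)) > real i - 1" if "real p * u > real i - 1"
    unfolding e using that by (simp add: field_simps)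
  have 2: "real p * ((u + real i - 1) / (real p + 1)) \<le> real i" if "real p * u \<le> real i + real p"
    unfolding e using that by (simp add: field_simps)
  have 3: "real p * (u - 1) > real i" if "real p * u > real i + real p"
    using that by (simp add: algebra_simps)
  show ?thesis
    using 1 2 3 by (auto simp: glide_def glide_inv_def)
qed

lemma glide_strict_mono: assumes "p \<ge> 1" shows "strict_mono (glide p i)"
proof (rule strict_monoI)
  fix u v :: real assume uv: "u < v"
  show "glide p i u < glide p i v"
  proof (cases "i = 0")
    case True then show ?thesis using uv by (simp add: glide_def)
  next
    case False
    have p: "real p > 0" using assms by simp
    have puv: "real p * u < real p * v" using uv p by simp
    have m1: "u < (v + real i - 1) / (real p + 1)" if "real p * u \<le> real i - 1"
    proof -
      have "u * (real p + 1) < v + real i - 1" using that uv by (simp add: algebra_simps)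
      then show ?thesis by (simp add: pos_less_divide_eq)
    qed
    have m2: "(u + real i - 1) / (real p + 1) < v - 1" if "real p * v > real i + real p"
    proof -
      have "u + real i - 1 < (v - 1) * (real p + 1)" using that uv by (simp add: algebra_simps)
      then show ?thesis by (simp add: pos_divide_less_eq)
    qed
    have m3: "u < v - 1" if "real p * u \<le> real i - 1" "real p * v > real i + real p"
    proof -
      have "real p * u < real p * (v - 1)" using that by (simp add: algebra_simps)
      then show ?thesis using p by simp
    qed
    show ?thesis using False uv puv m1 m2 m3
      by (auto simp: glide_def divide_strict_right_mono)
  qed
qed

definition step :: "nat \<Rightarrow> ((real \<Rightarrow> real) \<times> (real \<Rightarrow> real)) set" where
  "step p = {(h, h'). \<exists>i\<le>p. h' = glide p i \<circ> h \<or> h' = glide_inv p i \<circ> h}"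

text \<open>Passed, ahead and buried are \<open>-1\<close>, \<open>0\<close> and \<open>1\<close>: a point that changes from passed to buried or back
must be ahead in between, so the distance of the numbers is the number of steps required.\<close>

definition status :: "real \<Rightarrow> int" where
  "status u = (if u \<notin> \<int> then 1 else if u \<le> 0 then - 1 else 0)"

lemma status_of_int: "status (of_int u) = (if u \<le> 0 then -1 else 0)"
  by (simp add: status_def)

text \<open>Among the integers, only \<open>1\<close> lies strictly inside the interval that \<open>x\<^sub>i\<close> squeezes, or is carried
across the boundary between \<open>1\<close> and \<open>0\<close> when \<open>i = 0\<close>. A squeezed \<open>u\<close> goes to
\<open>(u + i - 1)/n\<close>, which is an integer only if \<open>u\<close> is one.\<close>

lemma status_glide_changeD:
  assumes "p \<ge> 1" "i \<le> p" "status (glide p i u) \<noteq> status u"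
  shows "u = 1"
proof (cases "u \<in> \<int>")
  case False
  have a: "u - 1 \<notin> \<int>" using False by (metis Ints_1 Ints_add diff_add_cancel)
  have b: "(u + real i - 1) / (real p + 1) \<notin> \<int>"
  proof
    assume "(u + real i - 1) / (real p + 1) \<in> \<int>"
    then obtain m where "(u + real i - 1) / (real p + 1) = of_int m" by (auto elim: Ints_cases)
    then have "u = of_int m * (real p + 1) - real i + 1" by (simp add: field_simps)
    also have "\<dots> = of_int (m * (int p + 1) - int i + 1)" by simp
    finally show False using False by (metis Ints_of_int)
  qed
  have "glide p i u \<notin> \<int>" using a b False by (simp add: glide_def)
  then show ?thesis using False assms(3) by (simp add: status_def)
next
  case True
  then obtain m where m: "u = of_int m" by (auto elim: Ints_cases)
  show ?thesis
  proof (cases "i = 0")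
    case True
    then show ?thesis using assms(3) m by (simp add: glide_def status_def split: if_splits)
  next
    case False
    consider "m \<le> 0" | "m = 1" | "m = 2" | "m \<ge> 3" by linarith
    then show ?thesis
    proof cases
      case 1
      then have "real p * of_int m \<le> 0" by (simp add: mult_le_0_iff)
      then have "glide p i u = u" using False m by (simp add: glide_def)
      then show ?thesis using assms(3) by simp
    next
      case 2 then show ?thesis using m by simp
    next
      case 3
      have "glide p i u = 1"
      proof (cases "i = p")
        case True then show ?thesis using 3 m False by (simp add: glide_def)
      next
        case f: False
        then show ?thesis using 3 m False assms(2) by (auto simp: glide_def)
      qed
      then show ?thesis using assms(3) 3 m by (simp add: status_def)
    next
      case 4
      have "real i + real p < real p * 3" using assms(1,2) by simp
      also have "real p * 3 \<le> real p * u" using 4 m by (intro mult_left_mono) auto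
      finally have "real i + real p < real p * u" .
      then have "glide p i u = u - 1" using False by (simp add: glide_def)
      then show ?thesis using assms(3) 4 m by (simp add: status_def)
    qed
  qed
qed

lemma status_step_changeD:
  assumes "p \<ge> 1" "(h, h') \<in> step p" "status (h' x) \<noteq> status (h x)"
  shows "(h x = 1 \<or> h' x = 1)" 
proof -
  obtain i where i: "i \<le> p" "h' = glide p i \<circ> h \<or> h' = glide_inv p i \<circ> h"
    using assms(2) by (auto simp: step_def)
  then show ?thesis
  proof (elim disjE)
    assume "h' = glide p i \<circ> h"
    then show ?thesis using status_glide_changeD[OF assms(1) i(1), of "h x"] assms(3) by auto
  next
    assume "h' = glide_inv p i \<circ> h"
    then have "h x = glide p i (h' x)" using glide_glide_inv[OF assms(1)] by simp
    then show ?thesis using status_glide_changeD[OF assms(1) i(1), of "h' x"] assms(3) by auto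
  qed
qed

lemma status_range: "status u \<in> {-1, 0, 1}" by (simp add: status_def)

text \<open>Injectivity leaves at most one point that sits at \<open>1\<close> on the side of the step where it is ahead.\<close>

lemma step_sum_le:
  assumes p: "p \<ge> 1" and s: "(h, h') \<in> step p" and h: "inj h" and P: "finite P"
  shows "(\<Sum>x\<in>P. \<bar>status (h' x) - status (h x)\<bar>) \<le> 1"
proof -
  obtain i where i: "i \<le> p" "h' = glide p i \<circ> h \<or> h' = glide_inv p i \<circ> h"
    using s by (auto simp: step_def)
  have "\<exists>y. \<forall>x. status (h' x) \<noteq> status (h x) \<longrightarrow> x = y \<and> \<bar>status (h' x) - status (h x)\<bar> \<le> 1"
    using i(2)
  proof (elim disjE)
    assume e: "h' = glide p i \<circ> h"
    have "h x = 1" if "status (h' x) \<noteq> status (h x)" for x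
      using status_glide_changeD[OF p i(1), of "h x"] that e by auto
    moreover have "\<bar>status v - status (1::real)\<bar> \<le> 1" for v
      by (simp add: status_def)
    ultimately show ?thesis using h by (metis inv_f_f)
  next
    assume e: "h' = glide_inv p i \<circ> h"
    have c: "h x = glide p i (h' x)" for x using glide_glide_inv[OF p] e by simp
    have h': "inj h'" 
    proof (rule injI)
      fix x y assume "h' x = h' y" 
      then have "h x = h y" by (simp add: c)
      then show "x = y" using h by (simp add: inj_eq)
    qed
    have "h' x = 1" if "status (h' x) \<noteq> status (h x)" for x
      using status_glide_changeD[OF p i(1), of "h' x"] that c[of x] by auto
    moreover have "\<bar>status (1::real) - status v\<bar> \<le> 1" for v
      by (simp add: status_def)
    ultimately show ?thesis using h' by (metis inv_f_f)
  qed
  then obtain y where y: "\<And>x. status (h' x) \<noteq> status (h x) \<Longrightarrow> x = y \<and> \<bar>status (h' x) - status (h x)\<bar> \<le> 1"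
    by blast
  have "(\<Sum>x\<in>P. \<bar>status (h' x) - status (h x)\<bar>) = (\<Sum>x\<in>P \<inter> {y}. \<bar>status (h' x) - status (h x)\<bar>)"
    by (rule sum.mono_neutral_right) (use P y in auto)
  also have "\<dots> \<le> 1"
  proof (cases "y \<in> P")
    case True then show ?thesis using y[of y] by (cases "status (h' y) = status (h y)") auto
  next
    case False then show ?thesis by simp
  qed
  finally show ?thesis .
qed

lemma step_strict_mono: 
  assumes "p \<ge> 1" "(h, h') \<in> step p" "strict_mono h" shows "strict_mono h'"
proof -
  obtain i where i: "i \<le> p" "h' = glide p i \<circ> h \<or> h' = glide_inv p i \<circ> h"
    using assms by (auto simp: step_def)
  have "strict_mono (glide_inv p i)"
    by (rule strict_monoI) (metis assms(1) glide_glide_inv glide_strict_mono strict_mono_less)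
  then show ?thesis using i(2) glide_strict_mono[OF assms(1), of i] assms(3)
    by (auto simp: strict_mono_def)
qed

lemma step_sym: assumes "p \<ge> 1" "(h, h') \<in> step p" shows "(h', h) \<in> step p"
proof -
  obtain i where i: "i \<le> p" "h' = glide p i \<circ> h \<or> h' = glide_inv p i \<circ> h"
    using assms by (auto simp: step_def)
  then have "h = glide_inv p i \<circ> h' \<or> h = glide p i \<circ> h'"
    using glide_inv_glide[OF assms(1)] glide_glide_inv[OF assms(1)] by (auto simp: fun_eq_iff)
  then show ?thesis using i(1) by (auto simp: step_def)
qed

lemma burying_step:
  assumes p: "p \<ge> 1" and s: "(h, h') \<in> step p" and v: "h x \<in> \<int>" and b: "h' x \<notin> \<int>"
  shows "h x = 1 \<and> (\<exists>i. 1 \<le> i \<and> i \<le> p \<and> h' x = real i / (real p + 1))"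
proof -
  have c: "status (h' x) \<noteq> status (h x)" using v b by (simp add: status_def)
  obtain i where i: "i \<le> p" "h' = glide p i \<circ> h \<or> h' = glide_inv p i \<circ> h"
    using s by (auto simp: step_def)
  have "h' x \<noteq> 1" using b by auto
  then have h1: "h x = 1" using status_step_changeD[OF p s c] by simp
  have "h' = glide p i \<circ> h"
  proof (rule ccontr)
    assume "h' \<noteq> glide p i \<circ> h"
    then have "h x = glide p i (h' x)" using i(2) glide_glide_inv[OF p] by auto
    then have "h' x = 1" using status_glide_changeD[OF p i(1), of "h' x"] c by auto
    then show False using b by auto
  qed
  then have e: "h' x = glide p i 1" using h1 by simp
  have "i \<noteq> 0" 
  proof
    assume "i = 0"
    then have "h' x = 0" using e by (simp add: glide_def)
    then show False using b by auto
  qed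
  moreover have "h' x = real i / (real p + 1)" using e \<open>i \<noteq> 0\<close> i(1) by (simp add: glide_def)
  ultimately show ?thesis using h1 i(1) by (intro conjI exI[of _ i]) auto
qed

section \<open>Walks and the variation of a point\<close>

definition walk :: "('a \<times> 'a) set \<Rightarrow> (nat \<Rightarrow> 'a) \<Rightarrow> nat \<Rightarrow> bool" where
  "walk r f N \<longleftrightarrow> (\<forall>k<N. (f k, f (Suc k)) \<in> r)"

definition splice :: "nat \<Rightarrow> (nat \<Rightarrow> 'a) \<Rightarrow> (nat \<Rightarrow> 'a) \<Rightarrow> nat \<Rightarrow> 'a" where
  "splice m f g k = (if k \<le> m then f k else g (k - m))"

lemma walk_splice:
  assumes "walk r f m" "walk r g n" "f m = g 0"
  shows "walk r (splice m f g) (m + n)"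
  unfolding walk_def
proof (intro allI impI)
  fix k assume k: "k < m + n"
  consider "k < m" | "k = m" | "k > m" by linarith
  then show "(splice m f g k, splice m f g (Suc k)) \<in> r"
  proof cases
    case 1 then show ?thesis using assms(1) by (simp add: splice_def walk_def)
  next
    case 2 then show ?thesis using assms(2,3) k by (simp add: splice_def walk_def)
  next
    case 3
    then have "k - m < n" using k by simp
    then have "(g (k - m), g (Suc (k - m))) \<in> r" using assms(2) by (simp add: walk_def)
    then show ?thesis using 3 by (simp add: splice_def Suc_diff_le)
  qed
qed

definition variation :: "(nat \<Rightarrow> real \<Rightarrow> real) \<Rightarrow> real \<Rightarrow> nat \<Rightarrow> nat \<Rightarrow> int" where
  "variation h x a b = (\<Sum>k=a..<b. \<bar>status (h (Suc k) x) - status (h k x)\<bar>)"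

lemma variation_add: "a \<le> b \<Longrightarrow> b \<le> c \<Longrightarrow> variation h x a b + variation h x b c = variation h x a c"
  by (simp add: variation_def sum.atLeastLessThan_concat)

lemma variation_ge: "a \<le> b \<Longrightarrow> \<bar>status (h b x) - status (h a x)\<bar> \<le> variation h x a b"
proof (induction b rule: dec_induct)
  case base then show ?case by (simp add: variation_def)
next
  case (step b)
  then show ?case by (simp add: variation_def)
qed

lemma walk_strict_mono:
  assumes "p \<ge> 1" "walk (step p) h N" "strict_mono (h 0)" "k \<le> N"
  shows "strict_mono (h k)"
  using assms(4)
proof (induction k)
  case 0 then show ?case using assms by simp
next
  case (Suc k)
  then have "(h k, h (Suc k)) \<in> step p" "strict_mono (h k)" using assms(2) by (auto simp: walk_def)
  then show ?case by (rule step_strict_mono[OF assms(1)])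
qed

lemma sum_variation_le:
  assumes "p \<ge> 1" "walk (step p) h N" "strict_mono (h 0)" "finite P"
  shows "(\<Sum>x\<in>P. variation h x 0 N) \<le> int N"
proof -
  have "(\<Sum>x\<in>P. variation h x 0 N) = (\<Sum>k=0..<N. \<Sum>x\<in>P. \<bar>status (h (Suc k) x) - status (h k x)\<bar>)"
    unfolding variation_def by (rule sum.swap)
  also have "\<dots> \<le> (\<Sum>k=0..<N. 1)"
  proof (rule sum_mono)
    fix k assume k: "k \<in> {0..<N}"
    have "inj (h k)" using walk_strict_mono[OF assms(1-3), of k] k by (simp add: strict_mono_imp_inj_on)
    then show "(\<Sum>x\<in>P. \<bar>status (h (Suc k) x) - status (h k x)\<bar>) \<le> 1"
      using assms k by (intro step_sum_le[of p]) (auto simp: walk_def)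
  qed
  finally show ?thesis by simp
qed

text \<open>A point that ends up buried is at \<open>1\<close> just before it is buried for good.\<close>

lemma last_burying:
  assumes p: "p \<ge> 1" and w: "walk (step p) h N" and v: "h 0 x \<in> \<int>" and b: "h N x \<notin> \<int>"
  obtains k where "k < N" "h k x = 1" "\<And>l. k < l \<Longrightarrow> l \<le> N \<Longrightarrow> h l x \<notin> \<int>"
    "\<exists>i. 1 \<le> i \<and> i \<le> p \<and> h (Suc k) x = real i / (real p + 1)"
proof -
  define k where "k = (GREATEST k. k \<le> N \<and> h k x \<in> \<int>)"
  have k: "k \<le> N \<and> h k x \<in> \<int>" unfolding k_def
    by (rule GreatestI_nat[where b = N and k = 0]) (use v in auto)
  have gr: "l \<le> k" if "l \<le> N" "h l x \<in> \<int>" for l unfolding k_def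
    by (rule Greatest_le_nat[where b = N]) (use that in auto)
  have kN: "k < N" using k b by (cases "k = N") auto
  have hid: "h l x \<notin> \<int>" if "k < l" "l \<le> N" for l using gr[of l] that by auto
  have "(h k, h (Suc k)) \<in> step p" using w kN by (simp add: walk_def)
  from burying_step[OF p this, of x] k hid[of "Suc k"] kN
  have "h k x = 1" "\<exists>i. 1 \<le> i \<and> i \<le> p \<and> h (Suc k) x = real i / (real p + 1)" by auto
  then show thesis using that kN hid by blast
qed

section \<open>Buried points and their parents\<close>

text \<open>The points \<open>a/n\<^sup>e\<close> and \<open>a/n\<^sup>e + 1/n\<^sup>e\<^sup>+\<^sup>1\<close> are, in the coordinate \<open>1 + p u\<close>, the left end and the last
interior division point of one standard n-adic interval. The generators map standard intervals to
standard intervals as long as the interior division points stay buried, so the relation says that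
the second point was buried by a caret that starts at the first one.\<close>

definition sibling :: "nat \<Rightarrow> real \<Rightarrow> real \<Rightarrow> bool" where
  "sibling n u v \<longleftrightarrow> (\<exists>(a::int) (e::nat). u = of_int a / real n ^ e \<and> v = of_int a / real n ^ e + 1 / real n ^ Suc e)"

text \<open>The breakpoints of \<open>x\<^sub>i\<close> are integers in the coordinate \<open>1 + p u\<close>, so that a standard interval lies
within one piece. The case distinction compares numerators over \<open>n\<^sup>e\<close>.\<close>

lemma sibling_glide:
  assumes "p \<ge> 1" "i \<le> p" "sibling (p + 1) u v"
  shows "sibling (p + 1) (glide p i u) (glide p i v)"
proof -
  define n where "n = real p + 1"
  have n: "n > 1" "real (p + 1) = n" using assms(1) by (auto simp: n_def)
  obtain a e where u: "u = of_int a / n ^ e" and v: "v = of_int a / n ^ e + 1 / n ^ Suc e"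
    using assms(3) unfolding sibling_def n(2) by blast
  have ne: "n ^ e > 0" using n by simp
  have pe: "of_int (int (p + 1) ^ e) = n ^ e" by (simp add: n_def add.commute)
  have v': "v = (of_int a + 1 / n) / n ^ e" using v by (simp add: add_divide_distrib)
  show ?thesis
  proof (cases "i = 0")
    case True
    have "u - 1 = of_int (a - int (p + 1) ^ e) / n ^ e" unfolding u of_int_diff of_int_add pe
      using n(1) ne by (simp add: diff_divide_distrib add_divide_distrib)
    moreover have "v - 1 = (u - 1) + 1 / n ^ Suc e" using u v by simp
    ultimately show ?thesis using True unfolding sibling_def n(2)
      by (intro exI[of _ "a - int (p + 1) ^ e"] exI[of _ e]) (simp add: glide_def)
  next
    case False
    define s where "s = (int i - 1) * int (p + 1) ^ e"
    define t where "t = (int i + int p) * int (p + 1) ^ e"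
    have s: "of_int s = (real i - 1) * n ^ e" by (simp add: s_def n_def add.commute)
    have t: "of_int t = (real i + real p) * n ^ e" by (simp add: t_def n_def add.commute)
    have pn: "real p / n < 1" by (simp add: n_def)
    have pu: "real p * u = of_int (int p * a) / n ^ e" using u by simp
    have pv: "real p * v = (of_int (int p * a) + real p / n) / n ^ e" using v' by (simp add: algebra_simps)
    have le: "real p * u \<le> c \<longleftrightarrow> of_int (int p * a) \<le> c * n ^ e" for c
      unfolding pu using ne by (simp add: pos_divide_le_eq)
    have lev: "real p * v \<le> c \<longleftrightarrow> of_int (int p * a) + real p / n \<le> c * n ^ e" for c
      unfolding pv using ne by (simp add: pos_divide_le_eq)
    consider "int p * a < s" | "s \<le> int p * a" "int p * a < t" | "t \<le> int p * a" by linarith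
    then show ?thesis
    proof cases
      case 1
      then have "of_int (int p * a) + 1 \<le> (of_int s :: real)" by linarith
      then have "real p * u \<le> real i - 1" "real p * v \<le> real i - 1"
        unfolding le lev s[symmetric] using pn by linarith+
      then show ?thesis using False assms(3) by (simp add: glide_def)
    next
      case 2
      have "of_int (int p * a) + 1 \<le> (of_int t :: real)" "of_int s \<le> (of_int (int p * a) :: real)" 
        using 2 by linarith+
      then have ub: "real p * u \<le> real i + real p" "real p * v \<le> real i + real p"
        unfolding le lev t[symmetric] using pn by linarith+
      have lb: "real p * u \<ge> real i - 1" unfolding pu using ne s \<open>of_int s \<le> (of_int (int p * a) :: real)\<close>
        by (simp add: pos_le_divide_eq)
      have uv: "u < v" using v u n by simp
      have "real p * u < real p * v" using uv assms(1) by simp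
      then have lbv: "\<not> real p * v \<le> real i - 1" using lb by linarith
      have eu: "glide p i u = (u + real i - 1) / n"
      proof (cases "real p * u \<le> real i - 1")
        case True
        then have "real p * u = real i - 1" using lb by simp
        then have "(u + real i - 1) / n = u" using n by (simp add: field_simps n_def)
        then show ?thesis using True False by (simp add: glide_def)
      next
        case f: False then show ?thesis using False ub by (simp add: glide_def n_def)
      qed
      have ev: "glide p i v = (v + real i - 1) / n" using False lbv ub by (simp add: glide_def n_def)
      have 1: "glide p i u = of_int (a + s) / n ^ Suc e"
        unfolding eu unfolding u of_int_add s using n ne by (simp add: field_simps)
      have 2: "glide p i v = glide p i u + 1 / n ^ Suc (Suc e)"
        unfolding eu ev unfolding v u using n ne by (simp add: field_simps)
      show ?thesis unfolding sibling_def n(2)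
        by (intro exI[of _ "a + s"] exI[of _ "Suc e"]) (use 1 2 in simp)
    next
      case 3
      then have "of_int t \<le> (of_int (int p * a) :: real)" by linarith
      then have lb: "real p * u \<ge> real i + real p" unfolding pu using ne t
        by (simp add: pos_le_divide_eq)
      have uv: "u < v" using v u n by simp
      have "real p * u < real p * v" using uv assms(1) by simp
      then have lbv: "\<not> real p * v \<le> real i + real p" using lb by linarith
      have eu: "glide p i u = u - 1"
      proof (cases "real p * u \<le> real i + real p")
        case True
        then have "real p * u = real i + real p" using lb by simp
        then have "(u + real i - 1) / n = u - 1" using n by (simp add: field_simps n_def)
        then show ?thesis using True False lb assms(1) by (auto simp: glide_def n_def)
      next
        case f: False then show ?thesis using False by (simp add: glide_def n_def)
      qed
      have ev: "glide p i v = v - 1" using False lbv by (simp add: glide_def)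
      have "u - 1 = of_int (a - int (p + 1) ^ e) / n ^ e" unfolding u of_int_diff of_int_add pe
        using n(1) ne by (simp add: diff_divide_distrib add_divide_distrib)
      moreover have "v - 1 = (u - 1) + 1 / n ^ Suc e" using u v by simp
      ultimately show ?thesis unfolding eu ev sibling_def n(2)
        by (intro exI[of _ "a - int (p + 1) ^ e"] exI[of _ e]) simp
    qed
  qed
qed

text \<open>The interval that the inverse of \<open>x\<^sub>i\<close> stretches has length \<open>1\<close> in the coordinate \<open>1 + p u\<close>. A
standard interval inside it is either smaller, and then stays standard, or all of it, and then the
division point \<open>v\<close> would be dug out.\<close>

lemma sibling_glide_inv:
  assumes "p \<ge> 1" "i \<le> p" "sibling (p + 1) u v" "glide_inv p i v \<notin> \<int>"
  shows "sibling (p + 1) (glide_inv p i u) (glide_inv p i v)"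
proof -
  define n where "n = real p + 1"
  have n: "n > 1" "real (p + 1) = n" using assms(1) by (auto simp: n_def)
  obtain a e where u: "u = of_int a / n ^ e" and v: "v = of_int a / n ^ e + 1 / n ^ Suc e"
    using assms(3) unfolding sibling_def n(2) by blast
  have ne: "n ^ e > 0" using n by simp
  have pe: "of_int (int (p + 1) ^ e) = n ^ e" by (simp add: n_def add.commute)
  have v': "v = (of_int a + 1 / n) / n ^ e" using v by (simp add: add_divide_distrib)
  have plus1: "sibling (p + 1) (u + 1) (v + 1)"
  proof -
    have "u + 1 = of_int (a + int (p + 1) ^ e) / n ^ e" unfolding u of_int_diff of_int_add pe
      using n(1) ne by (simp add: diff_divide_distrib add_divide_distrib)
    moreover have "v + 1 = (u + 1) + 1 / n ^ Suc e" using u v by simp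
    ultimately show ?thesis unfolding sibling_def n(2)
      by (intro exI[of _ "a + int (p + 1) ^ e"] exI[of _ e]) simp
  qed
  show ?thesis
  proof (cases "i = 0")
    case True then show ?thesis using plus1 by (simp add: glide_inv_def)
  next
    case False
    define s where "s = (int i - 1) * int (p + 1) ^ e"
    define t where "t = int i * int (p + 1) ^ e"
    have s: "of_int s = (real i - 1) * n ^ e" by (simp add: s_def n_def add.commute)
    have t: "of_int t = real i * n ^ e" by (simp add: t_def n_def add.commute)
    have pn: "real p / n < 1" by (simp add: n_def)
    have pu: "real p * u = of_int (int p * a) / n ^ e" using u by simp
    have pv: "real p * v = (of_int (int p * a) + real p / n) / n ^ e" using v' by (simp add: algebra_simps)
    have le: "real p * u \<le> c \<longleftrightarrow> of_int (int p * a) \<le> c * n ^ e" for c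
      unfolding pu using ne by (simp add: pos_divide_le_eq)
    have lev: "real p * v \<le> c \<longleftrightarrow> of_int (int p * a) + real p / n \<le> c * n ^ e" for c
      unfolding pv using ne by (simp add: pos_divide_le_eq)
    have uv: "u < v" using v u n by simp
    have puv: "real p * u < real p * v" using uv assms(1) by simp
    consider "int p * a < s" | "s \<le> int p * a" "int p * a < t" | "t \<le> int p * a" by linarith
    then show ?thesis
    proof cases
      case 1
      then have "of_int (int p * a) + 1 \<le> (of_int s :: real)" by linarith
      then have "real p * u \<le> real i - 1" "real p * v \<le> real i - 1"
        unfolding le lev s[symmetric] using pn by linarith+
      then show ?thesis using False assms(3) by (simp add: glide_inv_def)
    next
      case 2
      have *: "of_int (int p * a) + 1 \<le> (of_int t :: real)" "of_int s \<le> (of_int (int p * a) :: real)" 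
        using 2 by linarith+
      then have ub: "real p * u \<le> real i" "real p * v \<le> real i"
        unfolding le lev t[symmetric] using pn by linarith+
      have lb: "real p * u \<ge> real i - 1" unfolding pu using ne s *(2)
        by (simp add: pos_le_divide_eq)
      then have lbv: "\<not> real p * v \<le> real i - 1" using puv by linarith
      have eu: "glide_inv p i u = n * u - (real i - 1)"
      proof (cases "real p * u \<le> real i - 1")
        case True
        then have "real p * u = real i - 1" using lb by simp
        then have "n * u - (real i - 1) = u" by (simp add: algebra_simps n_def)
        then show ?thesis using True False by (simp add: glide_inv_def)
      next
        case f: False then show ?thesis using False ub by (simp add: glide_inv_def n_def)
      qed
      have ev: "glide_inv p i v = n * v - (real i - 1)" using False lbv ub by (simp add: glide_inv_def n_def)
      show ?thesis
      proof (cases e)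
        case 0
        have "glide_inv p i v = of_int (int (p + 1) * a + 1 - (int i - 1))"
          unfolding ev unfolding v 0 using n by (simp add: field_simps n_def)
        then show ?thesis using assms(4) by (metis Ints_of_int)
      next
        case (Suc d)
        define c where "c = (int i - 1) * int (p + 1) ^ d"
        have c: "of_int c = (real i - 1) * n ^ d" by (simp add: c_def n_def add.commute)
        have 1: "glide_inv p i u = of_int (a - c) / n ^ d"
          unfolding eu unfolding u of_int_diff c Suc using n by (simp add: field_simps)
        have 2: "glide_inv p i v = glide_inv p i u + 1 / n ^ Suc d"
          unfolding eu ev unfolding v u Suc using n by (simp add: field_simps)
        show ?thesis unfolding sibling_def n(2)
          by (intro exI[of _ "a - c"] exI[of _ d]) (use 1 2 in simp)
      qed
    next
      case 3
      then have "of_int t \<le> (of_int (int p * a) :: real)" by linarith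
      then have lb: "real p * u \<ge> real i" unfolding pu using ne t
        by (simp add: pos_le_divide_eq)
      then have lbv: "\<not> real p * v \<le> real i" using puv by linarith
      have eu: "glide_inv p i u = u + 1"
      proof (cases "real p * u \<le> real i")
        case True
        then have "real p * u = real i" using lb by simp
        then have "n * u - (real i - 1) = u + 1" by (simp add: algebra_simps n_def)
        then show ?thesis using True False lb by (auto simp: glide_inv_def n_def)
      next
        case f: False then show ?thesis using False by (simp add: glide_inv_def n_def)
      qed
      have ev: "glide_inv p i v = v + 1" using False lbv by (simp add: glide_inv_def)
      show ?thesis unfolding eu ev by (rule plus1)
    qed
  qed
qed

text \<open>Immediately after a burial the point is at \<open>i/n\<close>. Comparing denominators forces \<open>e = 0\<close>, and then
\<open>i - 1\<close> is a multiple of \<open>n\<close> between \<open>0\<close> and \<open>p - 1\<close>.\<close>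

lemma sibling_last_burying:
  assumes "p \<ge> 1" "sibling (p + 1) u (real i / (real p + 1))" "1 \<le> i" "i \<le> p"
  shows "u = 0"
proof -
  define n where "n = int p + 1"
  have n: "n > 1" "real (p + 1) = of_int n" "real p + 1 = of_int n" using assms(1) by (auto simp: n_def)
  obtain a e where u: "u = of_int a / of_int n ^ e" 
    and v: "real i / of_int n = of_int a / of_int n ^ e + 1 / of_int n ^ Suc e"
    using assms(2) unfolding sibling_def n(2,3) by blast
  have "real i * of_int n ^ e = of_int a * of_int n + 1"
    using v n by (simp add: field_simps)
  then have "of_int (int i * n ^ e) = (of_int (a * n + 1) :: real)" by simp
  then have eq: "int i * n ^ e = a * n + 1" by (simp only: of_int_eq_iff)
  \<comment> \<open>Otherwise \<open>n\<close> divides the left side but not the right one.\<close>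
  have "e = 0"
  proof (rule ccontr)
    assume "e \<noteq> 0"
    then have "n dvd int i * n ^ e" by simp
    then have "n dvd 1" using eq by (metis dvd_add_right_iff dvd_triv_right)
    then show False using n by simp
  qed
  then have "a * n = int i - 1" using eq by simp
  moreover have "int i - 1 < n" "int i - 1 \<ge> 0" using assms by (auto simp: n_def)
  ultimately have "a = 0" using n
    by (metis div_pos_pos_trivial nonzero_mult_div_cancel_right less_irrefl not_one_less_zero)
  then show ?thesis using u by simp
qed

text \<open>Going backwards in time from the end, the two points stay siblings until \<open>x\<close> is dug out, that is,
until just after its last burial; there its sibling is at \<open>0\<close>.\<close>

lemma parent_at_zero:
  assumes p: "p \<ge> 1" and w: "walk (step p) h N" and s: "sibling (p + 1) (h N y) (h N x)"
    and v: "h 0 x \<in> \<int>" and b: "h N x \<notin> \<int>"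
  shows "\<exists>k\<le>N. h k y = 0"
proof -
  obtain k i where k: "k < N" and hid: "\<And>l. k < l \<Longrightarrow> l \<le> N \<Longrightarrow> h l x \<notin> \<int>"
    and i: "1 \<le> i" "i \<le> p" "h (Suc k) x = real i / (real p + 1)"
    using last_burying[OF p w v b] by metis
  have "k < l \<longrightarrow> sibling (p + 1) (h l y) (h l x)" if "l \<le> N" for l
    using that
  proof (induction l rule: inc_induct)
    case base then show ?case using s by simp
  next
    case (step l)
    show ?case
    proof
      assume l: "k < l"
      have "(h l, h (Suc l)) \<in> step p" using w step by (simp add: walk_def)
      from step_sym[OF p this] obtain j where j: "j \<le> p"
        "h l = glide p j \<circ> h (Suc l) \<or> h l = glide_inv p j \<circ> h (Suc l)" by (auto simp: step_def)
      have sib: "sibling (p + 1) (h (Suc l) y) (h (Suc l) x)" using step l by simp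
      have hl: "h l x \<notin> \<int>" using hid[of l] l step by simp
      show "sibling (p + 1) (h l y) (h l x)"
        using j(2) sibling_glide[OF p j(1) sib] sibling_glide_inv[OF p j(1) sib] hl by auto
    qed
  qed
  from this[of "Suc k"] k have "sibling (p + 1) (h (Suc k) y) (h (Suc k) x)" by simp
  then have "h (Suc k) y = 0" unfolding i(3) using sibling_last_burying[OF p _ i(1,2)] by blast
  then show ?thesis using k by (intro exI[of _ "Suc k"]) auto
qed

section \<open>Lengths of walks that touch both ends\<close>

lemma int_interval_sum_split:
  fixes f :: "int \<Rightarrow> int"
  assumes "a \<le> b" "b \<le> c"
  shows "sum f {a..<c} = sum f {a..<b} + sum f {b..<c}"
proof -
  have "{a..<c} = {a..<b} \<union> {b..<c}" using assms by auto
  then show ?thesis by (simp add: sum.union_disjoint)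
qed

lemma int_interval_sum_ge:
  fixes f :: "int \<Rightarrow> int"
  assumes "a \<le> b" "\<And>u. a \<le> u \<Longrightarrow> u < b \<Longrightarrow> c \<le> f u"
  shows "c * (b - a) \<le> sum f {a..<b}"
proof -
  have "(\<Sum>u\<in>{a..<b}. c) \<le> sum f {a..<b}" by (rule sum_mono) (use assms in auto)
  then show ?thesis using assms(1) by (simp add: mult.commute)
qed

definition touches_left :: "(nat \<Rightarrow> real \<Rightarrow> real) \<Rightarrow> int \<Rightarrow> nat \<Rightarrow> bool" where
  "touches_left h A k \<longleftrightarrow> h k (of_int (1 - A)) = 1"

definition touches_right :: "(nat \<Rightarrow> real \<Rightarrow> real) \<Rightarrow> int \<Rightarrow> nat \<Rightarrow> bool" where
  "touches_right h M k \<longleftrightarrow> h k (of_int (2 * M - 1)) = 1"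

text \<open>The end map of the walk is prescribed only at the points that are counted. The points \<open>1 - A\<close> and
\<open>2M - 1\<close> are the marks at the two ends. All the lower bounds for \<open>N\<close> below come from
\<open>length_ge\<close>.\<close>

locale tour =
  fixes p :: nat and h :: "nat \<Rightarrow> real \<Rightarrow> real" and N :: nat and A M j :: int
  assumes p1: "p \<ge> 1"
    and walk: "walk (step p) h N"
    and start: "h 0 = id"
    and A: "A \<ge> 4" and M: "M \<ge> 4" and j: "\<bar>j\<bar> \<le> 3"
    and left_end: "\<And>u. 2 - A \<le> u \<Longrightarrow> u \<le> 0 \<Longrightarrow> h N (of_int u) = of_int (u - j)"
    and even_end: "\<And>q. 0 \<le> q \<Longrightarrow> q < M \<Longrightarrow> h N (of_int (2 * q)) = of_int (q - j)"
    and odd_end: "\<And>q. 0 \<le> q \<Longrightarrow> q < M \<Longrightarrow>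
      h N (of_int (2 * q + 1)) = of_int (q - j) + 1 / (real p + 1)"
    and mark_end: "h N (of_int (1 - A)) \<notin> \<int>"
begin

abbreviation state :: "nat \<Rightarrow> int \<Rightarrow> int" where
  "state k u \<equiv> status (h k (of_int u))"

abbreviation total :: "int \<Rightarrow> int" where
  "total u \<equiv> variation h (of_int u) 0 N"

lemma mono: "k \<le> N \<Longrightarrow> strict_mono (h k)"
  using walk_strict_mono[OF p1 walk] start by (simp add: strict_mono_def)

lemma odd_end_hidden: assumes "0 \<le> q" "q < M" shows "h N (of_int (2 * q + 1)) \<notin> \<int>"
proof
  assume "h N (of_int (2 * q + 1)) \<in> \<int>"
  then have "of_int (q - j) + 1 / (real p + 1) \<in> \<int>" using odd_end[OF assms] by simp
  then have "of_int (q - j) + 1 / (real p + 1) - of_int (q - j) \<in> \<int>" by (rule Ints_diff) (rule Ints_of_int)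
  then have "1 / (real p + 1) \<in> \<int>" by simp
  then obtain m where m: "1 / (real p + 1) = of_int m" by (auto elim: Ints_cases)
  have "0 < 1 / (real p + 1)" "1 / (real p + 1) < 1" using p1 by auto
  then show False unfolding m by simp
qed

lemma touches_right_exists: "\<exists>k\<le>N. touches_right h M k"
proof -
  have "h 0 (of_int (2 * (M - 1) + 1)) \<in> \<int>" using start by (simp only: id_apply Ints_of_int)
  from last_burying[OF p1 walk this odd_end_hidden] M
  obtain k where "k < N" "h k (of_int (2 * (M - 1) + 1)) = 1" by auto
  moreover have "2 * (M - 1) + 1 = 2 * M - 1" by simp
  ultimately show ?thesis unfolding touches_right_def by (metis less_imp_le)
qed

lemma touches_left_exists: "\<exists>k\<le>N. touches_left h A k"
proof -
  have "h 0 (of_int (1 - A)) \<in> \<int>" using start by (simp only: id_apply Ints_of_int)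
  from last_burying[OF p1 walk this mark_end]
  obtain k where "k < N" "h k (of_int (1 - A)) = 1" by metis
  then show ?thesis unfolding touches_left_def by (metis less_imp_le)
qed

text \<open>A smaller point cannot be ahead while \<open>2M - 1\<close> is the first point ahead.\<close>

lemma state_at_right_touch: assumes "k \<le> N" "touches_right h M k" "u < 2 * M - 1" shows "state k u \<noteq> 0"
proof -
  have "h k (of_int u) < h k (of_int (2 * M - 1))" using mono[OF assms(1)] assms(3) 
    by (simp only: strict_mono_less of_int_less_iff)
  then show ?thesis using assms(2) unfolding touches_right_def status_def by (auto elim!: Ints_cases)
qed

text \<open>A larger point cannot be passed while \<open>1 - A\<close> is still ahead.\<close>

lemma state_at_left_touch: assumes "k \<le> N" "touches_left h A k" "1 - A < u" shows "state k u \<ge> 0"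
proof -
  have "h k (of_int (1 - A)) < h k (of_int u)" using mono[OF assms(1)] assms(3) 
    by (simp only: strict_mono_less of_int_less_iff)
  then show ?thesis using assms(2) unfolding touches_left_def status_def by (auto elim!: Ints_cases)
qed

lemma state_range: "state k u = -1 \<or> state k u = 0 \<or> state k u = 1"
  using status_range[of "h k (of_int u)"] by auto

lemma state_start: "state 0 u = (if u \<le> 0 then -1 else 0)"
  using start by (simp add: status_of_int)

lemma state_left_end: "2 - A \<le> u \<Longrightarrow> u \<le> 0 \<Longrightarrow> state N u = (if u \<le> j then -1 else 0)"
  using left_end[of u] status_of_int[of "u - j"] by simp

lemma state_even_end: "0 \<le> q \<Longrightarrow> q < M \<Longrightarrow> state N (2 * q) = (if q \<le> j then -1 else 0)"
  using even_end[of q] status_of_int[of "q - j"] by simp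

lemma odd_total: assumes "0 \<le> q" "q < M" shows "1 \<le> total (2 * q + 1)"
proof -
  have "state N (2 * q + 1) = 1" using odd_end_hidden[OF assms] by (simp add: status_def)
  moreover have "state 0 (2 * q + 1) = 0" using state_start[of "2 * q + 1"] assms by simp
  ultimately show ?thesis using variation_ge[of 0 N h "of_int (2 * q + 1)"] by simp
qed

lemma total_ge1: 
  assumes "k \<le> N"
  shows "\<bar>state k u - state 0 u\<bar> + \<bar>state N u - state k u\<bar> \<le> total u"
  using variation_ge[of 0 k h "of_int u"] variation_ge[of k N h "of_int u"] variation_add[of 0 k N h "of_int u"] assms
  by simp

lemma total_ge2:
  assumes "k \<le> l" "l \<le> N"
  shows "\<bar>state k u - state 0 u\<bar> + \<bar>state l u - state k u\<bar> + \<bar>state N u - state l u\<bar> \<le> total u"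
  using variation_ge[of 0 k h "of_int u"] variation_ge[of k l h "of_int u"] variation_ge[of l N h "of_int u"]
    variation_add[of 0 k N h "of_int u"] variation_add[of k l N h "of_int u"] assms by simp

lemma total_ge3:
  assumes "k \<le> l" "l \<le> m" "m \<le> N"
  shows "\<bar>state k u - state 0 u\<bar> + \<bar>state l u - state k u\<bar> + \<bar>state m u - state l u\<bar> 
    + \<bar>state N u - state m u\<bar> \<le> total u"
  using variation_ge[of 0 k h "of_int u"] variation_ge[of k l h "of_int u"] variation_ge[of l m h "of_int u"] 
    variation_ge[of m N h "of_int u"]
    variation_add[of 0 k N h "of_int u"] variation_add[of k l N h "of_int u"] variation_add[of l m N h "of_int u"] assms 
  by simp

text \<open>The points counted are \<open>2 - A, \<dots>, 0\<close>, then \<open>2, 4, \<dots>, 2M - 2\<close>, and the odd points up to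
\<open>2M - 1\<close>, each of which has to be buried.\<close>

lemma length_ge:
  "sum total {2 - A..<1} + (\<Sum>q\<in>{1..<M}. total (2 * q)) + M \<le> int N"
proof -
  let ?L = "{2 - A..<1}" let ?E = "(\<lambda>q. 2 * q) ` {1..<M}" let ?O = "(\<lambda>q. 2 * q + 1) ` {0..<M}"
  have disj: "?L \<inter> ?E = {}" "(?L \<union> ?E) \<inter> ?O = {}" by (auto, presburger)
  have inj: "inj_on (of_int :: int \<Rightarrow> real) X" for X by (simp add: inj_on_def)
  have O: "sum total ?O = (\<Sum>q\<in>{0..<M}. total (2 * q + 1))"
    by (subst sum.reindex) (auto simp: inj_on_def)
  have E: "sum total ?E = (\<Sum>q\<in>{1..<M}. total (2 * q))"
    by (subst sum.reindex) (auto simp: inj_on_def)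
  have "1 * (M - 0) \<le> sum total ?O" unfolding O
    by (rule int_interval_sum_ge) (use M odd_total in auto)
  then have "sum total ?L + (\<Sum>q\<in>{1..<M}. total (2 * q)) + M \<le> sum total ?L + sum total ?E + sum total ?O"
    unfolding E by simp
  also have "\<dots> = sum total ((?L \<union> ?E) \<union> ?O)"
    using disj by (simp add: sum.union_disjoint)
  also have "\<dots> = (\<Sum>x\<in>of_int ` ((?L \<union> ?E) \<union> ?O). variation h x 0 N)"
    by (subst sum.reindex) (auto simp: inj)
  also have "\<dots> \<le> int N"
    by (rule sum_variation_le[OF p1 walk]) (use mono[of 0] in auto)
  finally show ?thesis .
qed

text \<open>Every point between the marks changes its status at least twice. The points \<open>2, 4, 6\<close> are ahead at
the start and passed at the end, which takes a third change when the left end is touched last.\<close>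

lemma right_left_length:
  assumes "touches_right h M k" "touches_left h A l" "k \<le> l" "l \<le> N" "j = 3"
  shows "2 * A + 3 * M - 1 \<le> int N"
proof -
  have a: "2 * (1 - (2 - A)) \<le> sum total {2 - A..<1}"
  proof (rule int_interval_sum_ge)
    fix u assume u: "2 - A \<le> u" "u < 1"
    show "2 \<le> total u"
      using total_ge2[of k l u] state_at_right_touch[of k u] state_at_left_touch[of l u] state_start[of u]
        state_left_end[of u] state_range[of k u] state_range[of l u] u assms M by (auto split: if_splits)
  qed (use A in simp)
  have b: "3 * (4 - 1) \<le> (\<Sum>q\<in>{1..<4}. total (2 * q))"
  proof (rule int_interval_sum_ge)
    fix q :: int assume u: "1 \<le> q" "q < 4"
    show "3 \<le> total (2 * q)"
      using total_ge2[of k l "2 * q"] state_at_right_touch[of k "2 * q"] state_at_left_touch[of l "2 * q"] 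
        state_start[of "2 * q"] state_even_end[of q] state_range[of k "2 * q"] state_range[of l "2 * q"] 
        u assms A M by (auto split: if_splits)
  qed simp
  have c: "2 * (M - 4) \<le> (\<Sum>q\<in>{4..<M}. total (2 * q))"
  proof (rule int_interval_sum_ge)
    fix q :: int assume u: "4 \<le> q" "q < M"
    show "2 \<le> total (2 * q)"
      using total_ge2[of k l "2 * q"] state_at_right_touch[of k "2 * q"] state_at_left_touch[of l "2 * q"] 
        state_start[of "2 * q"] state_even_end[of q] state_range[of k "2 * q"] state_range[of l "2 * q"] 
        u assms A M by (auto split: if_splits)
  qed (use M in simp)
  have "(\<Sum>q\<in>{1..<M}. total (2 * q)) = (\<Sum>q\<in>{1..<4}. total (2 * q)) + (\<Sum>q\<in>{4..<M}. total (2 * q))"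
    by (rule int_interval_sum_split) (use M in auto)
  then show ?thesis using a b c length_ge by simp
qed

text \<open>Now the points \<open>-2, -1, 0\<close> are passed at the start and ahead at the end, which takes a third change
when the right end is touched last.\<close>

lemma left_right_length:
  assumes "touches_left h A k" "touches_right h M l" "k \<le> l" "l \<le> N" "j = - 3"
  shows "2 * A + 3 * M - 1 \<le> int N"
proof -
  have a: "2 * (- 2 - (2 - A)) \<le> sum total {2 - A..<- 2}"
  proof (rule int_interval_sum_ge)
    fix u assume u: "2 - A \<le> u" "u < - 2"
    show "2 \<le> total u"
      using total_ge2[of k l u] state_at_right_touch[of l u] state_at_left_touch[of k u] state_start[of u]
        state_left_end[of u] state_range[of k u] state_range[of l u] u assms M by (auto split: if_splits)
  qed (use A in simp)
  have b: "3 * (1 - - 2) \<le> sum total {- 2..<1}"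
  proof (rule int_interval_sum_ge)
    fix u :: int assume u: "- 2 \<le> u" "u < 1"
    show "3 \<le> total u"
      using total_ge2[of k l u] state_at_right_touch[of l u] state_at_left_touch[of k u] state_start[of u]
        state_left_end[of u] state_range[of k u] state_range[of l u] u assms A M by (auto split: if_splits)
  qed simp
  have c: "2 * (M - 1) \<le> (\<Sum>q\<in>{1..<M}. total (2 * q))"
  proof (rule int_interval_sum_ge)
    fix q :: int assume u: "1 \<le> q" "q < M"
    show "2 \<le> total (2 * q)"
      using total_ge2[of k l "2 * q"] state_at_right_touch[of l "2 * q"] state_at_left_touch[of k "2 * q"] 
        state_start[of "2 * q"] state_even_end[of q] state_range[of k "2 * q"] state_range[of l "2 * q"] 
        u assms A M by (auto split: if_splits)
  qed (use M in simp)
  have "sum total {2 - A..<1} = sum total {2 - A..<- 2} + sum total {- 2..<1}"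
    by (rule int_interval_sum_split) (use A in auto)
  then show ?thesis using a b c length_ge by simp
qed

lemma total_nonneg: "0 \<le> total u"
  using variation_ge[of 0 N h "of_int u"] by simp

text \<open>The left part is crossed four times instead of twice.\<close>

lemma left_right_left_length:
  assumes "touches_left h A k" "touches_right h M l" "touches_left h A m" "k \<le> l" "l \<le> m" "m \<le> N"
  shows "4 * A + 3 * M - 24 \<le> int N"
proof -
  have a: "4 * (- 2 - (2 - A)) \<le> sum total {2 - A..<- 2}"
  proof (rule int_interval_sum_ge)
    fix u assume u: "2 - A \<le> u" "u < - 2"
    show "4 \<le> total u"
      using total_ge3[of k l m u] state_at_right_touch[of l u] state_at_left_touch[of k u] state_at_left_touch[of m u] 
        state_start[of u] state_left_end[of u] state_range[of k u] state_range[of l u] state_range[of m u] 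
        u assms M j by (auto split: if_splits)
  qed (use A in simp)
  have b: "0 * (1 - - 2) \<le> sum total {- 2..<1}" by (rule int_interval_sum_ge) (simp, rule total_nonneg)
  have b': "0 * (4 - 1) \<le> (\<Sum>q\<in>{1..<4}. total (2 * q))" 
    by (rule int_interval_sum_ge) (simp, rule total_nonneg)
  have c: "2 * (M - 4) \<le> (\<Sum>q\<in>{4..<M}. total (2 * q))"
  proof (rule int_interval_sum_ge)
    fix q :: int assume u: "4 \<le> q" "q < M"
    show "2 \<le> total (2 * q)"
      using total_ge1[of l "2 * q"] state_at_right_touch[of l "2 * q"] 
        state_start[of "2 * q"] state_even_end[of q] state_range[of l "2 * q"] 
        u assms A M j by (auto split: if_splits)
  qed (use M in simp)
  have "sum total {2 - A..<1} = sum total {2 - A..<- 2} + sum total {- 2..<1}"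
    by (rule int_interval_sum_split) (use A in auto)
  moreover have "(\<Sum>q\<in>{1..<M}. total (2 * q)) = (\<Sum>q\<in>{1..<4}. total (2 * q)) + (\<Sum>q\<in>{4..<M}. total (2 * q))"
    by (rule int_interval_sum_split) (use M in auto)
  ultimately show ?thesis using a b b' c length_ge by simp
qed

text \<open>At the end \<open>2q\<close> and \<open>2q + 1\<close> are siblings with \<open>e = 0\<close>.\<close>

lemma even_point_visits_left:
  assumes "0 \<le> q" "q < M"
  shows "\<exists>k\<le>N. state k (2 * q) = - 1"
proof -
  have "sibling (p + 1) (h N (of_int (2 * q))) (h N (of_int (2 * q + 1)))"
    unfolding sibling_def even_end[OF assms] odd_end[OF assms]
    by (rule exI[of _ "q - j"], rule exI[of _ 0]) (simp add: add.commute)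
  moreover have "h 0 (of_int (2 * q + 1)) \<in> \<int>" using start by (simp only: id_apply Ints_of_int)
  ultimately obtain k where "k \<le> N" "h k (of_int (2 * q)) = 0"
    using parent_at_zero[OF p1 walk _ _ odd_end_hidden[OF assms]] by blast
  then show ?thesis by (intro exI[of _ k]) (simp add: status_def)
qed

text \<open>An even point \<open>2q\<close> would need only two changes if it were buried from before the first touch until
after the last one. But it is passed at some time, and being passed as well as surviving the
touches takes four changes.\<close>

lemma right_left_right_length:
  assumes "touches_right h M k" "touches_left h A l" "touches_right h M m" "k \<le> l" "l \<le> m" "m \<le> N"
  shows "2 * A + 5 * M - 24 \<le> int N"
proof -
  have a: "2 * (- 2 - (2 - A)) \<le> sum total {2 - A..<- 2}"
  proof (rule int_interval_sum_ge)
    fix u assume u: "2 - A \<le> u" "u < - 2"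
    show "2 \<le> total u"
      using total_ge1[of l u] state_at_left_touch[of l u] 
        state_start[of u] state_left_end[of u] state_range[of l u]
        u assms M j by (auto split: if_splits)
  qed (use A in simp)
  have b: "0 * (1 - - 2) \<le> sum total {- 2..<1}" by (rule int_interval_sum_ge) (simp, rule total_nonneg)
  have b': "0 * (4 - 1) \<le> (\<Sum>q\<in>{1..<4}. total (2 * q))" 
    by (rule int_interval_sum_ge) (simp, rule total_nonneg)
  have c: "4 * (M - 4) \<le> (\<Sum>q\<in>{4..<M}. total (2 * q))"
  proof (rule int_interval_sum_ge)
    fix q :: int assume u: "4 \<le> q" "q < M"
    obtain i where i: "i \<le> N" "state i (2 * q) = - 1" using even_point_visits_left[of q] u by auto
    have s: "state 0 (2 * q) = 0" "state N (2 * q) = 0"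
      using state_start[of "2 * q"] state_even_end[of q] u j by auto
    have k: "state k (2 * q) = -1 \<or> state k (2 * q) = 1"
      using state_at_right_touch[of k "2 * q"] state_range[of k "2 * q"] u assms by auto
    have m: "state m (2 * q) = -1 \<or> state m (2 * q) = 1"
      using state_at_right_touch[of m "2 * q"] state_range[of m "2 * q"] u assms by auto
    have l: "state l (2 * q) = 0 \<or> state l (2 * q) = 1"
      using state_at_left_touch[of l "2 * q"] state_range[of l "2 * q"] u assms A by auto
    \<comment> \<open>If the point is ahead at time \<open>l\<close>, the three touches give four changes. If it is buried, the
      visit to the left of \<open>1\<close> before or after \<open>l\<close> does.\<close>
    consider "i \<le> l" | "l \<le> i" by linarith
    then show "4 \<le> total (2 * q)"
    proof cases
      case 1
      show ?thesis using total_ge2[of i l "2 * q"] total_ge3[of k l m "2 * q"] 1 s k l m i assms by auto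
    next
      case 2
      show ?thesis using total_ge2[of l i "2 * q"] total_ge3[of k l m "2 * q"] 2 s k l m i assms by auto
    qed
  qed (use M in simp)
  have "sum total {2 - A..<1} = sum total {2 - A..<- 2} + sum total {- 2..<1}"
    by (rule int_interval_sum_split) (use A in auto)
  moreover have "(\<Sum>q\<in>{1..<M}. total (2 * q)) = (\<Sum>q\<in>{1..<4}. total (2 * q)) + (\<Sum>q\<in>{4..<M}. total (2 * q))"
    by (rule int_interval_sum_split) (use M in auto)
  ultimately show ?thesis using a b b' c length_ge by simp
qed

end

section \<open>The generators as bent maps of the interval\<close>

text \<open>The common shape of all generators: identity, slope \<open>1/n\<close>, slope \<open>1\<close>, and slope \<open>n\<close> up to \<open>1\<close>. The
length \<open>(b - a)/n\<close> of the last piece is forced by continuity.\<close>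

definition bend :: "real \<Rightarrow> real \<Rightarrow> real \<Rightarrow> real \<Rightarrow> real" where
  "bend n a b t =
     (if t \<le> a then t
      else if t \<le> b then a + (t - a) / n
      else if t \<le> 1 - (b - a) / n then t - (b - a) * (1 - 1 / n)
      else if t \<le> 1 then 1 - n * (1 - t)
      else t)"

lemma bend_pieces:
  assumes "n > 1" "a \<le> b" "b \<le> 1 - (b - a) / n"
  shows "t \<le> a \<Longrightarrow> bend n a b t = t"
    and "a \<le> t \<Longrightarrow> t \<le> b \<Longrightarrow> bend n a b t = a + (t - a) / n"
    and "b \<le> t \<Longrightarrow> t \<le> 1 - (b - a) / n \<Longrightarrow> bend n a b t = t - (b - a) * (1 - 1 / n)"
    and "1 - (b - a) / n \<le> t \<Longrightarrow> t \<le> 1 \<Longrightarrow> bend n a b t = 1 - n * (1 - t)"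
    and "1 \<le> t \<Longrightarrow> bend n a b t = t"
proof -
  have e1: "a + (b - a) / n = b - (b - a) * (1 - 1 / n)"
    by (simp add: right_diff_distrib)
  have e2: "1 - (b - a) / n - (b - a) * (1 - 1 / n) = 1 - n * (1 - (1 - (b - a) / n))"
    using assms(1) by (simp add: field_simps)
  show "t \<le> a \<Longrightarrow> bend n a b t = t" by (simp add: bend_def)
  show 2: "a \<le> t \<Longrightarrow> t \<le> b \<Longrightarrow> bend n a b t = a + (t - a) / n" for t by (auto simp: bend_def)
  show 3: "b \<le> t \<Longrightarrow> t \<le> 1 - (b - a) / n \<Longrightarrow> bend n a b t = t - (b - a) * (1 - 1 / n)" for t
    using 2[of t] e1 assms(2) by (cases "t = b") (auto simp: bend_def)
  show 4: "1 - (b - a) / n \<le> t \<Longrightarrow> t \<le> 1 \<Longrightarrow> bend n a b t = 1 - n * (1 - t)" for t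
    using 3[of t] e2 assms by (cases "t = 1 - (b - a) / n") (auto simp: bend_def)
  have "(b - a) / n \<ge> 0" using assms by simp
  moreover from this have "b \<le> 1" "a \<le> 1" using assms by linarith+
  ultimately show "1 \<le> t \<Longrightarrow> bend n a b t = t" 
    using 4[of 1] by (cases "t = 1") (auto simp: bend_def)
qed

lemma subdiv_interval:
  fixes d :: "nat \<Rightarrow> real"
  assumes "d 0 \<le> t" "t \<le> d (Suc m)"
  shows "\<exists>j\<le>m. d j \<le> t \<and> t \<le> d (Suc j)"
  using assms(2)
proof (induction m)
  case 0 then show ?case using assms(1) by auto
next
  case (Suc m)
  show ?case
  proof (cases "t \<le> d (Suc m)")
    case True
    then obtain j where "j \<le> m" "d j \<le> t" "t \<le> d (Suc j)" using Suc.IH by auto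
    then show ?thesis by (intro exI[of _ j]) simp
  next
    case False
    then show ?thesis using Suc.prems by (intro exI[of _ "Suc m"]) simp
  qed
qed

lemma subdiv_eqs:
  assumes "i \<le> p"
  shows "j \<le> i \<Longrightarrow> subdiv p i j = real j / (real p + 1)"
    and "i \<le> j \<Longrightarrow> j \<le> i + p + 1 \<Longrightarrow> subdiv p i j = real i / (real p + 1) + (real j - real i) / (real p + 1)\<^sup>2"
    and "i + p + 1 \<le> j \<Longrightarrow> subdiv p i j = (real j - real p) / (real p + 1)"
proof -
  show "j \<le> i \<Longrightarrow> subdiv p i j = real j / (real p + 1)" by (simp add: subdiv_def add.commute)
  show 2: "i \<le> j \<Longrightarrow> j \<le> i + p + 1 \<Longrightarrow> subdiv p i j = real i / (real p + 1) + (real j - real i) / (real p + 1)\<^sup>2"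
    by (auto simp: subdiv_def add.commute of_nat_diff)
  have e: "real i / (real p + 1) + (real p + 1) / (real p + 1)\<^sup>2 = (real i + 1) / (real p + 1)"
  proof -
    have "x / y + y / y\<^sup>2 = (x + 1) / y" if "y \<noteq> 0" for x y :: real
      using that by (simp add: field_simps power2_eq_square)
    then show ?thesis by (simp add: add_nonneg_eq_0_iff)
  qed
  show "i + p + 1 \<le> j \<Longrightarrow> subdiv p i j = (real j - real p) / (real p + 1)"
  proof (cases "j = i + p + 1")
    case True
    then have j: "real j - real i = real p + 1" "real j - real p = real i + 1" by simp_all
    have "subdiv p i j = real i / (real p + 1) + (real j - real i) / (real p + 1)\<^sup>2"
      by (rule 2) (use True in auto)
    then show ?thesis using e unfolding j by simp
  next
    case False
    then show "i + p + 1 \<le> j \<Longrightarrow> ?thesis" by (auto simp: subdiv_def add.commute of_nat_diff)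
  qed
qed

text \<open>On the \<open>j\<close>-th interval of the domain the ranges \<open>j < i\<close>, \<open>i \<le> j < p\<close>, \<open>p \<le> j \<le> i + p\<close> and
\<open>j > i + p\<close> correspond to the four pieces.\<close>

lemma thompson_x_bend:
  assumes "i < p"
  shows "thompson_x p i = bend (real p + 1) (real i / (real p + 1)) (real p / (real p + 1))"
proof
  fix t
  define n where "n = real p + 1"
  have n: "n > 1" "n \<noteq> 0" using assms by (auto simp: n_def)
  have pn: "real p = n - 1" by (simp add: n_def)
  define a where "a = real i / n"
  define b where "b = real p / n"
  have ab: "a \<le> b" using assms n by (simp add: a_def b_def divide_right_mono)
  have c: "1 - (b - a) / n = b + (real i + 1) / n\<^sup>2"
    unfolding a_def b_def pn using n by (simp add: field_simps power2_eq_square)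
  have bc: "b \<le> 1 - (b - a) / n" unfolding c by simp
  note B = bend_pieces[OF n(1) ab bc]
  show "thompson_x p i t = bend (real p + 1) (real i / (real p + 1)) (real p / (real p + 1)) t"
    unfolding n_def[symmetric] a_def[symmetric] b_def[symmetric]
  proof (cases "t \<in> {0..1}")
    case False
    then have "t < 0 \<or> t > 1" by auto
    moreover have "0 \<le> a" using n by (simp add: a_def)
    ultimately have "bend n a b t = t" using B(1)[of t] B(5)[of t] by auto
    then show "thompson_x p i t = bend n a b t" using False assms 
      by (simp only: thompson_x_def thompson_x_low_def if_True if_False)
  next
    case True
    let ?d = "subdiv p p" let ?r = "subdiv p i"
    obtain j where j: "j \<le> 2 * p" "?d j \<le> t" "t \<le> ?d (Suc j)"
      using subdiv_interval[of ?d t "2 * p"] True subdiv_ends[of p p] by auto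
    have lt: "?d j < ?d (Suc j)" using subdiv_strict[of p p j] by simp
    define s where "s = (t - ?d j) / (?d (Suc j) - ?d j)"
    have s: "0 \<le> s" "s \<le> 1" using j lt by (auto simp: s_def field_simps)
    have "s * (?d (Suc j) - ?d j) = t - ?d j" using lt by (simp add: s_def)
    then have t: "t = (1 - s) * ?d j + s * ?d (Suc j)" by (simp add: algebra_simps)
    have x: "thompson_x p i t = (1 - s) * ?r j + s * ?r (Suc j)"
      unfolding t by (rule thompson_x_affine[OF assms j(1) s])
    consider "j < i" | "i \<le> j" "j < p" | "p \<le> j" "j \<le> i + p" | "i + p + 1 \<le> j" by linarith
    then show "thompson_x p i t = bend n a b t"
    proof cases
      case 1
      have d: "?d j = real j / n" "?d (Suc j) = (real j + 1) / n"
        using subdiv_eqs(1)[of p p j] subdiv_eqs(1)[of p p "Suc j"] 1 assms by (simp_all add: n_def add.commute)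
      have r: "?r j = real j / n" "?r (Suc j) = (real j + 1) / n"
        using subdiv_eqs(1)[of i p j] subdiv_eqs(1)[of i p "Suc j"] 1 assms by (simp_all add: n_def add.commute)
      have ts: "t = (real j + s) / n" unfolding t d using n by (simp add: field_simps)
      have xs: "thompson_x p i t = (real j + s) / n" unfolding x r using n by (simp add: field_simps)
      have "real j + s \<le> real i" using 1 s by linarith
      then have "t \<le> a" unfolding ts a_def using n by (simp add: divide_right_mono)
      then show ?thesis using B(1) xs ts by simp
    next
      case 2
      have d: "?d j = real j / n" "?d (Suc j) = (real j + 1) / n"
        using subdiv_eqs(1)[of p p j] subdiv_eqs(1)[of p p "Suc j"] 2 assms by (simp_all add: n_def add.commute)
      have r: "?r j = a + (real j - real i) / n\<^sup>2" "?r (Suc j) = a + (real j + 1 - real i) / n\<^sup>2"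
        using subdiv_eqs(2)[of i p j] subdiv_eqs(2)[of i p "Suc j"] 2 assms by (simp_all add: n_def a_def add.commute)
      have ts: "t = (real j + s) / n" unfolding t d using n by (simp add: field_simps)
      have xs: "thompson_x p i t = a + (real j + s - real i) / n\<^sup>2" unfolding x r using n by (simp add: field_simps)
      have "real i \<le> real j + s" "real j + s \<le> real p" using 2 s by linarith+
      then have "a \<le> t" "t \<le> b" unfolding ts a_def b_def using n by (simp_all add: divide_right_mono)
      then have "bend n a b t = a + (t - a) / n" by (rule B(2))
      also have "\<dots> = a + (real j + s - real i) / n\<^sup>2" unfolding ts a_def using n
        by (simp add: field_simps power2_eq_square)
      finally show ?thesis using xs by simp
    next
      case 3
      have d: "?d j = b + (real j - real p) / n\<^sup>2" "?d (Suc j) = b + (real j + 1 - real p) / n\<^sup>2"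
        using subdiv_eqs(2)[of p p j] subdiv_eqs(2)[of p p "Suc j"] 3 assms by (simp_all add: n_def b_def add.commute)
      have r: "?r j = a + (real j - real i) / n\<^sup>2" "?r (Suc j) = a + (real j + 1 - real i) / n\<^sup>2"
        using subdiv_eqs(2)[of i p j] subdiv_eqs(2)[of i p "Suc j"] 3 assms by (simp_all add: n_def a_def add.commute)
      have ts: "t = b + (real j + s - real p) / n\<^sup>2" unfolding t d using n by (simp add: field_simps)
      have xs: "thompson_x p i t = a + (real j + s - real i) / n\<^sup>2" unfolding x r using n by (simp add: field_simps)
      have "0 \<le> real j + s - real p" "real j + s - real p \<le> real i + 1" using 3 s by linarith+
      then have "b \<le> t" "t \<le> 1 - (b - a) / n" unfolding c ts using n by (simp_all add: divide_right_mono)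
      then have "bend n a b t = t - (b - a) * (1 - 1 / n)" by (rule B(3))
      also have "\<dots> = a + (real j + s - real i) / n\<^sup>2" unfolding ts a_def b_def pn using n
        by (simp add: field_simps power2_eq_square)
      finally show ?thesis using xs by simp
    next
      case 4
      have d: "?d j = b + (real j - real p) / n\<^sup>2" "?d (Suc j) = b + (real j + 1 - real p) / n\<^sup>2"
        using subdiv_eqs(2)[of p p j] subdiv_eqs(2)[of p p "Suc j"] 4 j assms by (simp_all add: n_def b_def add.commute)
      have r: "?r j = (real j - real p) / n" "?r (Suc j) = (real j + 1 - real p) / n"
        using subdiv_eqs(3)[of i p j] subdiv_eqs(3)[of i p "Suc j"] 4 j assms by (simp_all add: n_def a_def add.commute)
      have ts: "t = b + (real j + s - real p) / n\<^sup>2" unfolding t d using n by (simp add: field_simps)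
      have xs: "thompson_x p i t = (real j + s - real p) / n" unfolding x r using n by (simp add: field_simps)
      have "real i + 1 \<le> real j + s - real p" using 4 s by linarith
      then have "1 - (b - a) / n \<le> t" unfolding c ts using n by (simp_all add: divide_right_mono)
      then have "bend n a b t = 1 - n * (1 - t)" using True by (intro B(4)) auto
      also have "\<dots> = (real j + s - real p) / n" unfolding ts b_def pn using n
        by (simp add: field_simps power2_eq_square)
      finally show ?thesis using xs by simp
    qed
  qed
qed

lemma thompson_x_last_bend:
  assumes "p \<ge> 1"
  shows "thompson_x p p = bend (real p + 1) (real p / (real p + 1)) (real p / (real p + 1) + real p / (real p + 1)\<^sup>2)"
proof
  fix t
  define n where "n = real p + 1"
  have n: "n > 1" "n \<noteq> 0" "real p = n - 1" using assms by (auto simp: n_def)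
  define a where "a = real p / n"
  define b where "b = a + real p / n\<^sup>2"
  have ab: "a \<le> b" by (simp add: b_def)
  have c: "1 - (b - a) / n = b + 1 / n ^ 3"
    unfolding a_def b_def n(3) using n by (simp add: field_simps power2_eq_square power3_eq_cube)
  have bc: "b \<le> 1 - (b - a) / n" unfolding c using n by simp
  note B = bend_pieces[OF n(1) ab bc]
  have C0: "0 \<le> a" "a \<le> 1 - (a - 0) / n"
    unfolding a_def n(3) using n by (simp_all add: field_simps power2_eq_square)
  note C = bend_pieces[OF n(1) C0]
  have x0: "thompson_x_low p 0 = bend n 0 a"
    using thompson_x_bend[of 0 p] assms by (simp add: thompson_x_def n_def a_def)
  have l: "thompson_x p p t = (if t \<in> {a..1} then (n - 1 + bend n 0 a (n * t - (n - 1))) / n else t)"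
    unfolding thompson_x_def thompson_x_last_def x0 a_def n_def by (simp add: algebra_simps)
  have "thompson_x p p t = bend n a b t"
  proof (cases "t \<in> {a..1}")
    case False
    then have "t < a \<or> t > 1" by auto
    then have "bend n a b t = t" using B(1)[of t] B(5)[of t] by auto
    then show ?thesis using False l by (simp only: if_False)
  next
    case True
    define r where "r = n * t - (n - 1)"
    have tr: "t = a + r / n" unfolding r_def a_def n(3) using n by (simp add: field_simps)
    have r: "0 \<le> r" "r \<le> 1" using True n unfolding r_def a_def n(3) by (auto simp: field_simps)
    have x: "thompson_x p p t = a + bend n 0 a r / n" using l True 
      by (simp add: r_def a_def n(3) add_divide_distrib)
    have ba: "b = a + a / n" unfolding b_def a_def by (simp add: power2_eq_square)
    consider "r \<le> a" | "a \<le> r" "r \<le> 1 - a / n" | "1 - a / n \<le> r" by linarith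
    then show ?thesis
    proof cases
      case 1
      then have "a \<le> t" "t \<le> b" using r n unfolding tr ba by (auto simp: divide_right_mono)
      then show ?thesis using B(2) x C(2)[of r] r 1 by (simp add: tr)
    next
      case 2
      have "b \<le> t" using 2 n unfolding tr ba by (auto simp: divide_right_mono)
      moreover have "t \<le> 1 - (b - a) / n"
      proof -
        have "r / n \<le> (1 - a / n) / n" using 2 n by (intro divide_right_mono) auto
        moreover have "a + (1 - a / n) / n = 1 - (b - a) / n" 
          unfolding ba a_def n(3) using n by (simp add: field_simps power2_eq_square)
        ultimately show ?thesis unfolding tr by simp
      qed
      ultimately have "bend n a b t = t - (b - a) * (1 - 1 / n)" by (rule B(3))
      also have "\<dots> = a + (r - a * (1 - 1 / n)) / n" unfolding tr ba by (simp add: diff_divide_distrib)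
      also have "\<dots> = thompson_x p p t" using C(3)[of r] 2 x by simp
      finally show ?thesis by simp
    next
      case 3
      have "1 - (b - a) / n \<le> t"
      proof -
        have "(1 - a / n) / n \<le> r / n" using 3 n by (intro divide_right_mono) auto
        moreover have "a + (1 - a / n) / n = 1 - (b - a) / n" 
          unfolding ba a_def n(3) using n by (simp add: field_simps power2_eq_square)
        ultimately show ?thesis unfolding tr by simp
      qed
      then have "bend n a b t = 1 - n * (1 - t)" using True by (intro B(4)) auto
      also have "\<dots> = a + (1 - n * (1 - r)) / n" unfolding tr a_def n(3) using n by (simp add: field_simps)
      also have "\<dots> = thompson_x p p t" using C(4)[of r] 3 r x by simp
      finally show ?thesis by simp
    qed
  qed
  then show "thompson_x p p t = bend (real p + 1) (real p / (real p + 1)) (real p / (real p + 1) + real p / (real p + 1)\<^sup>2) t"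
    by (simp add: a_def b_def n_def)
qed

section \<open>A chart of the open interval\<close>

text \<open>The piecewise affine map of the line onto \<open>(0,1)\<close> that sends the points \<open>1 + p u = k\<close>, for integers
\<open>k\<close>, to the ends of the standard intervals hanging off the spines: towards \<open>0\<close> each unit interval is
\<open>n\<close> times shorter than the next one, and towards \<open>1\<close> the lengths shrink by \<open>n\<close> whenever
\<open>1 + p u\<close> crosses a multiple of \<open>p\<close>.\<close>

definition chart :: "nat \<Rightarrow> real \<Rightarrow> real" where
  "chart p u =
     (if u \<le> 0 then (1 + real p * (u - of_int \<lfloor>u\<rfloor>)) * (real p + 1) powi (\<lfloor>u\<rfloor> - 1)
      else let q = \<lfloor>u + 1 / real p\<rfloor> in
        1 - (real p + 1) powi (- q) * (1 - (1 + real p * u - of_int q * real p) / (real p + 1)))"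

lemma scaled_le_iff:
  assumes "p \<ge> (1::nat)"
  shows "u \<le> 1 \<longleftrightarrow> real p * u \<le> real p" "1 \<le> u \<longleftrightarrow> real p \<le> real p * u"
    "0 \<le> u \<longleftrightarrow> 0 \<le> real p * u" "2 \<le> u \<longleftrightarrow> 2 * real p \<le> real p * u"
    "u \<le> 2 \<longleftrightarrow> real p * u \<le> 2 * real p"
  using assms by (auto simp: mult.commute[of 2] zero_le_mult_iff)

lemma power_int_pred:
  fixes n :: real
  assumes "n > 1"
  shows "n powi (k - 1) = n powi k / n"
  using assms by (subst power_int_diff) auto

text \<open>The formula is valid on closed intervals, so that the pieces may be glued at their common ends.\<close>

lemma chart_left:
  assumes "p \<ge> 1" "of_int d \<le> u" "u \<le> of_int d + 1" "u \<le> 0"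
  shows "chart p u = (1 + real p * (u - of_int d)) * (real p + 1) powi (d - 1)"
proof (cases "u = of_int d + 1")
  case True
  then have "\<lfloor>u\<rfloor> = d + 1" by linarith
  moreover have "(real p + 1) powi d = (real p + 1) * (real p + 1) powi (d - 1)"
    using assms(1) by (simp add: power_int_pred)
  ultimately show ?thesis using True assms(4) by (simp add: chart_def add.commute)
next
  case False
  then have "\<lfloor>u\<rfloor> = d" using assms by linarith
  then show ?thesis using assms(4) by (simp add: chart_def)
qed

lemma chart_right:
  assumes "p \<ge> 1" "of_int q * real p \<le> 1 + real p * u" "1 + real p * u \<le> (of_int q + 1) * real p" "0 \<le> u"
  shows "chart p u = 1 - (real p + 1) powi (- q) * (1 - (1 + real p * u - of_int q * real p) / (real p + 1))"
proof -
  define n where "n = real p + 1"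
  have n: "n > 1" using assms(1) by (simp add: n_def)
  have p: "real p > 0" using assms(1) by simp
  have main: "1 - n powi (- \<lfloor>u + 1 / real p\<rfloor>) * (1 - (1 + real p * u - of_int \<lfloor>u + 1 / real p\<rfloor> * real p) / n)
     = 1 - n powi (- q) * (1 - (1 + real p * u - of_int q * real p) / n)"
  proof (cases "1 + real p * u = (of_int q + 1) * real p")
    case True
    have "u + 1 / real p = (1 + real p * u) / real p" using p by (simp add: field_simps)
    also have "\<dots> = of_int (q + 1)" unfolding True using p by simp
    finally have f: "\<lfloor>u + 1 / real p\<rfloor> = q + 1" by linarith
    have "n powi (- q) = n * n powi (- (q + 1))"
      using n power_int_pred[OF n, of "- q"] by simp
    moreover have "1 - real p / n = 1 / n" using n by (simp add: n_def field_simps)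
    moreover have "1 + real p * u - of_int q * real p = real p" "1 + real p * u - of_int (q + 1) * real p = 0"
      using True by (simp_all add: algebra_simps)
    ultimately show ?thesis unfolding f using n by simp
  next
    case False
    have "u + 1 / real p = (1 + real p * u) / real p" using p by (simp add: field_simps)
    moreover have "of_int q \<le> (1 + real p * u) / real p" "(1 + real p * u) / real p < of_int q + 1"
      using assms(2,3) False p by (simp_all add: pos_le_divide_eq pos_divide_less_eq)
    ultimately have f: "\<lfloor>u + 1 / real p\<rfloor> = q" by linarith
    show ?thesis unfolding f ..
  qed
  show ?thesis
  proof (cases "u = 0")
    case True
    have l: "chart p 0 = 1 / n" using chart_left[of p 0 0] assms(1) by (simp add: n_def power_int_minus divide_inverse)
    have "q = 0 \<or> q = 1"
    proof -
      have "of_int q * real p \<le> 1" "(of_int q + 1) * real p \<ge> 1" using assms(2,3) True by auto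
      moreover have "q \<le> 1" 
      proof (rule ccontr)
        assume "\<not> q \<le> 1"
        then have "2 * real p \<le> of_int q * real p" by (intro mult_right_mono) auto
        moreover have "real p \<ge> 1" using assms(1) by simp
          ultimately show False using \<open>of_int q * real p \<le> 1\<close> by linarith
      qed
      moreover have "q \<ge> 0"
      proof (rule ccontr)
        assume "\<not> q \<ge> 0"
        then have "(of_int q + 1) * real p \<le> 0 * real p" by (intro mult_right_mono) auto
        then show False using \<open>(of_int q + 1) * real p \<ge> 1\<close> by simp
      qed
      ultimately show ?thesis by auto
    qed
    then show ?thesis
    proof
      assume "q = 0" then show ?thesis using l True by (simp add: n_def)
    next
      assume q: "q = 1"
      then have "p = 1" using assms(1,2) True by simp
      then show ?thesis using l True q by (simp add: n_def power_int_minus)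
    qed
  next
    case False
    then show ?thesis using main assms(4) unfolding n_def by (simp add: chart_def Let_def)
  qed
qed

lemma chart_strict_mono_left:
  assumes "p \<ge> 1" "u < v" "v \<le> 0"
  shows "chart p u < chart p v"
proof -
  define n where "n = real p + 1"
  have n: "n > 1" using assms(1) by (simp add: n_def)
  define d e where "d = \<lfloor>u\<rfloor>" and "e = \<lfloor>v\<rfloor>"
  have d: "of_int d \<le> u" "u < of_int d + 1" and e: "of_int e \<le> v" "v < of_int e + 1"
    by (auto simp: d_def e_def)
  have u: "chart p u = (1 + real p * (u - of_int d)) * n powi (d - 1)"
    unfolding n_def by (rule chart_left) (use assms d in auto)
  have v: "chart p v = (1 + real p * (v - of_int e)) * n powi (e - 1)"
    unfolding n_def by (rule chart_left) (use assms e in auto)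
  have pos: "n powi k > 0" for k using n by simp
  have "d \<le> e" using assms(2) by (simp add: d_def e_def floor_mono)
  show ?thesis
  proof (cases "d = e")
    case True
    have "1 + real p * (u - of_int d) < 1 + real p * (v - of_int e)" using assms True by simp
    then show ?thesis unfolding u v True using pos by (intro mult_strict_right_mono) auto
  next
    case False
    have "real p * (u - of_int d) < real p * 1" using d assms(1) by (intro mult_strict_left_mono) auto
    then have "1 + real p * (u - of_int d) < n" by (simp add: n_def)
    then have "chart p u < n * n powi (d - 1)" unfolding u using pos by (intro mult_strict_right_mono) auto
    also have "\<dots> = n powi d" using n by (simp add: power_int_pred)
    also have "\<dots> \<le> n powi (e - 1)" using n False \<open>d \<le> e\<close> by (intro power_int_increasing) auto
    also have "\<dots> = 1 * n powi (e - 1)" by simp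
    also have "\<dots> \<le> chart p v" unfolding v using pos[of "e - 1"] e by (intro mult_right_mono) auto
    finally show ?thesis .
  qed
qed

lemma chart_strict_mono_right:
  assumes "p \<ge> 1" "u < v" "0 \<le> u"
  shows "chart p u < chart p v"
proof -
  define n where "n = real p + 1"
  have n: "n > 1" using assms(1) by (simp add: n_def)
  have p: "real p > 0" using assms(1) by simp
  define d e where "d = \<lfloor>u + 1 / real p\<rfloor>" and "e = \<lfloor>v + 1 / real p\<rfloor>"
  have "of_int d \<le> u + 1 / real p" "u + 1 / real p < of_int d + 1" 
    "of_int e \<le> v + 1 / real p" "v + 1 / real p < of_int e + 1" by (auto simp: d_def e_def)
  then have d: "of_int d * real p \<le> 1 + real p * u" "1 + real p * u < (of_int d + 1) * real p"
    and e: "of_int e * real p \<le> 1 + real p * v" "1 + real p * v < (of_int e + 1) * real p"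
    using p by (simp_all add: field_simps)
  have u: "chart p u = 1 - n powi (- d) * (1 - (1 + real p * u - of_int d * real p) / n)"
    unfolding n_def by (rule chart_right) (use assms d in auto)
  have v: "chart p v = 1 - n powi (- e) * (1 - (1 + real p * v - of_int e * real p) / n)"
    unfolding n_def by (rule chart_right) (use assms e in auto)
  have pos: "n powi k > 0" for k using n by simp
  have de: "d \<le> e" using assms(2) by (simp add: d_def e_def floor_mono)
  show ?thesis
  proof (cases "d = e")
    case True
    have "real p * u < real p * v" using assms p by simp
    then have "(1 + real p * u - of_int d * real p) / n < (1 + real p * v - of_int e * real p) / n" 
      using True n by (intro divide_strict_right_mono) auto
    then have "n powi (- e) * (1 - (1 + real p * v - of_int e * real p) / n) 
      < n powi (- e) * (1 - (1 + real p * u - of_int d * real p) / n)"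
      using pos by (intro mult_strict_left_mono) auto
    then show ?thesis unfolding u v True by simp
  next
    case False
    have "(1 + real p * u - of_int d * real p) / n < real p / n" using d n 
      by (intro divide_strict_right_mono) (auto simp: algebra_simps)
    then have "1 - (1 + real p * u - of_int d * real p) / n > 1 - real p / n" by simp
    moreover have "1 - real p / n = 1 / n" by (simp add: n_def field_simps)
    ultimately have "n powi (- d) * (1 / n) < n powi (- d) * (1 - (1 + real p * u - of_int d * real p) / n)"
      using pos by (intro mult_strict_left_mono) auto
    moreover have "n powi (- d) * (1 / n) = n powi (- d - 1)" using n by (simp add: power_int_pred)
    moreover have "n powi (- e) \<le> n powi (- d - 1)" using n False de by (intro power_int_increasing) auto
    moreover have "n powi (- e) * (1 - (1 + real p * v - of_int e * real p) / n) \<le> n powi (- e) * 1"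
      using pos[of "- e"] e n by (intro mult_left_mono) (auto simp: divide_nonneg_nonneg)
    ultimately show ?thesis unfolding u v by simp
  qed
qed

lemma chart_strict_mono:
  assumes "p \<ge> 1" shows "strict_mono (chart p)"
proof (rule strict_monoI)
  fix u v :: real assume uv: "u < v"
  consider "v \<le> 0" | "0 \<le> u" | "u < 0" "0 < v" by linarith
  then show "chart p u < chart p v"
  proof cases
    case 3
    then show ?thesis using chart_strict_mono_left[OF assms, of u 0] chart_strict_mono_right[OF assms, of 0 v] by simp
  qed (use uv chart_strict_mono_left[OF assms] chart_strict_mono_right[OF assms] in auto)
qed

lemma chart_first: 
  assumes "p \<ge> 1" "0 \<le> u" "real p * u \<le> real p - 1"
  shows "chart p u = (1 + real p * u) / (real p + 1)"
  using chart_right[of p 0 u] assms by simp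

lemma chart_before: 
  assumes "p \<ge> 1" "-1 \<le> u" "u \<le> 0"
  shows "chart p u = (1 + real p * (u + 1)) / (real p + 1)\<^sup>2"
proof -
  have "chart p u = (1 + real p * (u - of_int (- 1))) * (real p + 1) powi (- 1 - 1)"
    by (rule chart_left) (use assms in auto)
  also have "(real p + 1) powi (- 1 - 1) = 1 / (real p + 1)\<^sup>2"
    by (simp add: power_int_def inverse_eq_divide power_one_over numeral_2_eq_2)
  finally show ?thesis by simp
qed

lemma chart_second: 
  assumes "p \<ge> 1" "real p - 1 \<le> real p * u" "real p * u \<le> 2 * real p - 1" 
  shows "chart p u = real p / (real p + 1) + (1 + real p * u - real p) / (real p + 1)\<^sup>2"
proof -
  have "0 \<le> u" 
  proof (rule ccontr)
    assume "\<not> 0 \<le> u"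
    then have "real p * u < 0" using assms(1) by (simp add: mult_pos_neg)
    then show False using assms by simp
  qed
  then have "chart p u = 1 - (real p + 1) powi (- 1) * (1 - (1 + real p * u - of_int 1 * real p) / (real p + 1))"
    by (intro chart_right) (use assms in auto)
  also have "\<dots> = 1 - (1 / (real p + 1)) * (1 - (1 + real p * u - real p) / (real p + 1))"
    by (simp add: power_int_minus divide_inverse)
  also have "\<dots> = real p / (real p + 1) + (1 + real p * u - real p) / (real p + 1)\<^sup>2"
  proof -
    have "1 - (1 / n) * (1 - x / n) = (n - 1) / n + x / n\<^sup>2" if "n > 0" for n x :: real
      using that by (simp add: field_simps power2_eq_square)
    from this[of "real p + 1"] show ?thesis by simp
  qed
  finally show ?thesis .
qed

lemma chart_third: 
  assumes "p \<ge> 1" "2 * real p - 1 \<le> real p * u" "real p * u \<le> 3 * real p - 1" 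
  shows "chart p u = 1 - (1 - (1 + real p * u - 2 * real p) / (real p + 1)) / (real p + 1)\<^sup>2"
proof -
  have "0 \<le> u" 
  proof (rule ccontr)
    assume "\<not> 0 \<le> u"
    then have "real p * u < 0" using assms(1) by (simp add: mult_pos_neg)
    then show False using assms by simp
  qed
  then have "chart p u = 1 - (real p + 1) powi (- 2) * (1 - (1 + real p * u - of_int 2 * real p) / (real p + 1))"
    by (intro chart_right) (use assms in auto)
  moreover have "(real p + 1) powi (- 2) = 1 / (real p + 1)\<^sup>2"
    by (simp add: power_int_def inverse_eq_divide power_one_over)
  ultimately show ?thesis by simp
qed

text \<open>Near \<open>1\<close> the chart is self-similar under the last branch of \<open>x\<^sub>0\<close>.\<close>

lemma chart_shift_right:
  assumes "p \<ge> 1" "u \<ge> 1"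
  shows "chart p (u - 1) = 1 - (real p + 1) * (1 - chart p u)"
proof -
  define n where "n = real p + 1"
  have n: "n > 1" using assms(1) by (simp add: n_def)
  have p: "real p > 0" using assms(1) by simp
  define d where "d = \<lfloor>u + 1 / real p\<rfloor>"
  have "of_int d \<le> u + 1 / real p" "u + 1 / real p < of_int d + 1" by (auto simp: d_def)
  then have d: "of_int d * real p \<le> 1 + real p * u" "1 + real p * u < (of_int d + 1) * real p"
    using p by (simp_all add: field_simps)
  have u: "chart p u = 1 - n powi (- d) * (1 - (1 + real p * u - of_int d * real p) / n)"
    unfolding n_def by (rule chart_right) (use assms d in auto)
  have v: "chart p (u - 1) = 1 - n powi (- (d - 1)) * (1 - (1 + real p * (u - 1) - of_int (d - 1) * real p) / n)"
    unfolding n_def by (rule chart_right) (use assms d in \<open>auto simp: algebra_simps\<close>)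
  have "n powi (- (d - 1)) = n * n powi (- d)" using n power_int_pred[OF n, of "- (d - 1)"] by simp
  then show ?thesis unfolding n_def[symmetric] u v by (simp add: algebra_simps)
qed

text \<open>Near \<open>0\<close> the chart is self-similar under the first branch of \<open>x\<^sub>0\<close>.\<close>

lemma chart_shift_left:
  assumes "p \<ge> 1" "real p * u \<le> real p - 1"
  shows "chart p (u - 1) = chart p u / (real p + 1)"
proof (cases "u \<le> 0")
  case True
  define n where "n = real p + 1"
  have n: "n > 1" using assms(1) by (simp add: n_def)
  define d where "d = \<lfloor>u\<rfloor>"
  have d: "of_int d \<le> u" "u < of_int d + 1" by (auto simp: d_def)
  have u: "chart p u = (1 + real p * (u - of_int d)) * n powi (d - 1)"
    unfolding n_def by (rule chart_left) (use assms True d in auto)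
  have v: "chart p (u - 1) = (1 + real p * (u - 1 - of_int (d - 1))) * n powi (d - 1 - 1)"
    unfolding n_def by (rule chart_left) (use assms True d in auto)
  have "n powi (d - 1 - 1) = n powi (d - 1) / n" by (rule power_int_pred[OF n])
  then show ?thesis unfolding n_def[symmetric] u v by simp
next
  case False
  have "u \<le> 1" using assms(2) scaled_le_iff(1)[OF assms(1), of u] by linarith
  then show ?thesis using chart_first[of p u] chart_before[of p "u - 1"] False assms
    by (simp add: power2_eq_square)
qed

lemma chart_pos: assumes "p \<ge> 1" shows "chart p u > 0"
proof (cases "u \<le> 0")
  case True
  then show ?thesis using chart_left[of p "\<lfloor>u\<rfloor>" u] assms
    by (simp, intro mult_pos_pos) (auto intro: add_pos_nonneg)
next
  case False
  have "chart p 0 = 1 / (real p + 1)" using chart_first[of p 0] assms by simp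
  moreover have "chart p 0 < chart p u" using strict_monoD[OF chart_strict_mono[OF assms], of 0 u] False by simp
  moreover have "1 / (real p + 1) > 0" by simp
  ultimately show ?thesis by linarith
qed

lemma chart_less_1: assumes "p \<ge> 1" shows "chart p u < 1"
proof (cases "u \<ge> 0")
  case True
  define n where "n = real p + 1"
  have n: "n > 1" using assms(1) by (simp add: n_def)
  have p: "real p > 0" using assms(1) by simp
  define d where "d = \<lfloor>u + 1 / real p\<rfloor>"
  have "of_int d \<le> u + 1 / real p" "u + 1 / real p < of_int d + 1" by (auto simp: d_def)
  then have d: "of_int d * real p \<le> 1 + real p * u" "1 + real p * u < (of_int d + 1) * real p"
    using p by (simp_all add: field_simps)
  have u: "chart p u = 1 - n powi (- d) * (1 - (1 + real p * u - of_int d * real p) / n)"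
    unfolding n_def by (rule chart_right) (use assms True d in auto)
  have "1 + real p * u - of_int d * real p < n" using d by (simp add: n_def algebra_simps)
  then have "(1 + real p * u - of_int d * real p) / n < 1" using n by simp
  then have "n powi (- d) * (1 - (1 + real p * u - of_int d * real p) / n) > 0"
    using n by (intro mult_pos_pos) auto
  then show ?thesis unfolding u by simp
next
  case False
  have "chart p 0 = 1 / (real p + 1)" using chart_first[of p 0] assms by simp
  moreover have "chart p u < chart p 0" using strict_monoD[OF chart_strict_mono[OF assms], of u 0] False by simp
  moreover have "1 / (real p + 1) < 1" using assms by simp
  ultimately show ?thesis by linarith
qed

section \<open>The generators in the chart\<close>

lemma thompson_x_chart_zero:
  assumes p: "p \<ge> 1"
  shows "thompson_x p 0 (chart p u) = chart p (u - 1)"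
proof -
  define n where "n = real p + 1"
  have n: "n > 1" and pn: "real p = n - 1" using p by (auto simp: n_def)
  define b where "b = (n - 1) / n"
  have x: "thompson_x p 0 = bend n 0 b" using thompson_x_bend[of 0 p] p by (simp add: b_def n_def)
  have c: "1 - (b - 0) / n = b + 1 / n\<^sup>2" unfolding b_def using n by (simp add: field_simps power2_eq_square)
  have ab: "0 \<le> b" "b \<le> 1 - (b - 0) / n" unfolding c unfolding b_def using n by auto
  note B = bend_pieces[OF n ab]
  note mono = strict_mono_less_eq[OF chart_strict_mono[OF p]]
  consider "real p * u \<le> real p - 1" | "real p - 1 \<le> real p * u" "real p * u \<le> real p" | "real p \<le> real p * u"
    by linarith
  then show ?thesis
  proof cases
    case 1
    have s: "chart p ((real p - 1) / real p) = b" 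
      using chart_first[OF p, of "(real p - 1) / real p"] p by (simp add: b_def n_def)
    have "u \<le> (real p - 1) / real p" using 1 p by (simp add: pos_le_divide_eq mult.commute)
    then have "chart p u \<le> b" using mono s by metis
    moreover have "chart p u > 0" by (rule chart_pos[OF p])
    ultimately show ?thesis unfolding x using B(2)[of "chart p u"] chart_shift_left[OF p 1] by (simp add: n_def)
  next
    case 2
    have t: "chart p u = b + (1 + real p * u - real p) / n\<^sup>2"
    proof -
      have "real p \<ge> 1" using p by simp
      then have "real p * u \<le> 2 * real p - 1" using 2 by linarith
      then show ?thesis using chart_second[OF p 2(1)] by (simp add: b_def n_def)
    qed
    have "(1 + real p * u - real p) / n\<^sup>2 \<le> 1 / n\<^sup>2" using 2 by (intro divide_right_mono) auto
    then have "b \<le> chart p u" "chart p u \<le> 1 - (b - 0) / n" unfolding t c using 2 by auto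
    then have "bend n 0 b (chart p u) = chart p u - b * (1 - 1 / n)" using B(3)[of "chart p u"] by simp
    also have "\<dots> = (1 + real p * (u - 1 + 1)) / n\<^sup>2"
      unfolding t b_def pn using n by (simp add: field_simps power2_eq_square)
    also have "\<dots> = chart p (u - 1)"
    proof -
      have "u \<le> 1" using 2 scaled_le_iff(1)[OF p] by blast
      moreover have "0 \<le> u" using 2 p scaled_le_iff(3)[OF p, of u] by linarith
      ultimately show ?thesis using chart_before[OF p, of "u - 1"] by (simp add: n_def)
    qed
    finally show ?thesis unfolding x .
  next
    case 3
    have u: "1 \<le> u" using 3 p scaled_le_iff(2)[OF p, of u] by linarith
    have "chart p 1 = b + 1 / n\<^sup>2" using chart_second[OF p, of 1] p by (simp add: b_def n_def)
    then have "1 - (b - 0) / n \<le> chart p u" unfolding c using mono[of 1 u] u by simp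
    then show ?thesis unfolding x using B(4)[of "chart p u"] chart_less_1[OF p, of u] chart_shift_right[OF p u]
      by (simp add: n_def)
  qed
qed

lemma thompson_x_chart_low:
  assumes i: "1 \<le> i" "i < p"
  shows "thompson_x p i (chart p u) = chart p (glide p i u)"
proof -
  have p: "p \<ge> 1" using i by simp
  define n where "n = real p + 1"
  have n: "n > 1" and pn: "real p = n - 1" using p by (auto simp: n_def)
  have ip: "real i + 1 \<le> real p" "1 \<le> real i" using i by auto
  define a where "a = real i / n"
  define b where "b = (n - 1) / n"
  have x: "thompson_x p i = bend n a b" using thompson_x_bend[of i p] i by (simp add: a_def b_def n_def)
  have c: "1 - (b - a) / n = b + (real i + 1) / n\<^sup>2" 
    unfolding a_def b_def using n by (simp add: field_simps power2_eq_square)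
  have ab: "a \<le> b" unfolding a_def b_def using n ip by (intro divide_right_mono) (auto simp: n_def)
  have bc: "b \<le> 1 - (b - a) / n" unfolding c using n by auto
  note B = bend_pieces[OF n ab bc]
  note mono = strict_mono_less_eq[OF chart_strict_mono[OF p]]
  have new: "chart p ((u + real i - 1) / n) = (1 + real p * u + real p * real i) / n\<^sup>2"
    if "real i - 1 \<le> real p * u" "real p * u \<le> real i + real p"
  proof -
    have e: "real p * ((u + real i - 1) / n) = (real p * u + real p * (real i - 1)) / n"
      by (simp add: algebra_simps)
    have "0 \<le> real p * u" using that ip by simp
    then have "0 \<le> u" using p by (simp add: zero_le_mult_iff)
    then have "0 \<le> (u + real i - 1) / n" using ip n by simp
    moreover have "real p * ((u + real i - 1) / n) \<le> real p - 1"
    proof -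
      have "(real p * u + real p * (real i - 1)) / n \<le> (real i + real p + real p * (real i - 1)) / n"
        using that n by (intro divide_right_mono) auto
      also have "\<dots> = real i" unfolding pn using n by (simp add: field_simps)
      finally show ?thesis using ip e by linarith
    qed
    ultimately have "chart p ((u + real i - 1) / n) = (1 + real p * ((u + real i - 1) / n)) / n"
      using chart_first[OF p] by (simp add: n_def)
    also have "\<dots> = (1 + real p * u + real p * real i) / n\<^sup>2"
      unfolding e unfolding pn using n by (simp add: field_simps power2_eq_square)
    finally show ?thesis .
  qed
  consider "real p * u \<le> real i - 1" | "real i - 1 < real p * u" "real p * u \<le> real p - 1" 
    | "real p - 1 < real p * u" "real p * u \<le> real i + real p" | "real i + real p < real p * u"
    by linarith
  then show ?thesis
  proof cases
    case 1
    have s: "chart p ((real i - 1) / real p) = a" 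
      using chart_first[OF p, of "(real i - 1) / real p"] p ip by (simp add: a_def n_def)
    have "u \<le> (real i - 1) / real p" using 1 p by (simp add: pos_le_divide_eq mult.commute)
    then have "chart p u \<le> a" using mono s by metis
    then show ?thesis unfolding x using B(1)[of "chart p u"] 1 i by (simp add: glide_def)
  next
    case 2
    have "0 \<le> real p * u" using 2 ip by simp
    then have u0: "0 \<le> u" using p by (simp add: zero_le_mult_iff)
    have t: "chart p u = (1 + real p * u) / n" using chart_first[OF p u0] 2 by (simp add: n_def)
    have "a \<le> chart p u" "chart p u \<le> b" unfolding t a_def b_def pn[symmetric] using 2 n by (auto intro!: divide_right_mono)
    then have "bend n a b (chart p u) = a + (chart p u - a) / n" by (rule B(2))
    also have "\<dots> = (1 + real p * u + real p * real i) / n\<^sup>2"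
      unfolding t a_def pn using n by (simp add: field_simps power2_eq_square)
    also have "\<dots> = chart p ((u + real i - 1) / n)" by (rule new[symmetric]) (use 2 ip in linarith)+
    finally show ?thesis unfolding x using 2 ip i by (simp add: glide_def n_def)
  next
    case 3
    have t: "chart p u = b + (1 + real p * u - real p) / n\<^sup>2"
      using chart_second[OF p, of u] 3 ip by (simp add: b_def n_def)
    have "(1 + real p * u - real p) / n\<^sup>2 \<le> (real i + 1) / n\<^sup>2" using 3 by (intro divide_right_mono) auto
    then have "b \<le> chart p u" "chart p u \<le> 1 - (b - a) / n" unfolding t c using 3 by auto
    then have "bend n a b (chart p u) = chart p u - (b - a) * (1 - 1 / n)" by (rule B(3))
    also have "\<dots> = (1 + real p * u + real p * real i) / n\<^sup>2"
      unfolding t a_def b_def pn using n by (simp add: field_simps power2_eq_square)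
    also have "\<dots> = chart p ((u + real i - 1) / n)" by (rule new[symmetric]) (use 3 ip in linarith)+
    finally show ?thesis unfolding x using 3 ip i by (simp add: glide_def n_def)
  next
    case 4
    have u: "1 \<le> u" using 4 p scaled_le_iff(2)[OF p, of u] by linarith
    have "chart p ((real i + real p) / real p) = b + (real i + 1) / n\<^sup>2" 
      using chart_second[OF p, of "(real i + real p) / real p"] p ip by (simp add: b_def n_def add.commute)
    moreover have "(real i + real p) / real p \<le> u" using 4 p by (simp add: pos_divide_le_eq mult.commute)
    ultimately have "1 - (b - a) / n \<le> chart p u" unfolding c using mono by metis
    then show ?thesis unfolding x using B(4)[of "chart p u"] chart_less_1[OF p, of u] chart_shift_right[OF p u] 4 i
      by (simp add: n_def glide_def)
  qed
qed

lemma thompson_x_chart_last: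
  assumes p: "p \<ge> 1"
  shows "thompson_x p p (chart p u) = chart p (glide p p u)"
proof -
  define n where "n = real p + 1"
  have n: "n > 1" and pn: "real p = n - 1" using p by (auto simp: n_def)
  define a where "a = (n - 1) / n"
  define b where "b = a + (n - 1) / n\<^sup>2"
  have x: "thompson_x p p = bend n a b" using thompson_x_last_bend[OF p] by (simp add: a_def b_def n_def)
  have c: "1 - (b - a) / n = b + 1 / n ^ 3" 
    unfolding b_def a_def using n by (simp add: field_simps power2_eq_square power3_eq_cube)
  have ab: "a \<le> b" unfolding b_def using n by simp
  have bc: "b \<le> 1 - (b - a) / n" unfolding c using n by auto
  note B = bend_pieces[OF n ab bc]
  note mono = strict_mono_less_eq[OF chart_strict_mono[OF p]]
  have new: "chart p ((u + real p - 1) / n) = a + (1 + real p * u - real p) / n ^ 3"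
    if "real p - 1 \<le> real p * u" "real p * u \<le> 2 * real p"
  proof -
    have e: "real p * ((u + real p - 1) / n) = (real p * u + real p * (real p - 1)) / n"
      by (simp add: algebra_simps)
    have "(real p - 1 + real p * (real p - 1)) / n \<le> (real p * u + real p * (real p - 1)) / n"
      using that n by (intro divide_right_mono) auto
    moreover have "(real p - 1 + real p * (real p - 1)) / n = real p - 1" unfolding pn using n by (simp add: field_simps)
    moreover have "(real p * u + real p * (real p - 1)) / n \<le> (2 * real p + real p * (real p - 1)) / n"
      using that n by (intro divide_right_mono) auto
    moreover have "(2 * real p + real p * (real p - 1)) / n = real p" unfolding pn using n by (simp add: field_simps)
    ultimately have "chart p ((u + real p - 1) / n) = a + (1 + real p * ((u + real p - 1) / n) - real p) / n\<^sup>2"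
      using chart_second[OF p, of "(u + real p - 1) / n"] e p by (simp add: n_def a_def)
    also have "\<dots> = a + (1 + real p * u - real p) / n ^ 3"
      unfolding e unfolding pn using n by (simp add: field_simps power2_eq_square power3_eq_cube)
    finally show ?thesis .
  qed
  consider "real p * u \<le> real p - 1" | "real p - 1 < real p * u" "real p * u \<le> 2 * real p - 1" 
    | "2 * real p - 1 < real p * u" "real p * u \<le> 2 * real p" | "2 * real p < real p * u"
    by linarith
  then show ?thesis
  proof cases
    case 1
    have s: "chart p ((real p - 1) / real p) = a" 
      using chart_first[OF p, of "(real p - 1) / real p"] p by (simp add: a_def n_def)
    have "u \<le> (real p - 1) / real p" using 1 p by (simp add: pos_le_divide_eq mult.commute)
    then have "chart p u \<le> a" using mono s by metis
    then show ?thesis unfolding x using B(1)[of "chart p u"] 1 p by (simp add: glide_def)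
  next
    case 2
    have t: "chart p u = a + (1 + real p * u - real p) / n\<^sup>2" using chart_second[OF p, of u] 2 by (simp add: n_def a_def)
    have "(1 + real p * u - real p) / n\<^sup>2 \<le> (n - 1) / n\<^sup>2" using 2 pn by (intro divide_right_mono) auto
    then have "a \<le> chart p u" "chart p u \<le> b" unfolding t b_def using 2 n by auto
    then have "bend n a b (chart p u) = a + (chart p u - a) / n" by (rule B(2))
    also have "\<dots> = a + (1 + real p * u - real p) / n ^ 3"
      unfolding t using n by (simp add: power2_eq_square power3_eq_cube)
    also have "\<dots> = chart p ((u + real p - 1) / n)" by (rule new[symmetric]) (use 2 in linarith)+
    moreover have "u \<le> 2" using 2 scaled_le_iff(5)[OF p, of u] by linarith
    ultimately show ?thesis unfolding x using 2 p by (simp add: glide_def n_def)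
  next
    case 3
    have t: "chart p u = 1 - (1 - (1 + real p * u - 2 * real p) / n) / n\<^sup>2"
      using chart_third[OF p, of u] 3 p by (simp add: n_def)
    have t': "chart p u = b + (1 + real p * u - 2 * real p) / n ^ 3"
      unfolding t b_def a_def using n by (simp add: field_simps power2_eq_square power3_eq_cube)
    have "(1 + real p * u - 2 * real p) / n ^ 3 \<le> 1 / n ^ 3" using 3 n by (intro divide_right_mono) auto
    moreover have "0 \<le> (1 + real p * u - 2 * real p) / n ^ 3" using 3 n by auto
    ultimately have "b \<le> chart p u" "chart p u \<le> 1 - (b - a) / n" unfolding t' c by auto
    then have "bend n a b (chart p u) = chart p u - (b - a) * (1 - 1 / n)" by (rule B(3))
    also have "\<dots> = a + (1 + real p * u - real p) / n ^ 3"
      unfolding t' b_def pn using n by (simp add: field_simps power2_eq_square power3_eq_cube)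
    also have "\<dots> = chart p ((u + real p - 1) / n)" by (rule new[symmetric]) (use 3 p in linarith)+
    finally show ?thesis unfolding x using 3 p by (simp add: glide_def n_def)
  next
    case 4
    have np: "\<not> real p * u \<le> real p - 1" using 4 p by linarith
    have u: "1 \<le> u" using 4 p scaled_le_iff(2)[OF p, of u] by linarith
    have u2: "2 \<le> u" using 4 scaled_le_iff(4)[OF p, of u] by linarith
    have "chart p 2 = 1 - (1 - 1 / n) / n\<^sup>2" 
      using chart_third[OF p, of 2] p by (simp add: n_def)
    also have "\<dots> = b + 1 / n ^ 3" 
      unfolding b_def a_def using n by (simp add: field_simps power2_eq_square power3_eq_cube)
    finally have "1 - (b - a) / n \<le> chart p u" unfolding c using mono[of 2 u] u2 by simp
    then show ?thesis unfolding x using B(4)[of "chart p u"] chart_less_1[OF p, of u] chart_shift_right[OF p u] 4 p np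
      by (simp add: n_def glide_def)
  qed
qed

lemma thompson_x_chart:
  assumes "p \<ge> 1" "i \<le> p"
  shows "thompson_x p i (chart p u) = chart p (glide p i u)"
proof -
  consider "i = 0" | "1 \<le> i" "i < p" | "i = p" using assms(2) by linarith
  then show ?thesis
    using thompson_x_chart_zero[OF assms(1)] thompson_x_chart_low thompson_x_chart_last[OF assms(1)]
    by cases (auto simp: glide_def[of p 0])
qed

section \<open>Closure of the group under multiplication by letters\<close>

lemma strict_mono_glue:
  fixes f g :: "real \<Rightarrow> real"
  assumes "strict_mono f" "strict_mono g" "f c = g c"
  shows "strict_mono (\<lambda>t. if t \<le> c then f t else g t)"
proof (rule strict_monoI)
  fix x y :: real assume xy: "x < y"
  consider "y \<le> c" | "x \<le> c" "c < y" | "c < x" by linarith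
  then show "(if x \<le> c then f x else g x) < (if y \<le> c then f y else g y)"
  proof cases
    case 2
    have "f x \<le> f c" using assms(1) 2 by (simp add: strict_mono_less_eq)
    moreover have "g c < g y" using assms(2) 2 by (simp add: strict_monoD)
    ultimately show ?thesis using 2 assms(3) by simp
  qed (use xy assms in \<open>auto simp: strict_monoD\<close>)
qed

lemma continuous_glue:
  fixes f g :: "real \<Rightarrow> real"
  assumes "continuous_on UNIV f" "continuous_on UNIV g" "f c = g c"
  shows "continuous_on UNIV (\<lambda>t. if t \<le> c then f t else g t)"
proof -
  have U: "(UNIV :: real set) = {..c} \<union> {c..}" by auto
  show ?thesis unfolding U
    by (rule continuous_on_If) (use assms in \<open>auto intro: continuous_on_subset\<close>)
qed

lemma bend_glue:
  assumes n: "n > 1" and ab: "a \<le> b" and bc: "b \<le> 1 - (b - a) / n"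
  shows "strict_mono (bend n a b)" "continuous_on UNIV (bend n a b)"
proof -
  let ?c = "1 - (b - a) / n"
  define g4 where "g4 = (\<lambda>t. if t \<le> 1 then 1 - n * (1 - t) else t)"
  define g3 where "g3 = (\<lambda>t. if t \<le> ?c then t - (b - a) * (1 - 1 / n) else g4 t)"
  define g2 where "g2 = (\<lambda>t. if t \<le> b then a + (t - a) / n else g3 t)"
  have n0: "n \<noteq> 0" using n by simp
  have "(b - a) / n \<ge> 0" using n ab by simp
  then have c1: "?c \<le> 1" by simp
  have e1: "a + (b - a) / n = b - (b - a) * (1 - 1 / n)" by (simp add: right_diff_distrib)
  have e2: "?c - (b - a) * (1 - 1 / n) = 1 - n * (1 - ?c)" using n by (simp add: field_simps)
  have g: "bend n a b = (\<lambda>t. if t \<le> a then t else g2 t)"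
    by (auto simp: bend_def g2_def g3_def g4_def fun_eq_iff)
  have v3: "?c - (b - a) * (1 - 1 / n) = g4 ?c" using e2 c1 by (simp add: g4_def)
  have v2: "a + (b - a) / n = g3 b" using e1 bc by (simp add: g3_def)
  have v1: "a = g2 a" using ab by (simp add: g2_def)
  have "strict_mono g4" unfolding g4_def
    by (rule strict_mono_glue) (use n in \<open>auto simp: strict_mono_def\<close>)
  then have "strict_mono g3" unfolding g3_def
    by (intro strict_mono_glue v3) (auto simp: strict_mono_def)
  then have "strict_mono g2" unfolding g2_def
    by (intro strict_mono_glue v2) (use n in \<open>auto simp: strict_mono_def divide_strict_right_mono\<close>)
  then show "strict_mono (bend n a b)" unfolding g
    by (intro strict_mono_glue v1) (auto simp: strict_mono_def)
  have "continuous_on UNIV g4" unfolding g4_def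
    by (rule continuous_glue) (auto intro!: continuous_intros)
  then have "continuous_on UNIV g3" unfolding g3_def
    by (intro continuous_glue v3) (auto intro!: continuous_intros)
  then have "continuous_on UNIV g2" unfolding g2_def
    by (intro continuous_glue v2) (use n in \<open>auto intro!: continuous_intros\<close>)
  then show "continuous_on UNIV (bend n a b)" unfolding g
    by (intro continuous_glue v1) (auto intro!: continuous_intros)
qed

text \<open>In addition to \<open>thompson_PL\<close> the constants are n-adic. For elements of the group this is automatic,
but it has to be proved by gluing; the generators have it by inspection, and it
makes their inverses preserve the n-adic numbers, which closure under composition needs.\<close>

definition nadic_PL :: "nat \<Rightarrow> (real \<Rightarrow> real) \<Rightarrow> bool" where
  "nadic_PL n f \<longleftrightarrow>
     (\<exists>B. finite B \<and> B \<subseteq> nadic n \<and>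
        (\<forall>a b. 0 \<le> a \<and> a < b \<and> b \<le> 1 \<and> {a<..<b} \<inter> B = {} \<longrightarrow>
           (\<exists>(j::int) c. c \<in> nadic n \<and> (\<forall>t\<in>{a..b}. f t = real n powi j * t + c))))"

lemma nadicI: "real_of_int a / real n ^ k \<in> nadic n"
  by (auto simp: nadic_def)

lemma nadic_add: assumes "n > 1" "x \<in> nadic n" "y \<in> nadic n" shows "x + y \<in> nadic n"
proof -
  obtain a k where x: "x = real_of_int a / real n ^ k" using assms by (auto simp: nadic_def)
  obtain b l where y: "y = real_of_int b / real n ^ l" using assms by (auto simp: nadic_def)
  have "x + y = real_of_int (a * int n ^ l + b * int n ^ k) / real n ^ (k + l)"
    unfolding x y using assms(1) by (simp add: add_frac_eq power_add)
  then show ?thesis using nadicI by metis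
qed

lemma nadic_minus: assumes "x \<in> nadic n" shows "- x \<in> nadic n"
proof -
  obtain a k where x: "x = real_of_int a / real n ^ k" using assms by (auto simp: nadic_def)
  have "- x = real_of_int (- a) / real n ^ k" unfolding x by simp
  then show ?thesis using nadicI by metis
qed

lemma nadic_scale: assumes "n > 1" "x \<in> nadic n" shows "real n powi j * x \<in> nadic n"
proof -
  obtain a k where x: "x = real_of_int a / real n ^ k" using assms by (auto simp: nadic_def)
  show ?thesis
  proof (cases "j \<ge> 0")
    case True
    then have "real n powi j * x = real_of_int (a * int n ^ nat j) / real n ^ k"
      by (simp add: x power_int_def)
    then show ?thesis using nadicI by metis
  next
    case False
    then have "real n powi j = 1 / real n ^ nat (- j)"
      by (simp add: power_int_def divide_inverse power_inverse)
    then have "real n powi j * x = real_of_int a / real n ^ (k + nat (- j))"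
      by (simp add: x power_add mult.commute)
    then show ?thesis using nadicI by metis
  qed
qed

lemma affine_germ:
  fixes t :: real
  assumes "finite B" "0 \<le> t" "t \<le> 1"
  obtains a b where "0 \<le> a" "a < b" "b \<le> 1" "{a<..<b} \<inter> B = {}" "t \<in> {a..b}"
proof -
  obtain d where d: "d > 0" "\<And>x. x \<in> B \<Longrightarrow> x \<noteq> t \<Longrightarrow> d \<le> dist t x"
    using finite_set_avoid[OF assms(1), of t] by blast
  show thesis
  proof (cases "t < 1")
    case True
    have "{t<..<min 1 (t + d)} \<inter> B = {}"
    proof (safe)
      fix x assume "x \<in> {t<..<min 1 (t + d)}" "x \<in> B"
      then show "x \<in> {}" using d(2)[of x] by (auto simp: dist_real_def)
    qed
    then show ?thesis using that[of t "min 1 (t + d)"] True assms d by auto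
  next
    case False
    then have t: "t = 1" using assms by simp
    have "{max 0 (1 - d)<..<1} \<inter> B = {}"
    proof (safe)
      fix x assume "x \<in> {max 0 (1 - d)<..<1}" "x \<in> B"
      then show "x \<in> {}" using d(2)[of x] t by (auto simp: dist_real_def)
    qed
    then show ?thesis using that[of "max 0 (1 - d)" 1] t d by auto
  qed
qed

lemma nadic_PL_nadic_iff:
  assumes n: "n > 1" and f: "nadic_PL n f" and t: "0 \<le> t" "t \<le> 1"
  shows "f t \<in> nadic n \<longleftrightarrow> t \<in> nadic n"
proof -
  obtain B where B: "finite B" "\<forall>a b. 0 \<le> a \<and> a < b \<and> b \<le> 1 \<and> {a<..<b} \<inter> B = {} \<longrightarrow>
           (\<exists>(j::int) c. c \<in> nadic n \<and> (\<forall>t\<in>{a..b}. f t = real n powi j * t + c))"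
    using f unfolding nadic_PL_def by (elim exE conjE)
  obtain a b where ab: "0 \<le> a" "a < b" "b \<le> 1" "{a<..<b} \<inter> B = {}" "t \<in> {a..b}"
    using affine_germ[OF B(1) t] by metis
  have "\<exists>(j::int) c. c \<in> nadic n \<and> (\<forall>t\<in>{a..b}. f t = real n powi j * t + c)"
    by (rule B(2)[rule_format]) (use ab in simp)
  then obtain j c where c: "c \<in> nadic n" and "\<forall>t\<in>{a..b}. f t = real n powi j * t + c"
    by (elim exE conjE)
  then have f: "f t = real n powi j * t + c" using ab(5) by blast
  have t: "t = real n powi (- j) * (f t + - c)" unfolding f using n by (simp add: power_int_minus)
  show ?thesis
  proof
    assume "f t \<in> nadic n"
    then have "real n powi (- j) * (f t + - c) \<in> nadic n"
      by (intro nadic_scale[OF n] nadic_add[OF n] nadic_minus[OF c])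
    then show "t \<in> nadic n" using t by simp
  next
    assume "t \<in> nadic n"
    then show "f t \<in> nadic n" unfolding f by (intro nadic_scale[OF n] nadic_add[OF n] c)
  qed
qed

lemma nadic_PL_thompson_PL: "nadic_PL n f \<Longrightarrow> thompson_PL n f"
  unfolding nadic_PL_def thompson_PL_def by (elim exE conjE, intro exI conjI, assumption, assumption) blast

lemma thompson_set_mono:
  assumes "f \<in> thompson_set n"
  shows "strict_mono_on {0..1} f" "continuous_on {0..1} f" "f ` {0..1} = {0..1}" "inj_on f {0..1}"
    "t \<notin> {0..1} \<Longrightarrow> f t = t" "thompson_PL n f"
  using assms by (auto simp: thompson_set_def homeomorphism_def strict_mono_on_imp_inj_on)

lemma thompson_setI:
  assumes "strict_mono f" "continuous_on UNIV f" "f 0 = 0" "f 1 = 1" "\<And>t. t \<notin> {0..1} \<Longrightarrow> f t = t"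
    "thompson_PL n f"
  shows "f \<in> thompson_set n"
proof -
  have c: "continuous_on {0..1} f" using assms(2) continuous_on_subset by blast
  have "f ` {0..1} = {0..1}"
  proof
    show "f ` {0..1} \<subseteq> {0..1}"
      using strict_mono_less_eq[OF assms(1), of 0] strict_mono_less_eq[OF assms(1), of _ 1] assms(3,4) by auto
    show "{0..1} \<subseteq> f ` {0..1}"
    proof
      fix y :: real assume "y \<in> {0..1}"
      then show "y \<in> f ` {0..1}" using IVT'[of f 0 y 1] c assms(3,4) by force
    qed
  qed
  moreover have "inj_on f {0..1}" using assms(1) by (meson inj_on_subset strict_mono_imp_inj_on subset_UNIV)
  ultimately have "\<exists>g. homeomorphism {0..1} {0..1} f g"
    using homeomorphism_compact[OF compact_Icc c] by metis
  moreover have "strict_mono_on {0..1} f" using assms(1) by (simp add: strict_mono_on_def strict_mono_def)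
  ultimately show ?thesis using assms(5,6) by (simp add: thompson_set_def)
qed

lemma thompson_set_ends:
  assumes "f \<in> thompson_set n" shows "f 0 = 0" "f 1 = 1"
proof -
  note f = thompson_set_mono[OF assms]
  have r: "0 \<le> f t \<and> f t \<le> 1" if "0 \<le> t" "t \<le> 1" for t
    using f(3) that by (metis atLeastAtMost_iff imageI)
  obtain t where t: "t \<in> {0..1}" "f t = 0" using f(3) by (metis atLeastAtMost_iff imageE order_refl zero_le_one)
  then have "f 0 \<le> 0" using strict_mono_onD[OF f(1), of 0 t] by (cases "t = 0") auto
  then show "f 0 = 0" using r[of 0] by simp
  obtain t where t: "t \<in> {0..1}" "f t = 1" using f(3) by (metis atLeastAtMost_iff imageE order_refl zero_le_one)
  then have "f 1 \<ge> 1" using strict_mono_onD[OF f(1), of t 1] by (cases "t = 1") auto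
  then show "f 1 = 1" using r[of 1] by simp
qed

lemma thompson_set_inj:
  assumes "f \<in> thompson_set n" shows "inj f"
proof (rule injI)
  fix x y assume xy: "f x = f y"
  note f = thompson_set_mono[OF assms]
  have i: "f t \<in> {0..1} \<longleftrightarrow> t \<in> {0..1}" for t
    using f(3,5) by (metis imageI)
  show "x = y"
  proof (cases "x \<in> {0..1}")
    case True
    then have "y \<in> {0..1}" using i xy by metis
    then show ?thesis using True xy f(4) by (meson inj_onD)
  next
    case False
    then have "y \<notin> {0..1}" using i xy by metis
    then show ?thesis using False f(5) xy by metis
  qed
qed

text \<open>The breakpoints of the composition are those of \<open>s\<close> and the preimages under \<open>s\<close> of those of \<open>f\<close>.\<close>

lemma thompson_set_comp:
  assumes n: "n > 1" and f: "f \<in> thompson_set n" and s: "s \<in> thompson_set n" and ps: "nadic_PL n s"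
  shows "f \<circ> s \<in> thompson_set n"
proof -
  note F = thompson_set_mono[OF f] note S = thompson_set_mono[OF s]
  have sr: "s t \<in> {0..1}" if "t \<in> {0..1}" for t using S(3) that by blast
  have ends: "s 0 = 0" "s 1 = 1" using thompson_set_ends[OF s] by auto
  obtain g h where "homeomorphism {0..1} {0..1} f g" "homeomorphism {0..1} {0..1} s h"
    using f s by (auto simp: thompson_set_def)
  then have "homeomorphism {0..1} {0..1} (f \<circ> s) (h \<circ> g)" using homeomorphism_compose by blast
  moreover have "strict_mono_on {0..1} (f \<circ> s)"
    using F(1) S(1) sr by (simp add: strict_mono_on_def)
  moreover have "\<forall>t. t \<notin> {0..1} \<longrightarrow> (f \<circ> s) t = t" using F(5) S(5) by simp
  moreover have "thompson_PL n (f \<circ> s)"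
  proof -
    obtain A where A: "finite A" "A \<subseteq> nadic n" "\<forall>a b. 0 \<le> a \<and> a < b \<and> b \<le> 1 \<and> {a<..<b} \<inter> A = {} \<longrightarrow>
           (\<exists>(j::int) c. \<forall>t\<in>{a..b}. f t = real n powi j * t + c)"
      using F(6) unfolding thompson_PL_def by (elim exE conjE)
    obtain B where B: "finite B" "B \<subseteq> nadic n" "\<forall>a b. 0 \<le> a \<and> a < b \<and> b \<le> 1 \<and> {a<..<b} \<inter> B = {} \<longrightarrow>
           (\<exists>(j::int) c. \<forall>t\<in>{a..b}. s t = real n powi j * t + c)"
      using S(6) unfolding thompson_PL_def by (elim exE conjE)
    define D where "D = B \<union> {t \<in> {0..1}. s t \<in> A}"
    have "finite {t \<in> {0..1}. s t \<in> A}"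
    proof -
      have "finite (s -` A \<inter> {0..1})" by (rule finite_vimage_IntI[OF A(1) S(4)])
      then show ?thesis by (rule rev_finite_subset) auto
    qed
    then have "finite D" using B(1) by (simp add: D_def)
    moreover have "D \<subseteq> nadic n"
    proof
      fix t assume "t \<in> D"
      then consider "t \<in> B" | "0 \<le> t" "t \<le> 1" "s t \<in> A" by (auto simp: D_def)
      then show "t \<in> nadic n"
        using A(2) B(2) nadic_PL_nadic_iff[OF n ps, of t] by cases auto
    qed
    moreover have "\<exists>(j::int) c. \<forall>t\<in>{a..b}. (f \<circ> s) t = real n powi j * t + c"
      if ab: "0 \<le> a" "a < b" "b \<le> 1" "{a<..<b} \<inter> D = {}" for a b
    proof -
      have "{a<..<b} \<inter> B = {}" using ab(4) by (auto simp: D_def)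
      then obtain j c where s: "\<forall>t\<in>{a..b}. s t = real n powi j * t + c" using B(3) ab by metis
      have sa: "0 \<le> s a" "s b \<le> 1" using sr[of a] sr[of b] ab by auto
      have sab: "s a < s b" using strict_mono_onD[OF S(1), of a b] ab by auto
      have pos: "real n powi j > 0" using n by simp
      have "{s a<..<s b} \<inter> A = {}"
      proof (rule ccontr)
        assume "{s a<..<s b} \<inter> A \<noteq> {}"
        then obtain y where y: "s a < y" "y < s b" "y \<in> A" by auto
        define t where "t = (y - c) / real n powi j"
        have yt: "y = real n powi j * t + c" using pos n by (simp add: t_def)
        have "real n powi j * a + c < real n powi j * t + c" "real n powi j * t + c < real n powi j * b + c"
          using y(1,2) s ab(2) unfolding yt by auto
        then have t: "a < t" "t < b" using pos by auto
        then have "s t = y" using s yt by simp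
        then have "t \<in> D" using t ab y(3) by (simp add: D_def)
        then show False using ab(4) t by auto
      qed
      then obtain i d where f: "\<forall>t\<in>{s a..s b}. f t = real n powi i * t + d" using A(3) sa sab by metis
      have "(f \<circ> s) t = real n powi (i + j) * t + (real n powi i * c + d)" if t: "t \<in> {a..b}" for t
      proof -
        have st: "s t = real n powi j * t + c" "s a = real n powi j * a + c" "s b = real n powi j * b + c"
          using s t ab(2) by auto
        have "s t \<in> {s a..s b}" using t pos unfolding st by simp
        then have "(f \<circ> s) t = real n powi i * s t + d" using f by simp
        then show ?thesis using st(1) n by (simp add: power_int_add algebra_simps)
      qed
      then show ?thesis by blast
    qed
    ultimately show ?thesis unfolding thompson_PL_def by (intro exI[of _ D]) blast
  qed
  ultimately show ?thesis unfolding thompson_set_def by blast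
qed

lemma thompson_set_inverse:
  assumes n: "n > 1" and s: "s \<in> thompson_set n" and ps: "nadic_PL n s"
  obtains r where "r \<in> thompson_set n" "nadic_PL n r" "s \<circ> r = id" "r \<circ> s = id"
proof -
  note S = thompson_set_mono[OF s]
  have ends: "s 0 = 0" "s 1 = 1" using thompson_set_ends[OF s] by auto
  obtain g where g: "homeomorphism {0..1} {0..1} s g" using s by (auto simp: thompson_set_def)
  then have g': "homeomorphism {0..1} {0..1} g s" by (rule homeomorphism_symD)
  define r where "r t = (if t \<in> {0..1} then g t else t)" for t
  have rs: "r (s t) = t" for t
  proof (cases "t \<in> {0..1}")
    case True
    then show ?thesis using g by (metis homeomorphism_apply1 homeomorphism_image1 imageI r_def)
  next
    case False
    then show ?thesis using S(5)[OF False] by (simp only: r_def if_False)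
  qed
  have sr: "s (r t) = t" for t
  proof (cases "t \<in> {0..1}")
    case True then show ?thesis using g by (metis homeomorphism_apply2 r_def)
  next
    case False
    then show ?thesis using S(5)[OF False] by (simp only: r_def if_False)
  qed
  have rr: "r t \<in> {0..1}" if "t \<in> {0..1}" for t
    using g' that by (metis homeomorphism_image1 imageI r_def)
  have hr: "homeomorphism {0..1} {0..1} r s"
    by (rule homeomorphism_cong[OF g']) (auto simp: r_def)
  have mono_s: "s x < s y \<longleftrightarrow> x < y" if "x \<in> {0..1}" "y \<in> {0..1}" for x y
    using strict_mono_on_less[OF S(1)] that by auto
  have mono_r: "r x < r y" if "x \<in> {0..1}" "y \<in> {0..1}" "x < y" for x y
    using mono_s[of "r x" "r y"] rr sr that by auto
  have PL: "nadic_PL n r"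
  proof -
    obtain B where B: "finite B" "B \<subseteq> nadic n" "\<forall>a b. 0 \<le> a \<and> a < b \<and> b \<le> 1 \<and> {a<..<b} \<inter> B = {} \<longrightarrow>
           (\<exists>(j::int) c. c \<in> nadic n \<and> (\<forall>t\<in>{a..b}. s t = real n powi j * t + c))"
      using ps unfolding nadic_PL_def by (elim exE conjE)
    define D where "D = s ` (B \<inter> {0..1})"
    have "finite D" using B(1) by (simp add: D_def)
    moreover have "D \<subseteq> nadic n" using B(2) nadic_PL_nadic_iff[OF n ps] by (auto simp: D_def)
    moreover have "\<exists>(j::int) c. c \<in> nadic n \<and> (\<forall>t\<in>{a..b}. r t = real n powi j * t + c)"
      if ab: "0 \<le> a" "a < b" "b \<le> 1" "{a<..<b} \<inter> D = {}" for a b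
    proof -
      have I: "r a \<in> {0..1}" "r b \<in> {0..1}" using rr ab by auto
      have rab: "r a < r b" using mono_r ab by auto
      have "{r a<..<r b} \<inter> B = {}"
      proof (rule ccontr)
        assume "{r a<..<r b} \<inter> B \<noteq> {}"
        then obtain t where t: "r a < t" "t < r b" "t \<in> B" by auto
        then have t01: "t \<in> {0..1}" using I by auto
        have "s (r a) < s t" "s t < s (r b)" using mono_s t t01 I by auto
        moreover have "s t \<in> D" using t(3) t01 by (simp add: D_def)
        ultimately show False using ab(4) sr by auto
      qed
      then have "\<exists>(j::int) c. c \<in> nadic n \<and> (\<forall>t\<in>{r a..r b}. s t = real n powi j * t + c)"
        using I rab by (intro B(3)[rule_format]) auto
      then obtain j c where c: "c \<in> nadic n" and sc: "\<forall>t\<in>{r a..r b}. s t = real n powi j * t + c" by (elim exE conjE)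
      have "r t = real n powi (- j) * t + real n powi (- j) * (- c)" if t: "t \<in> {a..b}" for t
      proof -
        have "r a \<le> r t" using mono_r[of a t] t ab by (cases "t = a") auto
        moreover have "r t \<le> r b" using mono_r[of t b] t ab by (cases "t = b") auto
        ultimately have "s (r t) = real n powi j * r t + c" using sc by simp
        then have "t - c = real n powi j * r t" using sr by simp
        then have "real n powi (- j) * (t - c) = r t" using n by (simp add: power_int_minus)
        then show ?thesis by (simp add: right_diff_distrib)
      qed
      moreover have "real n powi (- j) * (- c) \<in> nadic n" by (intro nadic_scale[OF n] nadic_minus c)
      ultimately show ?thesis by blast
    qed
    ultimately show ?thesis unfolding nadic_PL_def by (intro exI[of _ D]) blast
  qed
  have "r \<in> thompson_set n"
    unfolding thompson_set_def using hr mono_r nadic_PL_thompson_PL[OF PL]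
    by (auto simp: strict_mono_on_def r_def)
  then show thesis using that[of r] PL rs sr by (auto simp: fun_eq_iff)
qed

lemma bend_nadic_PL:
  assumes n: "n > 1" and ab: "a \<le> b" and bc: "b \<le> 1 - (b - a) / real n"
    and a: "a \<in> nadic n" and b: "b \<in> nadic n"
  shows "nadic_PL n (bend (real n) a b)"
proof -
  have n': "real n > 1" using n by simp
  note P = bend_pieces[OF n' ab bc]
  let ?c = "1 - (b - a) / real n"
  note I = nadic_add[OF n] nadic_minus
  have div: "x / real n \<in> nadic n" if "x \<in> nadic n" for x
    using nadic_scale[OF n that, of "- 1"] n by (simp add: power_int_minus divide_inverse mult.commute)
  have int: "of_int k \<in> nadic n" for k using nadicI[of k n 0] by simp
  have ba: "b + - a \<in> nadic n" by (intro I a b)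
  have c: "?c \<in> nadic n" using I(1)[OF int[of 1] I(2)[OF div[OF ba]]] by simp
  show ?thesis unfolding nadic_PL_def
  proof (intro exI[of _ "{a, b, ?c}"] conjI allI impI)
    show "{a, b, ?c} \<subseteq> nadic n" using a b c by simp
    fix x y assume xy: "0 \<le> x \<and> x < y \<and> y \<le> 1 \<and> {x<..<y} \<inter> {a, b, ?c} = {}"
    have side: "y \<le> z \<or> z \<le> x" if "z \<in> {a, b, ?c}" for z
    proof -
      have "\<not> (x < z \<and> z < y)" using xy that by (auto simp: greaterThanLessThan_iff)
      then show ?thesis by linarith
    qed
    consider "y \<le> a" | "a \<le> x" "y \<le> b" | "b \<le> x" "y \<le> ?c" | "?c \<le> x"
      using side[of a] side[of b] side[of ?c] by auto
    then show "\<exists>(j::int) c. c \<in> nadic n \<and> (\<forall>t\<in>{x..y}. bend (real n) a b t = real n powi j * t + c)"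
    proof cases
      case 1
      then show ?thesis using int[of 0] P(1) by (intro exI[of _ 0]) auto
    next
      case 2
      have "\<forall>t\<in>{x..y}. bend (real n) a b t = real n powi (- 1) * t + (a + - (a / real n))"
        using 2 P(2) by (auto simp: power_int_minus diff_divide_distrib divide_inverse mult.commute algebra_simps)
      moreover have "a + - (a / real n) \<in> nadic n" by (intro I a div)
      ultimately show ?thesis by blast
    next
      case 3
      have "\<forall>t\<in>{x..y}. bend (real n) a b t = real n powi 0 * t + - (b + - a + - ((b + - a) / real n))"
        using 3 P(3) by (auto simp: algebra_simps diff_divide_distrib)
      moreover have "- (b + - a + - ((b + - a) / real n)) \<in> nadic n" by (intro I a b div)
      ultimately show ?thesis by blast
    next
      case 4
      have "\<forall>t\<in>{x..y}. bend (real n) a b t = real n powi 1 * t + of_int (1 - int n)"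
        using 4 P(4) xy by (auto simp: algebra_simps)
      then show ?thesis using int by blast
    qed
  qed simp
qed

lemma bend_thompson:
  assumes n: "n > 1" and ab: "0 \<le> a" "a \<le> b" and bc: "b \<le> 1 - (b - a) / real n"
    and a: "a \<in> nadic n" and b: "b \<in> nadic n"
  shows "bend (real n) a b \<in> thompson_set n"
proof (rule thompson_setI)
  have n': "real n > 1" using n by simp
  note P = bend_pieces[OF n' ab(2) bc]
  show "strict_mono (bend (real n) a b)" "continuous_on UNIV (bend (real n) a b)"
    by (rule bend_glue[OF n' ab(2) bc])+
  show "bend (real n) a b 0 = 0" using P(1) ab by simp
  show "bend (real n) a b 1 = 1" using P(5) by simp
  show "bend (real n) a b t = t" if "t \<notin> {0..1}" for t
    using P(1)[of t] P(5)[of t] that ab by auto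
  show "thompson_PL n (bend (real n) a b)"
    by (rule nadic_PL_thompson_PL[OF bend_nadic_PL[OF n ab(2) bc a b]])
qed

lemma thompson_x_thompson:
  assumes "p \<ge> 1" "i \<le> p"
  shows "thompson_x p i \<in> thompson_set (p + 1) \<and> nadic_PL (p + 1) (thompson_x p i)"
proof -
  define n where "n = real (p + 1)"
  have n: "n > 1" and pn: "real p = n - 1" and N: "p + 1 > 1" and n': "real p + 1 = n" using assms by (auto simp: n_def)
  have nad: "real m / n \<in> nadic (p + 1)" for m
    using nadicI[of "int m" "p + 1" 1] by (simp add: n_def)
  show ?thesis
  proof (cases "i < p")
    case True
    define a b where "a = real i / n" and "b = real p / n"
    have ab: "0 \<le> a" "a \<le> b" using True n unfolding a_def b_def by (auto intro: divide_right_mono)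
    have "1 - (b - a) / n = b + (real i + 1) / n\<^sup>2" 
      unfolding a_def b_def pn using n by (simp add: field_simps power2_eq_square)
    then have bc: "b \<le> 1 - (b - a) / n" using n by simp
    have x: "thompson_x p i = bend n a b" using thompson_x_bend[OF True] unfolding n' a_def b_def .
    show ?thesis unfolding x unfolding n_def
      using bend_thompson[OF N ab bc[unfolded n_def]] bend_nadic_PL[OF N ab(2) bc[unfolded n_def]] nad
      unfolding a_def b_def by blast
  next
    case False
    then have i: "i = p" using assms by simp
    define a where "a = real p / n"
    define b where "b = a + real p / n\<^sup>2"
    have ab: "0 \<le> a" "a \<le> b" using n unfolding a_def b_def by auto
    have "1 - (b - a) / n = b + 1 / n ^ 3" 
      unfolding b_def a_def pn using n by (simp add: field_simps power2_eq_square power3_eq_cube)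
    then have bc: "b \<le> 1 - (b - a) / n" using n by simp
    have x: "thompson_x p p = bend n a b" using thompson_x_last_bend[OF assms(1)] unfolding n' a_def b_def .
    have a: "a \<in> nadic (p + 1)" unfolding a_def by (rule nad)
    have "real p / n\<^sup>2 \<in> nadic (p + 1)" using nadicI[of "int p" "p + 1" 2] by (simp add: n_def)
    then have b: "b \<in> nadic (p + 1)" unfolding b_def by (intro nadic_add[OF N] a)
    show ?thesis unfolding i x unfolding n_def
      using bend_thompson[OF N ab bc[unfolded n_def] a b] bend_nadic_PL[OF N ab(2) bc[unfolded n_def] a b] by blast
  qed
qed

abbreviation F :: "nat \<Rightarrow> (real \<Rightarrow> real) monoid" where "F p \<equiv> thompson_F (p + 1)"

definition edges :: "nat \<Rightarrow> ((real \<Rightarrow> real) \<times> (real \<Rightarrow> real)) set" where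
  "edges p = cayley_edges (F p) (thompson_gens p)"

definition xinv :: "nat \<Rightarrow> nat \<Rightarrow> real \<Rightarrow> real" where
  "xinv p i = m_inv (F p) (thompson_x p i)"

lemma F_simps [simp]:
  "carrier (thompson_F n) = thompson_set n" "f \<otimes>\<^bsub>thompson_F n\<^esub> g = f \<circ> g" "\<one>\<^bsub>thompson_F n\<^esub> = id"
  by (simp_all add: thompson_F_def)

lemma xinv:
  assumes "p \<ge> 1" "i \<le> p"
  shows "xinv p i \<in> thompson_set (p + 1)" "nadic_PL (p + 1) (xinv p i)"
    "thompson_x p i \<circ> xinv p i = id" "xinv p i \<circ> thompson_x p i = id"
proof -
  have n: "p + 1 > 1" using assms by simp
  obtain r where r: "r \<in> thompson_set (p + 1)" "nadic_PL (p + 1) r" "thompson_x p i \<circ> r = id" "r \<circ> thompson_x p i = id"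
    using thompson_set_inverse[OF n] thompson_x_thompson[OF assms] by metis
  have "xinv p i = r" unfolding xinv_def m_inv_def F_simps
  proof (rule the_equality)
    fix y assume "y \<in> thompson_set (p + 1) \<and> thompson_x p i \<circ> y = id \<and> y \<circ> thompson_x p i = id"
    then show "y = r" using r by (metis comp_assoc comp_id id_comp)
  qed (use r in simp)
  then show "xinv p i \<in> thompson_set (p + 1)" "nadic_PL (p + 1) (xinv p i)"
    "thompson_x p i \<circ> xinv p i = id" "xinv p i \<circ> thompson_x p i = id" using r by auto
qed

lemma xinv_simps [simp]:
  assumes "p \<ge> 1" "i \<le> p"
  shows "thompson_x p i (xinv p i t) = t" "xinv p i (thompson_x p i t) = t"
  using xinv(3,4)[OF assms] by (auto simp: fun_eq_iff)

lemma edges_iff: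
  "(u, v) \<in> edges p \<longleftrightarrow> u \<in> thompson_set (p + 1) \<and> (\<exists>i\<le>p. v = u \<circ> thompson_x p i \<or> v = u \<circ> xinv p i)"
proof -
  have "g \<in> letters (F p) (thompson_gens p) \<longleftrightarrow> (\<exists>i\<le>p. g = thompson_x p i \<or> g = xinv p i)" for g
    unfolding letters_def thompson_gens_def xinv_def by force
  then show ?thesis unfolding edges_def cayley_edges_def mem_Collect_eq F_simps by (simp add: Pair_inject) blast
qed

lemma edges_carrier:
  assumes "p \<ge> 1" "(u, v) \<in> edges p"
  shows "u \<in> thompson_set (p + 1)" "v \<in> thompson_set (p + 1)"
proof -
  show u: "u \<in> thompson_set (p + 1)" using assms(2) edges_iff by blast
  obtain i where i: "i \<le> p" "v = u \<circ> thompson_x p i \<or> v = u \<circ> xinv p i" using assms(2) edges_iff by blast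
  have n: "p + 1 > 1" using assms(1) by simp
  note xinv(1,2)[OF assms(1) i(1)] thompson_x_thompson[OF assms(1) i(1)]
  then show "v \<in> thompson_set (p + 1)" using i(2) thompson_set_comp[OF n u] by metis
qed

lemma edges_sym:
  assumes "p \<ge> 1" "(u, v) \<in> edges p"
  shows "(v, u) \<in> edges p"
proof -
  obtain i where i: "i \<le> p" "v = u \<circ> thompson_x p i \<or> v = u \<circ> xinv p i" using assms(2) edges_iff by blast
  have "u = v \<circ> xinv p i \<or> u = v \<circ> thompson_x p i"
    using i(2) xinv(3,4)[OF assms(1) i(1)] by (metis comp_assoc comp_id)
  then show ?thesis using edges_carrier(2)[OF assms] i(1) edges_iff by blast
qed

lemma id_thompson: "id \<in> thompson_set n"
proof (rule thompson_setI)
  show "thompson_PL n id" unfolding thompson_PL_def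
    by (intro exI[of _ "{}"]) (auto intro!: exI[of _ 0])
qed (auto simp: strict_mono_def)

section \<open>From the Cayley graph to walks of maps of the line\<close>

text \<open>The map \<open>h\<close> is \<open>g\<^sup>-\<^sup>1\<close> read in the chart. Stating this without inverses makes it easy to verify.\<close>

definition induces :: "nat \<Rightarrow> (real \<Rightarrow> real) \<Rightarrow> (real \<Rightarrow> real) \<Rightarrow> bool" where
  "induces p g h \<longleftrightarrow> (\<forall>u. g (chart p (h u)) = chart p u)"

lemma induces_id: "induces p id id"
  by (simp add: induces_def)

lemma induces_unique:
  assumes "p \<ge> 1" "g \<in> thompson_set (p + 1)" "g (chart p v) = chart p u" "induces p g h"
  shows "h u = v"
proof -
  have "g (chart p (h u)) = chart p u" using assms(4) unfolding induces_def by (rule spec)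
  then have "g (chart p (h u)) = g (chart p v)" using assms(3) by (rule trans[OF _ sym])
  then have "chart p (h u) = chart p v" by (rule injD[OF thompson_set_inj[OF assms(2)]])
  then show ?thesis by (rule injD[OF strict_mono_imp_inj_on[OF chart_strict_mono[OF assms(1)]]])
qed

text \<open>Multiplying \<open>g\<close> on the right by a letter postcomposes \<open>g\<^sup>-\<^sup>1\<close> with the inverse letter.\<close>

lemma induces_edge:
  assumes p: "p \<ge> 1" and e: "(g, g') \<in> edges p" and m: "induces p g h"
  shows "\<exists>h'. induces p g' h' \<and> (h, h') \<in> step p"
proof -
  obtain i where i: "i \<le> p" "g' = g \<circ> thompson_x p i \<or> g' = g \<circ> xinv p i" using e edges_iff by blast
  from i(2) show ?thesis
  proof
    assume g': "g' = g \<circ> thompson_x p i"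
    have "induces p g' (glide_inv p i \<circ> h)"
      using m by (simp add: induces_def g' thompson_x_chart[OF p i(1)] glide_glide_inv[OF p])
    moreover have "(h, glide_inv p i \<circ> h) \<in> step p" using i(1) unfolding step_def by blast
    ultimately show ?thesis by blast
  next
    assume g': "g' = g \<circ> xinv p i"
    have "xinv p i (chart p (glide p i u)) = chart p u" for u
      using thompson_x_chart[OF p i(1), of u] xinv_simps(2)[OF p i(1), of "chart p u"] by simp
    then have "induces p g' (glide p i \<circ> h)"
      using m by (simp add: induces_def g')
    moreover have "(h, glide p i \<circ> h) \<in> step p" using i(1) unfolding step_def by blast
    ultimately show ?thesis by blast
  qed
qed

definition action :: "nat \<Rightarrow> (real \<Rightarrow> real) \<Rightarrow> real \<Rightarrow> real" where
  "action p g = (SOME h. induces p g h)"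

lemma action_eqI:
  assumes "p \<ge> 1" "g \<in> thompson_set (p + 1)" "induces p g h"
  shows "action p g = h"
proof -
  have m: "induces p g (action p g)" unfolding action_def by (rule someI[of _ h]) (rule assms(3))
  show ?thesis
  proof
    fix u
    have "g (chart p (h u)) = chart p u" using assms(3) unfolding induces_def by (rule spec)
    then show "action p g u = h u" by (rule induces_unique[OF assms(1,2) _ m])
  qed
qed

lemma action_walk:
  assumes p: "p \<ge> 1" and w: "walk (edges p) f N" and f0: "f 0 = id"
  shows "walk (step p) (\<lambda>k. action p (f k)) N" "\<And>k. k \<le> N \<Longrightarrow> induces p (f k) (action p (f k))"
    "action p (f 0) = id"
proof -
  have car: "f k \<in> thompson_set (p + 1)" if "k \<le> N" for k
  proof (cases k)
    case 0 then show ?thesis using f0 id_thompson by metis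
  next
    case (Suc l)
    then have "(f l, f k) \<in> edges p" using that w by (simp add: walk_def)
    then show ?thesis by (rule edges_carrier(2)[OF p])
  qed
  show *: "induces p (f k) (action p (f k))" if "k \<le> N" for k
    using that
  proof (induction k)
    case 0 
    have "action p id = id" by (rule action_eqI[OF p id_thompson induces_id])
    then show ?case unfolding f0 using induces_id by metis
  next
    case (Suc k)
    then have "(f k, f (Suc k)) \<in> edges p" using w by (simp add: walk_def)
    then obtain h' where "induces p (f (Suc k)) h'" using induces_edge[OF p] Suc by (metis Suc_leD)
    then show ?case using action_eqI[OF p car] Suc.prems by metis
  qed
  show "walk (step p) (\<lambda>k. action p (f k)) N" unfolding walk_def
  proof (intro allI impI)
    fix k assume k: "k < N"
    then have "(f k, f (Suc k)) \<in> edges p" using w by (simp add: walk_def)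
    then obtain h' where "induces p (f (Suc k)) h'" "(action p (f k), h') \<in> step p" 
      using induces_edge[OF p] *[of k] k by (metis less_imp_le)
    then show "(action p (f k), action p (f (Suc k))) \<in> step p"
      using action_eqI[OF p car[of "Suc k"]] k by simp
  qed
  show "action p (f 0) = id" unfolding f0 by (rule action_eqI[OF p id_thompson induces_id])
qed

section \<open>The elements and two short words for each of them\<close>

abbreviation x0 :: "nat \<Rightarrow> real \<Rightarrow> real" where "x0 p \<equiv> thompson_x p 0"

text \<open>Reading the product from left to right: contract and move on \<open>M\<close> times, go back to the left end,
contract the mark there, and move right \<open>e\<close> times.\<close>

definition word_right_first :: "nat \<Rightarrow> nat \<Rightarrow> nat \<Rightarrow> nat \<Rightarrow> real \<Rightarrow> real" where
  "word_right_first p M A e =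
     (xinv p 1 \<circ> xinv p 0) ^^ M \<circ> (x0 p ^^ (M + A) \<circ> (xinv p 1 \<circ> xinv p 0 ^^ e))"

definition word_left_first :: "nat \<Rightarrow> nat \<Rightarrow> nat \<Rightarrow> nat \<Rightarrow> real \<Rightarrow> real" where
  "word_left_first p M A d =
     x0 p ^^ A \<circ> (xinv p 1 \<circ> (xinv p 0 ^^ (A - 1) \<circ> ((xinv p 1 \<circ> xinv p 0) ^^ M \<circ> x0 p ^^ d)))"

text \<open>Quantifying over all \<open>g\<close> makes the lengths of the factors of a product add up.\<close>

definition factor_of_length :: "nat \<Rightarrow> nat \<Rightarrow> (real \<Rightarrow> real) \<Rightarrow> bool" where
  "factor_of_length p k s \<longleftrightarrow> (\<forall>g\<in>thompson_set (p + 1). (g, g \<circ> s) \<in> edges p ^^ k \<and> g \<circ> s \<in> thompson_set (p + 1))"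

lemma factor_comp:
  assumes "factor_of_length p k s" "factor_of_length p l r"
  shows "factor_of_length p (k + l) (s \<circ> r)"
  unfolding factor_of_length_def
proof
  fix g assume g: "g \<in> thompson_set (p + 1)"
  have s: "(g, g \<circ> s) \<in> edges p ^^ k" "g \<circ> s \<in> thompson_set (p + 1)" 
    using assms(1) g by (auto simp: factor_of_length_def)
  have r: "(g \<circ> s, g \<circ> s \<circ> r) \<in> edges p ^^ l" "g \<circ> s \<circ> r \<in> thompson_set (p + 1)" 
    using assms(2) s(2) unfolding factor_of_length_def by blast+
  have "(g, g \<circ> s \<circ> r) \<in> edges p ^^ (k + l)" unfolding relpow_add using s(1) r(1) by (rule relcompI)
  then show "(g, g \<circ> (s \<circ> r)) \<in> edges p ^^ (k + l) \<and> g \<circ> (s \<circ> r) \<in> thompson_set (p + 1)"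
    using r(2) by (simp only: comp_assoc simp_thms)
qed

lemma factor_id: "factor_of_length p 0 id"
  by (simp add: factor_of_length_def)

lemma factor_funpow:
  assumes "factor_of_length p k s"
  shows "factor_of_length p (m * k) (s ^^ m)"
proof (induction m)
  case 0 show ?case using factor_id[of p] by (simp only: funpow.simps mult_0)
next
  case (Suc m)
  then show ?case using factor_comp[OF assms Suc] by (simp only: funpow.simps mult_Suc)
qed

lemma factor_gen:
  assumes "p \<ge> 1" "i \<le> p"
  shows "factor_of_length p 1 (thompson_x p i)" "factor_of_length p 1 (xinv p i)"
proof -
  have "(g, g \<circ> s) \<in> edges p ^^ 1 \<and> g \<circ> s \<in> thompson_set (p + 1)" 
    if "g \<in> thompson_set (p + 1)" "s = thompson_x p i \<or> s = xinv p i" for g s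
  proof -
    have "(g, g \<circ> s) \<in> edges p" unfolding edges_iff using that assms by blast
    then show ?thesis using edges_carrier(2)[OF assms(1)] by simp
  qed
  then show "factor_of_length p 1 (thompson_x p i)" "factor_of_length p 1 (xinv p i)"
    unfolding factor_of_length_def by blast+
qed

lemma factor_right_first:
  assumes "p \<ge> 1"
  shows "factor_of_length p (3 * M + A + 1 + e) (word_right_first p M A e)"
proof -
  note g = factor_gen[OF assms, of 0, OF le0] factor_gen[OF assms, of 1, OF assms]
  note pw = factor_funpow[OF factor_comp[OF g(4,2)], of M] factor_funpow[OF g(1), of "M + A"] factor_funpow[OF g(2), of e]
  have eq: "M * (1 + 1) + ((M + A) * 1 + (1 + e * 1)) = 3 * M + A + 1 + e" by simp
  show ?thesis unfolding word_right_first_def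
    by (subst eq[symmetric]) (rule factor_comp[OF pw(1) factor_comp[OF pw(2) factor_comp[OF g(4) pw(3)]]])
qed

lemma factor_left_first:
  assumes "p \<ge> 1" "A \<ge> 1"
  shows "factor_of_length p (2 * M + 2 * A + d) (word_left_first p M A d)"
proof -
  note g = factor_gen[OF assms(1), of 0, OF le0] factor_gen[OF assms(1), of 1, OF assms(1)]
  note pw = factor_funpow[OF factor_comp[OF g(4,2)], of M] factor_funpow[OF g(1), of A] 
    factor_funpow[OF g(2), of "A - 1"] factor_funpow[OF g(1), of d]
  have eq: "A * 1 + (1 + ((A - 1) * 1 + (M * (1 + 1) + d * 1))) = 2 * M + 2 * A + d" using assms(2) by simp
  show ?thesis unfolding word_left_first_def
    by (subst eq[symmetric]) (rule factor_comp[OF pw(2) factor_comp[OF g(4) factor_comp[OF pw(3) factor_comp[OF pw(1) pw(4)]]]])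
qed

lemma factor_thompson: "factor_of_length p k s \<Longrightarrow> s \<in> thompson_set (p + 1)"
  using id_thompson unfolding factor_of_length_def by (metis id_comp)

lemma thompson_set_strict_mono:
  assumes "f \<in> thompson_set n" shows "strict_mono f"
proof (rule strict_monoI)
  fix x y :: real assume xy: "x < y"
  note f = thompson_set_mono[OF assms]
  have r: "0 \<le> f t \<and> f t \<le> 1" if "0 \<le> t" "t \<le> 1" for t
    using f(3) that by (metis atLeastAtMost_iff imageI)
  have o: "f t = t" if "t < 0 \<or> t > 1" for t using f(5)[of t] that by auto
  show "f x < f y"
  proof (cases "x \<in> {0..1} \<and> y \<in> {0..1}")
    case True then show ?thesis using strict_mono_onD[OF f(1)] xy by blast
  next
    case False
    then consider "x < 0" "y < 0" | "x < 0" "0 \<le> y" "y \<le> 1" | "x < 0" "y > 1" | "x > 1" | "0 \<le> x" "x \<le> 1" "y > 1"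
      using xy by force
    then show ?thesis using xy o[of x] o[of y] r[of x] r[of y] by cases auto
  qed
qed

lemma x0_chart: "p \<ge> 1 \<Longrightarrow> x0 p (chart p u) = chart p (u - 1)"
  by (rule thompson_x_chart_zero)

lemma x0_inv_chart: "p \<ge> 1 \<Longrightarrow> xinv p 0 (chart p u) = chart p (u + 1)"
  using x0_chart[of p "u + 1"] xinv_simps(2)[of p 0 "chart p (u + 1)"] by simp

lemma x0_funpow_chart: "p \<ge> 1 \<Longrightarrow> (x0 p ^^ k) (chart p u) = chart p (u - real k)"
  by (induction k) (auto simp: x0_chart diff_diff_eq add.commute)

lemma x0_inv_funpow_chart: "p \<ge> 1 \<Longrightarrow> (xinv p 0 ^^ k) (chart p u) = chart p (u + real k)"
  by (induction k) (auto simp: x0_inv_chart add_ac)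

lemma x1_inv_chart:
  assumes "p \<ge> 1"
  shows "u \<le> 0 \<Longrightarrow> xinv p 1 (chart p u) = chart p u"
    and "xinv p 1 (chart p (1 / (real p + 1))) = chart p 1"
    and "u \<ge> 1 \<Longrightarrow> xinv p 1 (chart p u) = chart p (u + 1)"
proof -
  have x: "xinv p 1 (chart p (glide p 1 u)) = chart p u" for u
    using thompson_x_chart[OF assms assms, of u] xinv_simps(2)[OF assms assms, of "chart p u"] by simp
  show "u \<le> 0 \<Longrightarrow> xinv p 1 (chart p u) = chart p u" using x[of u] by (simp add: glide_def mult_le_0_iff)
  have "glide p 1 1 = 1 / (real p + 1)" using assms by (simp add: glide_def)
  then show "xinv p 1 (chart p (1 / (real p + 1))) = chart p 1" using x[of 1] by simp
  assume u: "u \<ge> 1"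
  have m: "real p * 1 \<le> real p * u" using u by (intro mult_left_mono) auto
  have p1: "real p \<ge> 1" using assms by simp
  have pos: "\<not> real p * (u + 1) \<le> 0" unfolding distrib_left using m p1 by linarith
  have "glide p 1 (u + 1) = u"
  proof (cases "real p * (u + 1) \<le> 1 + real p")
    case True
    then have "real p * u \<le> 1" by (simp add: distrib_left)
    then have "real p = 1" using m p1 by linarith
    then have "u = 1" using u True by simp
    then show ?thesis using \<open>real p = 1\<close> by (simp add: glide_def)
  next
    case False then show ?thesis using pos by (simp add: glide_def)
  qed
  then show "xinv p 1 (chart p u) = chart p (u + 1)" using x[of "u + 1"] by simp
qed

text \<open>A round consists of one move and one contraction. Far to the left only the move shows, so a round
is a translation by one unit; from \<open>0\<close> on both show, and it is a translation by two.\<close>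

lemma zigzag_chart:
  assumes "p \<ge> 1"
  shows "u \<le> - real k \<Longrightarrow> ((xinv p 1 \<circ> xinv p 0) ^^ k) (chart p u) = chart p (u + real k)"
    and "0 \<le> u \<Longrightarrow> ((xinv p 1 \<circ> xinv p 0) ^^ k) (chart p u) = chart p (u + 2 * real k)"
proof -
  show "u \<le> - real k \<Longrightarrow> ((xinv p 1 \<circ> xinv p 0) ^^ k) (chart p u) = chart p (u + real k)"
  proof (induction k)
    case (Suc k)
    have ih: "((xinv p 1 \<circ> xinv p 0) ^^ k) (chart p u) = chart p (u + real k)"
      by (rule Suc.IH) (use Suc.prems in simp)
    have "((xinv p 1 \<circ> xinv p 0) ^^ Suc k) (chart p u) = xinv p 1 (xinv p 0 (((xinv p 1 \<circ> xinv p 0) ^^ k) (chart p u)))" by simp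
    also have "\<dots> = xinv p 1 (chart p (u + real k + 1))" unfolding ih by (simp only: x0_inv_chart[OF assms])
    also have "\<dots> = chart p (u + real k + 1)" by (rule x1_inv_chart(1)[OF assms]) (use Suc in simp)
    also have "u + real k + 1 = u + real (Suc k)" by simp
    finally show ?case .
  qed simp
  show "0 \<le> u \<Longrightarrow> ((xinv p 1 \<circ> xinv p 0) ^^ k) (chart p u) = chart p (u + 2 * real k)"
  proof (induction k)
    case (Suc k)
    have ih: "((xinv p 1 \<circ> xinv p 0) ^^ k) (chart p u) = chart p (u + 2 * real k)"
      by (rule Suc.IH) (use Suc.prems in simp)
    have "((xinv p 1 \<circ> xinv p 0) ^^ Suc k) (chart p u) = xinv p 1 (xinv p 0 (((xinv p 1 \<circ> xinv p 0) ^^ k) (chart p u)))" by simp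
    also have "\<dots> = xinv p 1 (chart p (u + 2 * real k + 1))" unfolding ih by (simp only: x0_inv_chart[OF assms])
    also have "\<dots> = chart p (u + 2 * real k + 1 + 1)" by (rule x1_inv_chart(3)[OF assms]) (use Suc in simp)
    also have "u + 2 * real k + 1 + 1 = u + 2 * real (Suc k)" by simp
    finally show ?case .
  qed simp
qed

text \<open>With \<open>j = e - (A - 1)\<close> these are the end conditions of \<open>tour\<close>, for \<open>g\<close> in place of its inverse.\<close>

lemma word_right_first_chart:
  assumes p: "p \<ge> 1" and A: "A \<ge> 2"
  shows "2 - int A \<le> u \<Longrightarrow> u \<le> 0 \<Longrightarrow>
      word_right_first p M A e (chart p (of_int (u - (int e - (int A - 1))))) = chart p (of_int u)"
    and "0 \<le> q \<Longrightarrow> q < int M \<Longrightarrow>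
      word_right_first p M A e (chart p (of_int (q - (int e - (int A - 1))))) = chart p (of_int (2 * q))"
    and "0 \<le> q \<Longrightarrow> q < int M \<Longrightarrow>
      word_right_first p M A e (chart p (of_int (q - (int e - (int A - 1))) + 1 / (real p + 1))) = chart p (of_int (2 * q + 1))"
    and "word_right_first p M A e (chart p (1 / (real p + 1) - real e)) = chart p (of_int (1 - int A))"
proof -
  let ?z = "xinv p 1 \<circ> xinv p 0" let ?j = "int e - (int A - 1)"
  have start: "word_right_first p M A e (chart p (v - of_int ?j)) = (?z ^^ M) (chart p (v - real M))"
    if "2 - real A \<le> v" for v
  proof -
    have e: "v - of_int ?j + real e = v + real A - 1" by simp
    have "word_right_first p M A e (chart p (v - of_int ?j)) 
      = (?z ^^ M) ((x0 p ^^ (M + A)) (xinv p 1 ((xinv p 0 ^^ e) (chart p (v - of_int ?j)))))"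
      by (simp only: word_right_first_def comp_apply)
    also have "\<dots> = (?z ^^ M) ((x0 p ^^ (M + A)) (xinv p 1 (chart p (v + real A - 1))))"
      by (simp only: x0_inv_funpow_chart[OF p] e)
    also have "\<dots> = (?z ^^ M) ((x0 p ^^ (M + A)) (chart p (v + real A - 1 + 1)))"
      by (subst x1_inv_chart(3)[OF p]) (use that in simp_all)
    also have "\<dots> = (?z ^^ M) (chart p (v - real M))"
      by (simp add: x0_funpow_chart[OF p])
    finally show ?thesis .
  qed
  show "word_right_first p M A e (chart p (of_int (u - ?j))) = chart p (of_int u)" if "2 - int A \<le> u" "u \<le> 0"
  proof -
    have "2 - real A \<le> of_int u" using that(1) by linarith
    from start[OF this] have "word_right_first p M A e (chart p (of_int (u - ?j))) = (?z ^^ M) (chart p (of_int u - real M))"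
      by (simp only: of_int_diff)
    also have "\<dots> = chart p (of_int u - real M + real M)"
      by (rule zigzag_chart(1)[OF p]) (use that in simp)
    finally show ?thesis by simp
  qed
  have split: "?z ^^ M = ?z ^^ nat q \<circ> ?z ^^ nat (int M - q)" if "0 \<le> q" "q < int M" for q
  proof -
    have "M = nat q + nat (int M - q)" using that by linarith
    then show ?thesis by (metis funpow_add)
  qed
  show "word_right_first p M A e (chart p (of_int (q - ?j))) = chart p (of_int (2 * q))" if q: "0 \<le> q" "q < int M" for q
  proof -
    have "2 - real A \<le> of_int q" using q A by linarith
    from start[OF this] have "word_right_first p M A e (chart p (of_int (q - ?j))) = (?z ^^ M) (chart p (of_int q - real M))"
      by (simp only: of_int_diff)
    also have "\<dots> = (?z ^^ nat q) ((?z ^^ nat (int M - q)) (chart p (of_int q - real M)))"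
      unfolding split[OF q] by simp
    also have "(?z ^^ nat (int M - q)) (chart p (of_int q - real M)) = chart p (of_int q - real M + real (nat (int M - q)))"
      by (rule zigzag_chart(1)[OF p]) (use q in simp)
    also have "of_int q - real M + real (nat (int M - q)) = 0" using q by simp
    also have "(?z ^^ nat q) (chart p 0) = chart p (0 + 2 * real (nat q))" by (rule zigzag_chart(2)[OF p]) simp
    finally show ?thesis using q by simp
  qed
  show "word_right_first p M A e (chart p (of_int (q - ?j) + 1 / (real p + 1))) = chart p (of_int (2 * q + 1))" 
    if q: "0 \<le> q" "q < int M" for q
  proof -
    let ?r = "1 / (real p + 1)"
    have r: "0 \<le> ?r" "?r \<le> 1" by auto
    have "2 - real A \<le> of_int q + ?r" using q A r(1) by linarith
    from start[OF this] 
    have "word_right_first p M A e (chart p (of_int (q - ?j) + ?r)) = (?z ^^ M) (chart p (of_int q + ?r - real M))"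
      by (simp add: algebra_simps)
    also have "\<dots> = (?z ^^ nat q) ((?z ^^ nat (int M - q)) (chart p (of_int q + ?r - real M)))"
      unfolding split[OF q] by simp
    also have "nat (int M - q) = Suc (nat (int M - q - 1))" using q by linarith
    also have "(?z ^^ Suc (nat (int M - q - 1))) (chart p (of_int q + ?r - real M)) 
      = xinv p 1 (xinv p 0 ((?z ^^ nat (int M - q - 1)) (chart p (of_int q + ?r - real M))))" by simp
    also have "(?z ^^ nat (int M - q - 1)) (chart p (of_int q + ?r - real M)) 
      = chart p (of_int q + ?r - real M + real (nat (int M - q - 1)))"
      by (rule zigzag_chart(1)[OF p]) (use q r in simp)
    also have "of_int q + ?r - real M + real (nat (int M - q - 1)) = ?r - 1" using q by simp
    also have "xinv p 1 (xinv p 0 (chart p (?r - 1))) = chart p 1" 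
      using x0_inv_chart[OF p, of "?r - 1"] x1_inv_chart(2)[OF p] by simp
    also have "(?z ^^ nat q) (chart p 1) = chart p (1 + 2 * real (nat q))" by (rule zigzag_chart(2)[OF p]) simp
    finally show ?thesis using q by (simp add: add.commute)
  qed
  show "word_right_first p M A e (chart p (1 / (real p + 1) - real e)) = chart p (of_int (1 - int A))"
  proof -
    have "word_right_first p M A e (chart p (1 / (real p + 1) - real e)) 
      = (?z ^^ M) ((x0 p ^^ (M + A)) (xinv p 1 ((xinv p 0 ^^ e) (chart p (1 / (real p + 1) - real e)))))"
      by (simp only: word_right_first_def comp_apply)
    also have "(xinv p 0 ^^ e) (chart p (1 / (real p + 1) - real e)) = chart p (1 / (real p + 1))"
      by (simp add: x0_inv_funpow_chart[OF p])
    also have "xinv p 1 (chart p (1 / (real p + 1))) = chart p 1" by (rule x1_inv_chart(2)[OF p])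
    also have "(x0 p ^^ (M + A)) (chart p 1) = chart p (1 - real (M + A))" by (rule x0_funpow_chart[OF p])
    also have "(?z ^^ M) (chart p (1 - real (M + A))) = chart p (1 - real (M + A) + real M)"
      by (rule zigzag_chart(1)[OF p]) (use A in simp)
    finally show ?thesis by (simp add: algebra_simps)
  qed
qed

text \<open>Both generators are on their last piece there, which has slope \<open>n\<close> and ends at \<open>1\<close>.\<close>

lemma x1_eq_x0:
  assumes p: "p \<ge> 1" and w: "chart p 2 \<le> w"
  shows "thompson_x p 1 w = thompson_x p 0 w"
proof -
  define n where "n = real p + 1"
  have n: "n > 1" and pn: "real p = n - 1" using p by (auto simp: n_def)
  have chart2: "chart p 2 = 1 - (n - 1) / n ^ 3"
  proof -
    have "chart p 2 = 1 - (1 - 1 / n) / n\<^sup>2" using chart_third[OF p, of 2] p by (simp add: n_def)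
    then show ?thesis using n by (simp add: field_simps power2_eq_square power3_eq_cube)
  qed
  have *: "bend n a b w = (if w \<le> 1 then 1 - n * (1 - w) else w)"
    if "a \<le> b" "b \<le> 1 - (b - a) / n" "1 - (b - a) / n \<le> 1 - (n - 1) / n ^ 3" for a b
    using bend_pieces(4,5)[OF n that(1,2), of w] that(3) w chart2 by auto
  have 0: "thompson_x p 0 w = (if w \<le> 1 then 1 - n * (1 - w) else w)"
  proof -
    have "thompson_x p 0 = bend n 0 ((n - 1) / n)" using thompson_x_bend[of 0 p] p by (simp add: n_def)
    moreover have "(n - 1) / n \<le> 1 - ((n - 1) / n - 0) / n"
      using n by (simp add: field_simps power2_eq_square)
    moreover have "(n - 1) / n ^ 3 \<le> (n - 1) / n\<^sup>2"
      using n by (intro divide_left_mono power_increasing) auto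
    then have "1 - ((n - 1) / n - 0) / n \<le> 1 - (n - 1) / n ^ 3"
      by (simp add: power2_eq_square)
    ultimately show ?thesis using *[of 0 "(n - 1) / n"] n by simp
  qed
  have 1: "thompson_x p 1 w = (if w \<le> 1 then 1 - n * (1 - w) else w)"
  proof (cases "p = 1")
    case True
    then have n2: "n = 2" by (simp add: n_def)
    have "thompson_x p 1 = bend n (1 / 2) (3 / 4)" using thompson_x_last_bend[of 1] True n2 by (simp add: power2_eq_square)
    then show ?thesis using *[of "1 / 2" "3 / 4"] n2 by simp
  next
    case False
    then have p2: "real p \<ge> 2" using p by simp
    have x: "thompson_x p 1 = bend n (1 / n) ((n - 1) / n)" using thompson_x_bend[of 1 p] p False by (simp add: n_def)
    have c: "1 - ((n - 1) / n - 1 / n) / n = 1 - (n - 2) / n\<^sup>2"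
      by (simp add: power2_eq_square diff_divide_distrib)
    have "(n - 1) / n ^ 3 \<le> (n - 2) / n\<^sup>2"
    proof -
      have "n - 1 \<le> (n - 2) * n"
      proof -
        have "1 * n \<le> (n - 2) * n" using p2 n by (intro mult_right_mono) (auto simp: n_def)
        then show ?thesis by simp
      qed
      then have "(n - 1) / n ^ 3 \<le> (n - 2) * n / n ^ 3" using n by (intro divide_right_mono) auto
      also have "\<dots> = (n - 2) / n\<^sup>2" using n by (simp add: power2_eq_square power3_eq_cube)
      finally show ?thesis .
    qed
    moreover have "1 - (n - 2) / n\<^sup>2 = (n - 1) / n + 2 / n\<^sup>2" using n by (simp add: field_simps power2_eq_square)
    then have "(n - 1) / n \<le> 1 - (n - 2) / n\<^sup>2" using n by simp
    moreover have "1 / n \<le> (n - 1) / n" using p2 n by (intro divide_right_mono) (auto simp: n_def)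
    ultimately show ?thesis unfolding x using *[of "1 / n" "(n - 1) / n"] c by simp
  qed
  show ?thesis unfolding 0 1 ..
qed

lemma x1_fixes:
  assumes p: "p \<ge> 1" and w: "w \<le> chart p 0"
  shows "xinv p 1 w = w"
proof -
  have chart0: "chart p 0 = 1 / (real p + 1)" using chart_first[OF p, of 0] p by simp
  have "thompson_x p 1 w = w"
  proof (cases "p = 1")
    case True
    then show ?thesis using thompson_x_last_bend[of 1] w chart0 by (simp add: bend_def)
  next
    case False
    then show ?thesis using thompson_x_bend[of 1 p] w p chart0 by (simp add: bend_def)
  qed
  then show ?thesis using xinv_simps(2)[OF p p, of w] by simp
qed

lemma cancel_x0: "p \<ge> 1 \<Longrightarrow> x0 p ^^ k \<circ> xinv p 0 ^^ k = id" "p \<ge> 1 \<Longrightarrow> xinv p 0 ^^ k \<circ> x0 p ^^ k = id"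
proof -
  assume p: "p \<ge> 1"
  show "x0 p ^^ k \<circ> xinv p 0 ^^ k = id"
    by (rule ext, induction k) (use p in \<open>simp_all add: funpow_swap1\<close>)
  show "xinv p 0 ^^ k \<circ> x0 p ^^ k = id"
    by (rule ext, induction k) (use p in \<open>simp_all add: funpow_swap1\<close>)
qed

lemma commute_if_disjoint_support:
  fixes f g :: "real \<Rightarrow> real"
  assumes "strict_mono f" "strict_mono g" "\<And>y. y \<le> q \<Longrightarrow> f y = y" "\<And>y. q \<le> y \<Longrightarrow> g y = y"
  shows "f \<circ> g = g \<circ> f"
proof
  fix y
  show "(f \<circ> g) y = (g \<circ> f) y"
  proof (cases "y \<le> q")
    case True
    then have "g y \<le> q" using strict_mono_less_eq[OF assms(2), of y q] assms(4)[of q] by simp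
    then show ?thesis using assms(3) True by simp
  next
    case False
    then have "q \<le> f y" using strict_mono_less_eq[OF assms(1), of q y] assms(3)[of q] by simp
    then show ?thesis using assms(4) False by simp
  qed
qed

text \<open>Undoing the moves, the work on the right is supported above \<open>chart p 0\<close> and the work on the left
below it. So they commute, and the pointer may do them in either order.\<close>

lemma word_right_first_eq_left_first:
  assumes p: "p \<ge> 1" and A: "A \<ge> 2" and ed: "e + d = M + A - 1"
  shows "word_right_first p M A e = word_left_first p M A d"
proof -
  let ?t = "xinv p 0" let ?c = "xinv p 1" let ?x = "x0 p" let ?q = "chart p 0"
  define R where "R = (?c \<circ> ?t) ^^ M \<circ> ?x ^^ M"
  define E where "E = ?x ^^ A \<circ> (?c \<circ> ?t ^^ (A - 1))"
  note g = factor_gen[OF p, of 0, OF le0] factor_gen[OF p, of 1, OF p]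
  have mono_R: "strict_mono R" unfolding R_def
    by (rule thompson_set_strict_mono, rule factor_thompson, rule factor_comp,
        rule factor_funpow, rule factor_comp, rule g(4), rule g(2), rule factor_funpow, rule g(1))
  have mono_E: "strict_mono E" unfolding E_def
    by (rule thompson_set_strict_mono, rule factor_thompson, rule factor_comp,
        rule factor_funpow, rule g(1), rule factor_comp, rule g(4), rule factor_funpow, rule g(2))
  have x_le: "(?x ^^ k) y \<le> ?q" if "y \<le> ?q" for k y
  proof -
    have "strict_mono (?x ^^ k)" 
      by (rule thompson_set_strict_mono, rule factor_thompson, rule factor_funpow, rule g(1))
    then have "(?x ^^ k) y \<le> (?x ^^ k) ?q" using that by (simp add: strict_mono_less_eq)
    also have "\<dots> = chart p (0 - real k)" by (rule x0_funpow_chart[OF p])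
    also have "\<dots> \<le> ?q" using strict_mono_less_eq[OF chart_strict_mono[OF p], of "0 - real k" 0] by simp
    finally show ?thesis .
  qed
  have fix_R: "R y = y" if y: "y \<le> ?q" for y
    unfolding R_def
  proof (induction M)
    case (Suc m)
    have "((?c \<circ> ?t) ^^ Suc m \<circ> ?x ^^ Suc m) y = ((?c \<circ> ?t) ^^ m) (?c (?t (?x ((?x ^^ m) y))))"
      by (simp add: funpow_swap1)
    also have "?t (?x ((?x ^^ m) y)) = (?x ^^ m) y" using p by simp
    also have "?c ((?x ^^ m) y) = (?x ^^ m) y" by (rule x1_fixes[OF p x_le[OF y]])
    finally show ?case using Suc by simp
  qed simp
  have fix_E: "E y = y" if y: "?q \<le> y" for y
  proof -
    define w where "w = (?t ^^ A) y"
    have "strict_mono (?t ^^ A)" 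
      by (rule thompson_set_strict_mono, rule factor_thompson, rule factor_funpow, rule g(2))
    then have "(?t ^^ A) ?q \<le> w" using y by (simp add: strict_mono_less_eq w_def)
    moreover have "(?t ^^ A) ?q = chart p (0 + real A)" by (rule x0_inv_funpow_chart[OF p])
    moreover have "chart p 2 \<le> chart p (0 + real A)" using A strict_mono_less_eq[OF chart_strict_mono[OF p]] by simp
    ultimately have "thompson_x p 1 w = ?x w" by (intro x1_eq_x0[OF p]) simp
    moreover have "A = Suc (A - 1)" using A by simp
    then have w': "w = ?t ((?t ^^ (A - 1)) y)" unfolding w_def by (metis comp_apply funpow.simps(2))
    ultimately have "thompson_x p 1 w = (?t ^^ (A - 1)) y" using p by simp
    then have "?c ((?t ^^ (A - 1)) y) = w" using xinv_simps(2)[OF p p, of w] by simp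
    then have "E y = (?x ^^ A) w" by (simp add: E_def)
    also have "\<dots> = y" using fun_cong[OF cancel_x0(1)[OF p, of A], of y] by (simp add: w_def)
    finally show ?thesis .
  qed
  have comm: "R \<circ> E = E \<circ> R" by (rule commute_if_disjoint_support[OF mono_R mono_E fix_R fix_E])
  have tx: "?t ^^ e \<circ> ?x ^^ e = id" for e by (rule cancel_x0(2)[OF p])
  have "word_right_first p M A e \<circ> ?x ^^ e = (?c \<circ> ?t) ^^ M \<circ> (?x ^^ (M + A) \<circ> (?c \<circ> (?t ^^ e \<circ> ?x ^^ e)))"
    by (simp only: word_right_first_def comp_assoc)
  also have "\<dots> = (?c \<circ> ?t) ^^ M \<circ> (?x ^^ (M + A) \<circ> (?c \<circ> (?t ^^ (A - 1) \<circ> ?x ^^ (A - 1))))"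
    by (simp only: tx)
  also have "\<dots> = (R \<circ> E) \<circ> ?x ^^ (A - 1)" by (simp only: R_def E_def funpow_add comp_assoc)
  also have "\<dots> = (E \<circ> R) \<circ> ?x ^^ (A - 1)" by (simp only: comm)
  also have "\<dots> = ?x ^^ A \<circ> (?c \<circ> (?t ^^ (A - 1) \<circ> ((?c \<circ> ?t) ^^ M \<circ> (?x ^^ M \<circ> ?x ^^ (A - 1)))))"
    by (simp only: R_def E_def comp_assoc)
  also have "?x ^^ M \<circ> ?x ^^ (A - 1) = ?x ^^ d \<circ> ?x ^^ e"
  proof -
    have "M + (A - 1) = d + e" using ed A by simp
    then show ?thesis by (simp only: funpow_add[symmetric])
  qed
  also have "?x ^^ A \<circ> (?c \<circ> (?t ^^ (A - 1) \<circ> ((?c \<circ> ?t) ^^ M \<circ> (?x ^^ d \<circ> ?x ^^ e)))) = word_left_first p M A d \<circ> ?x ^^ e"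
    by (simp only: word_left_first_def comp_assoc)
  finally have "word_right_first p M A e \<circ> ?x ^^ e = word_left_first p M A d \<circ> ?x ^^ e" .
  then have "(word_right_first p M A e \<circ> ?x ^^ e) \<circ> ?t ^^ e = (word_left_first p M A d \<circ> ?x ^^ e) \<circ> ?t ^^ e"
    by (rule arg_cong[where f = "\<lambda>g. g \<circ> ?t ^^ e"])
  then show ?thesis by (simp only: comp_assoc cancel_x0(1)[OF p] comp_id)
qed

lemma tour_word:
  assumes p: "p \<ge> 1" and AM: "A \<ge> 4" "M \<ge> 4" and e: "\<bar>int e - (int A - 1)\<bar> \<le> 3"
    and w: "walk (edges p) f N" "f 0 = id" "f N = word_right_first p M A e"
  shows "tour p (\<lambda>k. action p (f k)) N (int A) (int M) (int e - (int A - 1))"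
proof -
  let ?w = "word_right_first p M A e" 
  have car: "f N \<in> thompson_set (p + 1)" unfolding w(3)
    by (rule factor_thompson[OF factor_right_first[OF p]])
  have m: "induces p (f N) (action p (f N))" by (rule action_walk(2)[OF p w(1,2)]) simp
  have act: "action p (f N) u = v" if "?w (chart p v) = chart p u" for u v
    by (rule induces_unique[OF p car _ m]) (use that w(3) in simp)
  have A2: "A \<ge> 2" using AM by simp
  note W = word_right_first_chart[OF p A2, where M = M and e = e]
  show ?thesis
  proof unfold_locales
    show "walk (step p) (\<lambda>k. action p (f k)) N" "action p (f 0) = id" using action_walk[OF p w(1,2)] by auto
    show "action p (f N) (of_int (1 - int A)) \<notin> \<int>"
    proof
      assume "action p (f N) (of_int (1 - int A)) \<in> \<int>"
      then have "1 / (real p + 1) - real e \<in> \<int>" using act[OF W(4)] by simp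
      then have "1 / (real p + 1) - real e + real e \<in> \<int>" by (rule Ints_add) simp
      then have "1 / (real p + 1) \<in> \<int>" by simp
      then obtain m where m: "1 / (real p + 1) = of_int m" by (auto elim: Ints_cases)
      have "0 < 1 / (real p + 1)" "1 / (real p + 1) < 1" using p by auto
      then show False unfolding m by simp
    qed
  qed (use p AM e act[OF W(1)] act[OF W(2)] act[OF W(3)] in auto)
qed

section \<open>Geodesic words\<close>

lemma walk_relpow: "walk r f n \<Longrightarrow> k \<le> l \<Longrightarrow> l \<le> n \<Longrightarrow> (f k, f l) \<in> r ^^ (l - k)"
  unfolding relpow_fun_conv walk_def
  by (intro exI[of _ "\<lambda>i. f (k + i)"]) auto

lemma relpow_walk: "(a, b) \<in> r ^^ n \<Longrightarrow> \<exists>f. walk r f n \<and> f 0 = a \<and> f n = b"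
  unfolding relpow_fun_conv walk_def by blast

lemma walk_drop: "walk r f n \<Longrightarrow> walk r (\<lambda>k. f (m + k)) (n - m)"
  by (simp add: walk_def)

lemma walk_rev: 
  assumes "walk r f n" "sym r" shows "walk r (\<lambda>k. f (n - k)) n"
  unfolding walk_def
proof (intro allI impI)
  fix k assume k: "k < n"
  then have "(f (n - Suc k), f (Suc (n - Suc k))) \<in> r" using assms(1) by (simp add: walk_def)
  moreover have "Suc (n - Suc k) = n - k" using k by simp
  ultimately show "(f (n - k), f (n - Suc k)) \<in> r" using assms(2) by (simp add: symD)
qed

lemma cayley_dist_le: "(u, v) \<in> cayley_edges G X ^^ n \<Longrightarrow> cayley_dist G X u v \<le> n"
  unfolding cayley_dist_def by (rule Least_le)

lemma cayley_dist_path: 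
  "(u, v) \<in> cayley_edges G X ^^ n \<Longrightarrow> (u, v) \<in> cayley_edges G X ^^ cayley_dist G X u v"
  unfolding cayley_dist_def by (rule LeastI)

text \<open>A prefix of a geodesic is a geodesic, so the vertex number \<open>k\<close> has length \<open>k\<close>.\<close>

lemma geodesic_word_walk:
  fixes G (structure)
  assumes "geodesic_word G X w"
  defines "f \<equiv> \<lambda>k. word_val G (take k w)"
  shows "walk (cayley_edges G X) f (length w)" "f 0 = \<one>" "f (length w) = word_val G w"
    "length w = cayley_dist G X \<one> (word_val G w)"
    "\<And>k. k \<le> length w \<Longrightarrow> f k \<in> set (word_path G w)"
    "\<And>k. k \<le> length w \<Longrightarrow> cayley_length G X (f k) = k"
proof -
  let ?E = "cayley_edges G X" let ?N = "length w"
  have path: "word_path G w = map f [0..<Suc ?N]" by (simp add: word_path_def f_def)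
  have geo: "geodesic_path G X (map f [0..<Suc ?N])" using assms(1) unfolding geodesic_word_def path by simp
  show f0: "f 0 = \<one>" by (simp add: f_def word_val_def)
  show fN: "f ?N = word_val G w" by (simp add: f_def)
  show walk: "walk ?E f ?N" unfolding walk_def
  proof (intro allI impI)
    fix k assume k: "k < ?N"
    have "successively (\<lambda>u v. (u, v) \<in> ?E) (map f [0..<Suc ?N])" using geo by (simp only: geodesic_path_def simp_thms)
    then have "((map f [0..<Suc ?N]) ! k, (map f [0..<Suc ?N]) ! Suc k) \<in> ?E"
      unfolding successively_conv_nth using k by (metis Suc_mono length_map length_upt diff_zero)
    then show "(f k, f (Suc k)) \<in> ?E" using k by (simp del: upt_Suc)
  qed
  have hd: "hd (map f [0..<Suc ?N]) = \<one>" using f0 by (simp add: hd_map del: upt_Suc)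
  have last: "last (map f [0..<Suc ?N]) = word_val G w" using fN by simp
  have "length (map f [0..<Suc ?N]) = Suc (cayley_dist G X (hd (map f [0..<Suc ?N])) (last (map f [0..<Suc ?N])))"
    using geo unfolding geodesic_path_def by blast
  then show len: "?N = cayley_dist G X \<one> (word_val G w)" unfolding hd last by simp
  fix k assume k: "k \<le> ?N"
  show "f k \<in> set (word_path G w)" unfolding path using k by (simp del: upt_Suc)
  have to_k: "(\<one>, f k) \<in> ?E ^^ k" using walk_relpow[OF walk, of 0 k] k f0 by simp
  have from_k: "(f k, word_val G w) \<in> ?E ^^ (?N - k)" using walk_relpow[OF walk, of k ?N] k fN by simp
  let ?d = "cayley_length G X (f k)"
  have "?d \<le> k" unfolding cayley_length_def by (rule cayley_dist_le[OF to_k])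
  moreover have "(\<one>, f k) \<in> ?E ^^ ?d" unfolding cayley_length_def by (rule cayley_dist_path[OF to_k])
  then have "(\<one>, word_val G w) \<in> ?E ^^ (?d + (?N - k))" using from_k unfolding relpow_add by (rule relcompI)
  then have "?N \<le> ?d + (?N - k)" using cayley_dist_le len by metis
  ultimately show "?d = k" using k by linarith
qed

section \<open>Two neighbouring elements whose geodesics diverge\<close>

theorem theorem2p2:
  fixes p :: nat
  assumes "p \<ge> 1"
  shows "\<not> combable_by_geodesics (thompson_F (p + 1)) (thompson_gens p)"
proof
  note p = assms
  let ?E = "edges p"
  assume "combable_by_geodesics (thompson_F (p + 1)) (thompson_gens p)"
  then obtain D L where geo: "\<And>w. w \<in> L \<Longrightarrow> geodesic_word (F p) (thompson_gens p) w"
    and onto: "\<And>h. h \<in> thompson_set (p + 1) \<Longrightarrow> \<exists>w\<in>L. word_val (F p) w = h"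
    and travel: "\<And>u v. u \<in> L \<Longrightarrow> v \<in> L \<Longrightarrow> cayley_dist (F p) (thompson_gens p) (word_val (F p) u) (word_val (F p) v) = 1 \<Longrightarrow>
           sync_fellow_travel (F p) (thompson_gens p) D (word_path (F p) u) (word_path (F p) v)"
    unfolding combable_by_geodesics_def F_simps by blast
  \<comment> \<open>The bounds for three touches exceed the geodesic length by \<open>2M - 24\<close>, which must be more than
    the \<open>2D\<close> steps of a detour.\<close>
  define M where "M = D + 13"
  \<comment> \<open>The mark is at \<open>1 - M\<close>, and the shift \<open>j = i - 3\<close> runs from \<open>-3\<close> to \<open>3\<close>.\<close>
  define W where "W i = word_right_first p M M (M - 4 + i)" for i
  have W: "W i \<in> thompson_set (p + 1)" for i
    unfolding W_def by (rule factor_thompson[OF factor_right_first[OF p]])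
  define w where "w i = (SOME w. w \<in> L \<and> word_val (F p) w = W i)" for i
  have w: "w i \<in> L" "word_val (F p) (w i) = W i" for i
    using someI_ex[of "\<lambda>v. v \<in> L \<and> word_val (F p) v = W i"] onto[OF W[of i]] unfolding w_def by auto
  define f where "f i k = word_val (F p) (take k (w i))" for i k
  define N where "N i = length (w i)" for i
  define h where "h i k = action p (f i k)" for i k
  note G = geodesic_word_walk[OF geo[OF w(1)], folded f_def N_def edges_def, unfolded F_simps w(2)]
  have j: "int (M - 4 + i) - (int M - 1) = int i - 3" for i by (simp add: M_def)
  have tour: "tour p (\<lambda>k. action p (g k)) n (int M) (int M) (int i - 3)" 
    if "walk ?E g n" "g 0 = id" "g n = W i" "i \<le> 6" for g n i
    using tour_word[OF p, of M M "M - 4 + i" g n] that unfolding j W_def by (simp add: M_def)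
  have tour_f: "tour p (h i) (N i) (int M) (int M) (int i - 3)" if "i \<le> 6" for i
    unfolding h_def by (rule tour) (use G[of i] that in auto)
  have short: "int (N i) \<le> 5 * int M + (int i - 3)" "int (N i) \<le> 5 * int M - (int i - 3)" if "i \<le> 6" for i
  proof -
    have le: "N i \<le> n" if "factor_of_length p n (W i)" for n
    proof -
      have "(id, id \<circ> W i) \<in> edges p ^^ n" using that id_thompson unfolding factor_of_length_def by blast
      then show ?thesis unfolding G(4) id_comp edges_def by (rule cayley_dist_le)
    qed
    have "N i \<le> 3 * M + M + 1 + (M - 4 + i)"
      unfolding W_def by (rule le[unfolded W_def]) (rule factor_right_first[OF p])
    then show "int (N i) \<le> 5 * int M + (int i - 3)" by (simp add: M_def)
    have "W i = word_left_first p M M (M + 3 - i)"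
      unfolding W_def by (rule word_right_first_eq_left_first[OF p]) (use that in \<open>auto simp: M_def\<close>)
    then have "factor_of_length p (2 * M + 2 * M + (M + 3 - i)) (W i)"
      using factor_left_first[OF p, of M M "M + 3 - i"] by (simp add: M_def)
    then have "N i \<le> 2 * M + 2 * M + (M + 3 - i)" by (rule le)
    then show "int (N i) \<le> 5 * int M - (int i - 3)" using that by (simp add: M_def)
  qed
  \<comment> \<open>Some touch of the right end precedes some touch of the left mark.\<close>
  define RL where "RL i \<longleftrightarrow> (\<exists>a b. a \<le> b \<and> b \<le> N i \<and> touches_right (h i) (int M) a \<and> touches_left (h i) (int M) b)" for i
  have touches: "\<exists>a\<le>N i. touches_right (h i) (int M) a" "\<exists>b\<le>N i. touches_left (h i) (int M) b" if "i \<le> 6" for i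
    using tour.touches_right_exists[OF tour_f[OF that]] tour.touches_left_exists[OF tour_f[OF that]] by auto
  have "\<not> RL 6"
  proof
    assume "RL 6"
    then have "2 * int M + 3 * int M - 1 \<le> int (N 6)"
      unfolding RL_def using tour.right_left_length[OF tour_f[of 6]] by auto
    then show False using short(2)[of 6] by simp
  qed
  moreover have "RL 0"
  proof -
    obtain a b where ab: "a \<le> N 0" "b \<le> N 0" "touches_right (h 0) (int M) a" "touches_left (h 0) (int M) b"
      using touches[of 0] by auto
    have "a \<le> b"
    proof (rule ccontr)
      assume "\<not> a \<le> b"
      then have "2 * int M + 3 * int M - 1 \<le> int (N 0)"
        using tour.left_right_length[OF tour_f[of 0], of b a] ab by auto
      then show False using short(1)[of 0] by simp
    qed
    then show ?thesis unfolding RL_def using ab by blast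
  qed
  ultimately obtain i where i: "i < 6" "RL i" "\<not> RL (Suc i)"
    by (metis dec_induct[of 0 6 RL] le0)
  have edge: "(W i, W (Suc i)) \<in> ?E"
  proof -
    have "W (Suc i) = W i \<circ> xinv p 0" unfolding W_def word_right_first_def
      by (simp add: funpow_Suc_right comp_assoc del: funpow.simps)
    then show ?thesis unfolding edges_iff using W by blast
  qed
  have ne: "W i \<noteq> W (Suc i)"
  proof
    assume "W i = W (Suc i)"
    then have "h i (N i) = h (Suc i) (N (Suc i))" using G(3)[of i] G(3)[of "Suc i"] by (simp add: h_def)
    moreover have "h i (N i) (of_int 0) = of_int (0 - (int i - 3))"
      by (rule tour.left_end[OF tour_f]) (use i in \<open>auto simp: M_def\<close>)
    moreover have "h (Suc i) (N (Suc i)) (of_int 0) = of_int (0 - (int (Suc i) - 3))"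
      by (rule tour.left_end[OF tour_f]) (use i in \<open>auto simp: M_def\<close>)
    ultimately show False by simp
  qed
  have dist1: "cayley_dist (F p) (thompson_gens p) (W i) (W (Suc i)) = 1"
  proof -
    have "(W i, W (Suc i)) \<in> cayley_edges (F p) (thompson_gens p) ^^ 1" using edge by (simp add: edges_def)
    then have "cayley_dist (F p) (thompson_gens p) (W i) (W (Suc i)) \<le> 1"
      and "(W i, W (Suc i)) \<in> cayley_edges (F p) (thompson_gens p) ^^ cayley_dist (F p) (thompson_gens p) (W i) (W (Suc i))"
      by (rule cayley_dist_le, rule cayley_dist_path)
    then show ?thesis using ne by (cases "cayley_dist (F p) (thompson_gens p) (W i) (W (Suc i))") auto
  qed
  have sym: "sym ?E" using edges_sym[OF p] by (auto intro: symI)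
  have Nle: "N i \<le> N (Suc i) + 1"
  proof -
    have "(id, W (Suc i)) \<in> ?E ^^ N (Suc i)" using walk_relpow[OF G(1)[of "Suc i"], of 0 "N (Suc i)"] G(2,3)[of "Suc i"] by simp
    moreover have "(W (Suc i), W i) \<in> ?E ^^ 1" using edges_sym[OF p edge] by simp
    ultimately have "(id, W i) \<in> ?E ^^ (N (Suc i) + 1)" unfolding relpow_add by (rule relcompI)
    then show ?thesis unfolding G(4)[of i] edges_def by (rule cayley_dist_le)
  qed
  have i6: "i \<le> 6" "Suc i \<le> 6" using i by auto
  obtain a b where ab: "a \<le> b" "b \<le> N i" "touches_right (h i) (int M) a" "touches_left (h i) (int M) b"
    using i(2) unfolding RL_def by blast
  obtain a' b' where ab': "a' \<le> N (Suc i)" "b' \<le> N (Suc i)" "touches_right (h (Suc i)) (int M) a'" "touches_left (h (Suc i)) (int M) b'"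
    using touches[OF i6(2)] by blast
  have ba': "b' < a'"
  proof (rule ccontr)
    assume "\<not> b' < a'"
    then have "RL (Suc i)" using ab' unfolding RL_def by (intro exI[of _ a'] exI[of _ b']) auto
    then show False using i(3) by simp
  qed
  have "a \<noteq> b"
  proof
    assume "a = b"
    then have "h i a (of_int (1 - int M)) = h i a (of_int (2 * int M - 1))"
      using ab by (simp add: touches_right_def touches_left_def)
    moreover have "strict_mono (h i a)" by (rule tour.mono[OF tour_f[OF i6(1)]]) (use ab in simp)
    ultimately have "(of_int (1 - int M) :: real) = of_int (2 * int M - 1)"
      by (simp only: strict_mono_eq)
    then show False by (simp add: M_def)
  qed
  then have lt: "a < b" using ab(1) by simp
  then have aN: "a \<le> N (Suc i)" "a \<le> N i" using Nle ab(2) by auto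
  have walk_a: "walk ?E (f (Suc i)) a" using G(1)[of "Suc i"] aN by (simp add: walk_def)
  obtain d n where d: "walk ?E d n" "d 0 = f i a" "d n = f (Suc i) a" "n \<le> D"
  proof -
    let ?dist = "cayley_dist (F p) (thompson_gens p) (f i a) (f (Suc i) a)"
    have "walk ?E (f i) a" using G(1)[of i] aN by (simp add: walk_def)
    from walk_relpow[OF walk_rev[OF this sym], of 0 a] have "(f i a, id) \<in> ?E ^^ a" using G(2)[of i] by simp
    moreover have "(id, f (Suc i) a) \<in> ?E ^^ a" using walk_relpow[OF walk_a, of 0 a] G(2)[of "Suc i"] by simp
    ultimately have "(f i a, f (Suc i) a) \<in> ?E ^^ (a + a)" unfolding relpow_add by (rule relcompI)
    then have "(f i a, f (Suc i) a) \<in> ?E ^^ ?dist" unfolding edges_def by (rule cayley_dist_path)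
    from relpow_walk[OF this] obtain d where d: "walk ?E d ?dist" "d 0 = f i a" "d ?dist = f (Suc i) a"
      by (elim exE conjE)
    have "?dist \<le> D"
    proof -
      have "sync_fellow_travel (F p) (thompson_gens p) D (word_path (F p) (w i)) (word_path (F p) (w (Suc i)))"
        by (rule travel[OF w(1) w(1)]) (simp only: w(2) dist1)
      then show ?thesis unfolding sync_fellow_travel_def
        using G(5)[OF aN(2)] G(5)[OF aN(1)] G(6)[OF aN(2)] G(6)[OF aN(1)] by simp
    qed
    then show thesis by (rule that[OF d])
  qed
  let ?d_rev = "\<lambda>k. d (n - k)"
  have d_rev: "walk ?E ?d_rev n" by (rule walk_rev[OF d(1) sym])
  define g1 where "g1 = splice a (f (Suc i)) ?d_rev"
  have g1: "walk ?E g1 (a + n)" unfolding g1_def by (rule walk_splice[OF walk_a d_rev]) (simp add: d)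
  have g1_end: "g1 (a + n) = f i a" using d by (cases "n = 0") (auto simp: g1_def splice_def)
  have g1_start: "g1 k = f (Suc i) k" if "k \<le> a" for k using that by (simp add: g1_def splice_def)
  show False
  proof (cases "b' \<le> a")
    \<comment> \<open>Change over from the second geodesic to the first one at time \<open>a\<close>: left, right, left.\<close>
    case True
    define g where "g = splice (a + n) g1 (\<lambda>k. f i (a + k))"
    have walk_g: "walk ?E g (a + n + (N i - a))"
      unfolding g_def by (rule walk_splice[OF g1 walk_drop[OF G(1)]]) (simp add: g1_end)
    have later: "g (k + n) = f i k" if "a \<le> k" for k
      using that g1_end by (cases "k = a") (auto simp: g_def splice_def)
    have earlier: "g k = f (Suc i) k" if "k \<le> a" for k
      using that g1_start by (simp add: g_def splice_def)
    have "g (a + n + (N i - a)) = W i" using later[of "N i"] aN G(3)[of i] by (simp add: add.commute)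
    moreover have "g 0 = id" using earlier[of 0] G(2) by simp
    ultimately have T: "tour p (\<lambda>k. action p (g k)) (a + n + (N i - a)) (int M) (int M) (int i - 3)"
      by (intro tour walk_g i6(1))
    have "4 * int M + 3 * int M - 24 \<le> int (a + n + (N i - a))"
    proof (rule tour.left_right_left_length[OF T])
      show "touches_left (\<lambda>k. action p (g k)) (int M) b'"
        using ab'(4) earlier[OF True] by (simp add: touches_left_def h_def)
      show "touches_right (\<lambda>k. action p (g k)) (int M) (a + n)"
        using ab(3) later[of a] by (simp add: touches_right_def h_def)
      show "touches_left (\<lambda>k. action p (g k)) (int M) (b + n)"
        using ab(4) later[of b] lt by (simp add: touches_left_def h_def)
    qed (use True lt ab(2) in auto)
    then show False using short[OF i6(1)] d(4) aN by (simp add: M_def)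
  next
    \<comment> \<open>Make a detour from the second geodesic to the first one at time \<open>a\<close>: right, left, right.\<close>
    case False
    define g2 where "g2 = splice (a + n) g1 d"
    have g2: "walk ?E g2 (a + n + n)" unfolding g2_def by (rule walk_splice[OF g1 d(1)]) (simp add: g1_end d)
    have g2_end: "g2 (a + n + n) = f (Suc i) a" using g1_end d by (cases "n = 0") (auto simp: g2_def splice_def)
    define g where "g = splice (a + n + n) g2 (\<lambda>k. f (Suc i) (a + k))"
    have walk_g: "walk ?E g (a + n + n + (N (Suc i) - a))"
      unfolding g_def by (rule walk_splice[OF g2 walk_drop[OF G(1)]]) (simp add: g2_end)
    have later: "g (k + n + n) = f (Suc i) k" if "a \<le> k" for k
      using that g2_end by (cases "k = a") (auto simp: g_def splice_def)
    have idx: "a + n + n + (N (Suc i) - a) = N (Suc i) + n + n" using aN by simp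
    have "g (a + n + n + (N (Suc i) - a)) = W (Suc i)"
      unfolding idx later[OF aN(1)] by (rule G(3))
    moreover have "g 0 = id" using g1_start[of 0] G(2)[of "Suc i"] by (simp add: g_def g2_def splice_def)
    ultimately have T: "tour p (\<lambda>k. action p (g k)) (a + n + n + (N (Suc i) - a)) (int M) (int M) (int (Suc i) - 3)"
      by (intro tour walk_g i6(2))
    have "2 * int M + 5 * int M - 24 \<le> int (a + n + n + (N (Suc i) - a))"
    proof (rule tour.right_left_right_length[OF T])
      show "touches_right (\<lambda>k. action p (g k)) (int M) (a + n)"
        using ab(3) g1_end by (simp add: touches_right_def h_def g_def g2_def splice_def)
      show "touches_left (\<lambda>k. action p (g k)) (int M) (b' + n + n)"
        using ab'(4) later[of b'] False by (simp add: touches_left_def h_def)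
      show "touches_right (\<lambda>k. action p (g k)) (int M) (a' + n + n)"
        using ab'(3) later[of a'] False ba' by (simp add: touches_right_def h_def)
    qed (use False ba' ab' in auto)
    then show False using short[OF i6(2)] d(4) aN by (simp add: M_def)
  qed
qed

end
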